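(* Let $\alpha\ge 1$ and let $X_1,\dots,X_n$ be iid gamma$(\alpha,1)$ random variables. For a nonnegative weight vector $\theta=(\theta_1,\dots,\theta_n)$ let $F_\theta$ denote the distribution function of $\sum_{i=1}^n\theta_iX_i$. If $\theta,\eta$ are nonnegative weight vectors in $\mathbb{R}^n$ such that $\eta\prec\theta$ and $\theta$ is not a permutation of $\eta$, then $F_\eta(x)-F_\theta(x)$ changes signs exactly once, from $-$ to $+$, as $x$ increases from $0$ to $\infty$.
   Context: gamma$(\alpha,1)$ has density $t^{\alpha-1}e^{-t}/\Gamma(\alpha)$ on $(0,\infty)$. $\eta\prec\theta$ denotes majorization: with $\theta_{(1)}\le\dots\le\theta_{(n)}$ the increasing rearrangement, $\sum_{i=1}^l\eta_{(i)}\ge\sum_{i=1}^l\theta_{(i)}$ for $1\le l\le n$, with equality at $l=n$. Sign changes of a function on $(0,\infty)$ are counted in the usual way, discarding zeros. *)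

theory Defs
  imports "HOL-Probability.Probability"
begin

definition gamma_density :: "real \<Rightarrow> real \<Rightarrow> real" where
  "gamma_density \<alpha> t = (if t > 0 then t powr (\<alpha> - 1) * exp (- t) / Gamma \<alpha> else 0)"

text \<open>
  A vector in \<open>\<real>\<^sup>n\<close> is a list of length \<open>n\<close>, with components \<open>\<theta> ! 0, \<dots>, \<theta> ! (n - 1)\<close>; its
  increasing rearrangement is \<open>sort \<theta>\<close>. The direction of the inequality is the one for the sums
  of the smallest entries.
\<close>

definition majorized_by :: "real list \<Rightarrow> real list \<Rightarrow> bool" (infix "\<prec>\<^sub>m" 50) where
  "\<eta> \<prec>\<^sub>m \<theta> \<longleftrightarrow> length \<eta> = length \<theta> \<and>
     (\<forall>l\<in>{1..length \<theta>}. sum_list (take l (sort \<eta>)) \<ge> sum_list (take l (sort \<theta>))) \<and>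
     sum_list \<eta> = sum_list \<theta>"

definition weighted_sum_cdf ::
    "'a measure \<Rightarrow> (nat \<Rightarrow> 'a \<Rightarrow> real) \<Rightarrow> real list \<Rightarrow> real \<Rightarrow> real" where
  "weighted_sum_cdf M X \<theta> = cdf (distr M borel (\<lambda>\<omega>. \<Sum>i<length \<theta>. \<theta> ! i * X i \<omega>))"

definition seq_sign_changes :: "real list \<Rightarrow> nat" where
  "seq_sign_changes xs = length (remdups_adj (map sgn (filter (\<lambda>x. x \<noteq> 0) xs))) - 1"

text \<open>
  The number of sign changes of a function is the supremum, possibly infinite, of the number of
  sign changes of its values along finite increasing sequences of arguments.
\<close>

definition sign_changes_on :: "real set \<Rightarrow> (real \<Rightarrow> real) \<Rightarrow> enat" where
  "sign_changes_on S f =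
     (SUP xs\<in>{xs. sorted_wrt (<) xs \<and> set xs \<subseteq> S}. enat (seq_sign_changes (map f xs)))"

end

theory Submission
  imports Defs
begin

text \<open>
  With \<open>F z\<close> the distribution function of \<open>\<Sum>i. z i * X i\<close>, one has \<open>\<partial>F z / \<partial>z i = - \<alpha> * \<phi> i z\<close>, where
  \<open>\<phi> i z\<close> is the density of the sum with an independent exponential variable of mean \<open>z i\<close> added.
  Convolution with a log-concave density does not increase the number of sign changes. Hence, for
  \<open>z i \<le> z j \<le> z k < z l\<close> and \<open>A, C \<ge> 0\<close>, the function
  \<open>A * (\<phi> i z - \<phi> j z) + C * (\<phi> k z - \<phi> l z)\<close> changes sign at most once, from \<open>+\<close> to \<open>-\<close>; this
  reduces to the two coordinates \<open>k\<close>, \<open>l\<close>, where a Riccati equation for the ratio of the two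
  densities yields it.
  If \<open>F \<eta> x0 = F \<theta> x0\<close>, then \<open>\<eta>\<close> is moved towards \<open>\<theta>\<close> inside the level set of \<open>z \<mapsto> F z x0\<close>
  along such combinations, which does not increase \<open>F z y\<close> for \<open>y > x0\<close>: by compactness there is a
  minimiser of \<open>F z y + \<epsilon> * (\<Sum>i. \<bar>\<theta> i - z i\<bar>)\<close>, and it can only be \<open>\<theta>\<close>.
  So \<open>F \<eta> - F \<theta>\<close> never goes from \<open>+\<close> to \<open>-\<close>. It takes
  both signs since the means agree while the second moment of \<open>\<theta>\<close> is strictly larger.
\<close>

text \<open>On a level set of \<open>F\<close> at \<open>x0\<close> the sum of the weights is not
  conserved, so majorization cannot be reduced to transfers between two coordinates: a pair move
  that keeps the value at \<open>x0\<close> has its ratio of increments dictated by the densities,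
  and this ratio may destroy the control of partial sums. When it does so both for a pair of small
  and for a pair of large weights, the two pair moves can be made sum-preserving and balanced
  against each other at \<open>x0\<close>. This is why four exponential means must be compared at
  once. The sign patterns yield only a nonstrict first-order inequality at \<open>y\<close>. The
  penalty with factor \<open>\<epsilon>\<close> turns it into a strict decrease: it pays for the
  remainder terms and for the correction that returns to the level set. The assumption
  \<open>1 \<le> \<alpha>\<close> enters twice: it makes the gamma kernels log-concave, and it gives
  \<open>1 \<le> 2 * \<alpha> - 1\<close> in the final inequality for the Riccati equation.\<close>

section \<open>Log-concave kernels and sign changes\<close>

text \<open>Only positivity is recorded; zero and negative values are not distinguished. Beyond a
  zero \<open>x0\<close> the function is therefore nonpositive, which is the consequence that the
  level-set argument extracts.\<close>

definition pm_sign :: "(real \<Rightarrow> real) \<Rightarrow> bool" where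
  "pm_sign d \<longleftrightarrow> (\<forall>x y. 0 < x \<and> x < y \<and> 0 < d y \<longrightarrow> 0 < d x)"

text \<open>This is total positivity of order two of \<open>k (x - y)\<close>, a form that makes
  sense for kernels vanishing on a half-line and that passes to difference quotients without
  logarithms.\<close>

definition log_concave :: "(real \<Rightarrow> real) \<Rightarrow> bool" where
  "log_concave k \<longleftrightarrow> (\<forall>p q h. p \<le> q \<and> 0 \<le> h \<longrightarrow> k p * k (q + h) \<le> k (p + h) * k q)"

definition conv :: "(real \<Rightarrow> real) \<Rightarrow> (real \<Rightarrow> real) \<Rightarrow> real \<Rightarrow> real" where
  "conv k d x = (LINT y|lborel. k (x - y) * d y)"

lemma integrable_reflect_shift:
  fixes k :: "real \<Rightarrow> real"
  assumes "integrable lborel k"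
  shows "integrable lborel (\<lambda>y. k (x - y))"
  using lborel_integrable_real_affine[OF assms, of "-1" x] by simp

lemma integrable_conv:
  fixes k d :: "real \<Rightarrow> real"
  assumes "integrable lborel k" "d \<in> borel_measurable borel" "\<And>y. \<bar>d y\<bar> \<le> B"
  shows "integrable lborel (\<lambda>y. k (x - y) * d y)"
proof -
  have i: "integrable lborel (\<lambda>y. k (x - y))"
    by (rule integrable_reflect_shift[OF assms(1)])
  show ?thesis
  proof (rule Bochner_Integration.integrable_bound[OF integrable_mult_right[OF i, of B]])
    show "(\<lambda>y. k (x - y) * d y) \<in> borel_measurable lborel"
      using borel_measurable_integrable[OF i] assms(2) by simp
    show "AE y in lborel. norm (k (x - y) * d y) \<le> norm (B * k (x - y))"
    proof (rule AE_I2)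
      fix y
      have "\<bar>d y\<bar> \<le> \<bar>B\<bar>" using assms(3)[of y] by linarith
      then show "norm (k (x - y) * d y) \<le> norm (B * k (x - y))"
        by (simp add: abs_mult mult.commute mult_right_mono)
    qed
  qed
qed

lemma conv_commute: "conv k d x = conv d k x"
proof -
  have "(LINT y|lborel. k (x - y) * d y) = \<bar>-1\<bar> *\<^sub>R (LINT y|lborel. k (x - (x + -1 * y)) * d (x + -1 * y))"
    by (rule lborel_integral_real_affine) simp
  then show ?thesis
    by (simp add: conv_def mult.commute)
qed

text \<open>
  Variation diminution: the comparison with the value of the kernel at the sign change \<open>m\<close> of
  \<open>d\<close> turns log-concavity into a pointwise inequality of the integrands.
\<close>

lemma conv_compare:
  fixes k d :: "real \<Rightarrow> real"
  assumes lc: "log_concave k" and "x \<le> x'"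
    and "\<And>y. y < m \<Longrightarrow> 0 \<le> d y" "\<And>y. m < y \<Longrightarrow> d y \<le> 0"
    and int: "integrable lborel (\<lambda>y. k (x - y) * d y)" "integrable lborel (\<lambda>y. k (x' - y) * d y)"
  shows "k (x - m) * conv k d x' \<le> k (x' - m) * conv k d x"
proof -
  have "(LINT y|lborel. k (x - m) * (k (x' - y) * d y)) \<le> (LINT y|lborel. k (x' - m) * (k (x - y) * d y))"
  proof (rule integral_mono)
    fix y :: real
    have L: "k p * k (q + h) \<le> k (p + h) * k q" if "p \<le> q" "0 \<le> h" for p q h
      using lc that unfolding log_concave_def by blast
    consider "y < m" | "m < y" | "y = m" by linarith
    then show "k (x - m) * (k (x' - y) * d y) \<le> k (x' - m) * (k (x - y) * d y)"
    proof cases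
      case 1
      then have "k (x - m) * k (x' - y) \<le> k (x' - m) * k (x - y)"
        using L[of "x - m" "x - y" "x' - x"] \<open>x \<le> x'\<close> by simp
      then have "k (x - m) * k (x' - y) * d y \<le> k (x' - m) * k (x - y) * d y"
        using assms(3)[OF 1] by (intro mult_right_mono)
      then show ?thesis by (simp add: mult.assoc)
    next
      case 2
      then have "k (x' - m) * k (x - y) \<le> k (x - m) * k (x' - y)"
        using L[of "x - y" "x - m" "x' - x"] \<open>x \<le> x'\<close> by (simp add: mult.commute)
      then have "k (x - m) * k (x' - y) * d y \<le> k (x' - m) * k (x - y) * d y"
        using assms(4)[OF 2] by (intro mult_right_mono_neg)
      then show ?thesis by (simp add: mult.assoc)
    qed simp
  qed (use int in auto)
  then show ?thesis
    by (simp add: conv_def)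
qed

lemma conv_eq_0:
  assumes "\<And>y. y \<le> 0 \<Longrightarrow> k y = 0" "\<And>y. y \<le> 0 \<Longrightarrow> d y = 0" "x \<le> 0"
  shows "conv k d x = 0"
proof -
  have "(\<lambda>y. k (x - y) * d y) = (\<lambda>_. 0)"
  proof
    show "k (x - y) * d y = 0" for y
      using assms by (cases "y \<le> 0") auto
  qed
  then show ?thesis by (simp add: conv_def)
qed

lemma conv_nonneg: "(\<And>y. 0 \<le> k y) \<Longrightarrow> (\<And>y. 0 \<le> d y) \<Longrightarrow> 0 \<le> conv k d x"
  unfolding conv_def by (intro Bochner_Integration.integral_nonneg) simp

lemma conv_nonpos:
  assumes "\<And>y. 0 \<le> k y" "\<And>y. d y \<le> 0"
  shows "conv k d x \<le> 0"
  using conv_nonneg[of k "\<lambda>y. - d y" x] assms by (simp add: conv_def)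

text \<open>As \<open>k\<close> lives on the positive half-line, only the values of \<open>d\<close>
  below \<open>x\<close> enter; \<open>d\<close> may change sign from \<open>x\<close> on.\<close>

lemma conv_pos:
  fixes k d :: "real \<Rightarrow> real"
  assumes "\<And>y. y \<le> 0 \<Longrightarrow> k y = 0" "\<And>y. 0 < y \<Longrightarrow> 0 < k y"
    and "\<And>y. y \<le> 0 \<Longrightarrow> d y = 0" "\<And>y. 0 < y \<Longrightarrow> y < x \<Longrightarrow> 0 < d y" and "0 < x"
    and int: "integrable lborel (\<lambda>y. k (x - y) * d y)"
  shows "0 < conv k d x"
proof -
  have nn: "0 \<le> k (x - y) * d y" for y
    using assms(1)[of "x - y"] assms(2)[of "x - y"] assms(3)[of y] assms(4)[of y]
    by (cases "y \<le> 0"; cases "x \<le> y") auto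
  have "conv k d x \<noteq> 0"
  proof
    assume "conv k d x = 0"
    then have "AE y in lborel. k (x - y) * d y = 0"
      using integral_nonneg_eq_0_iff_AE[OF int] nn by (simp add: conv_def)
    then have "AE y in lborel. y \<notin> {0<..<x}"
    proof eventually_elim
      case (elim y)
      then show ?case
        using assms(2)[of "x - y"] assms(4)[of y] by auto
    qed
    then have "emeasure lborel {0<..<x} = 0"
      by (subst (asm) AE_iff_measurable[of "{0<..<x}"]) auto
    with \<open>0 < x\<close> show False by simp
  qed
  moreover have "0 \<le> conv k d x"
    using nn by (simp add: conv_def)
  ultimately show ?thesis by simp
qed

text \<open>If \<open>d\<close> is positive somewhere at or beyond \<open>x\<close>, it is positive
  on all of \<open>(0, x)\<close> and \<open>conv_pos\<close> applies. Otherwise the sign change of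
  \<open>d\<close> lies at or before \<open>x\<close>, and \<open>conv_compare\<close> carries
  positivity from \<open>x'\<close> back to \<open>x\<close>.\<close>

lemma pm_sign_conv:
  fixes k d :: "real \<Rightarrow> real"
  assumes lc: "log_concave k"
    and k: "\<And>y. y \<le> 0 \<Longrightarrow> k y = 0" "\<And>y. 0 < y \<Longrightarrow> 0 < k y"
    and d: "\<And>y. y \<le> 0 \<Longrightarrow> d y = 0" and pm: "pm_sign d"
    and int: "\<And>x. integrable lborel (\<lambda>y. k (x - y) * d y)"
  shows "pm_sign (conv k d)"
  unfolding pm_sign_def
proof (intro allI impI, elim conjE)
  fix x x' :: real
  assume x: "0 < x" "x < x'" and pos: "0 < conv k d x'"
  have down: "0 < d u" if "0 < u" "u \<le> v" "0 < d v" for u v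
    using pm that unfolding pm_sign_def by (metis order_le_less)
  define P where "P = {y. 0 < y \<and> 0 < d y}"
  show "0 < conv k d x"
  proof (cases "\<exists>v\<in>P. x \<le> v")
    case True
    then obtain v where "0 < d v" "x \<le> v"
      by (auto simp: P_def)
    then have "0 < d y" if "0 < y" "y < x" for y
      using down[of y v] that by simp
    then show ?thesis
      using x(1) by (intro conv_pos k d int)
  next
    case False
    have "P \<noteq> {}"
    proof
      assume "P = {}"
      then have "d y \<le> 0" for y
        using d[of y] by (cases "y \<le> 0") (auto simp: P_def not_less)
      moreover have "0 \<le> k y" for y
        using k[of y] by (cases "y \<le> 0") auto
      ultimately have "conv k d x' \<le> 0"
        by (intro conv_nonpos)
      with pos show False by simp
    qed
    have bdd: "bdd_above P"
      using False by (intro bdd_aboveI[of _ x]) auto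
    \<comment> \<open>The sign change of \<open>d\<close>. Here \<open>m \<le> x\<close>; the
      boundary case \<open>m = x\<close> needs its own argument because \<open>k (x - m)\<close>
      vanishes there.\<close>
    define m where "m = Sup P"
    have "0 \<le> d y" if "y < m" for y
    proof (cases "y \<le> 0")
      case False
      obtain v where "v \<in> P" "y < v"
        using \<open>y < m\<close> \<open>P \<noteq> {}\<close> bdd unfolding m_def by (auto simp: less_cSup_iff)
      then show ?thesis
        using down[of y v] False by (auto simp: P_def)
    qed (simp add: d)
    moreover have "d y \<le> 0" if "m < y" for y
    proof -
      have "0 < m"
        using \<open>P \<noteq> {}\<close> bdd unfolding m_def by (auto simp: less_cSup_iff P_def)
      then show ?thesis
        using that cSup_upper[OF _ bdd, of y] by (auto simp: P_def m_def not_less[symmetric])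
    qed
    ultimately have cmp: "k (x - m) * conv k d x' \<le> k (x' - m) * conv k d x"
      using x int by (intro conv_compare lc) auto
    show ?thesis
    proof (cases "m < x")
      case True
      then have "0 < k (x' - m) * conv k d x"
        using cmp pos k(2)[of "x - m"] by (intro less_le_trans[OF _ cmp]) simp
      then show ?thesis
        using k(2)[of "x' - m"] x True by (simp add: zero_less_mult_iff)
    next
      case False
      have "0 < d y" if "0 < y" "y < x" for y
      proof -
        have "y < m" using that False by simp
        then obtain v where "v \<in> P" "y < v"
          using \<open>P \<noteq> {}\<close> bdd unfolding m_def by (auto simp: less_cSup_iff)
        then show ?thesis
          using down[of y v] that by (auto simp: P_def)
      qed
      then show ?thesis
        using x by (intro conv_pos k d int) auto
    qed
  qed
qed

lemma conv_shift:
  "conv k (\<lambda>y. d (y + h)) x = conv k d (x + h)"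
proof -
  have "(LINT y|lborel. k (x + h - y) * d y) = \<bar>1\<bar> *\<^sub>R (LINT y|lborel. k (x + h - (h + 1 * y)) * d (h + 1 * y))"
    by (rule lborel_integral_real_affine) simp
  then show ?thesis
    by (simp add: conv_def algebra_simps)
qed

text \<open>For fixed \<open>h\<close> and \<open>c\<close> the function
  \<open>g (y + h) - c * g y\<close> changes sign at most once, from + to -, by log-concavity of
  \<open>g\<close>, and convolution with \<open>k\<close> preserves this. So the ratio of
  \<open>conv k g (x + h)\<close> to \<open>conv k g x\<close> cannot exceed a level after having
  been below it: it decreases in \<open>x\<close>.\<close>

lemma log_concave_conv:
  fixes k g :: "real \<Rightarrow> real"
  assumes lk: "log_concave k" and lg: "log_concave g"
    and k: "\<And>y. y \<le> 0 \<Longrightarrow> k y = 0" "\<And>y. 0 < y \<Longrightarrow> 0 < k y"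
    and g: "\<And>y. y \<le> 0 \<Longrightarrow> g y = 0" "\<And>y. 0 < y \<Longrightarrow> 0 < g y"
    and int: "\<And>x. integrable lborel (\<lambda>y. k (x - y) * g y)"
  shows "log_concave (conv k g)"
proof -
  have k0: "0 \<le> k y" for y using k[of y] by (cases "y \<le> 0") auto
  have g0: "0 \<le> g y" for y using g[of y] by (cases "y \<le> 0") auto
  have c0: "conv k g x = 0" if "x \<le> 0" for x
    using that k g by (intro conv_eq_0) auto
  have cpos: "0 < conv k g x" if "0 < x" for x
    using that k g int by (intro conv_pos) auto
  show ?thesis
    unfolding log_concave_def
  proof (intro allI impI, elim conjE)
    fix x x' h :: real
    assume "x \<le> x'" "0 \<le> h"
    show "conv k g x * conv k g (x' + h) \<le> conv k g (x + h) * conv k g x'"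
    proof (cases "x \<le> 0 \<or> h = 0 \<or> x = x'")
      case True
      then show ?thesis
        using c0[of x] conv_nonneg[of k g, OF k0 g0] by (auto simp: mult.commute)
    next
      case False
      with \<open>x \<le> x'\<close> \<open>0 \<le> h\<close> have x: "0 < x" "x < x'" "0 < h" by auto
      have ratio: "c * conv k g x \<le> conv k g (x + h)"
        if c: "0 \<le> c" "c * conv k g x' < conv k g (x' + h)" for c
      proof (rule ccontr)
        assume "\<not> c * conv k g x \<le> conv k g (x + h)"
        \<comment> \<open>This \<open>d\<close> is positive on \<open>(- h, 0]\<close>, so
          \<open>pm_sign_conv\<close> is not applicable and \<open>conv_compare\<close> is used
          directly at the sign change.\<close>
        define d where "d y = g (y + h) - c * g y" for y
        have down: "0 \<le> d u" if "0 < d v" "u < v" for u v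
        proof (cases "u \<le> 0")
          case True
          then show ?thesis using g(1)[OF True] g0[of "u + h"] by (simp add: d_def)
        next
          case False
          have "g u * g (v + h) \<le> g (u + h) * g v"
            using lg that(2) x(3) unfolding log_concave_def by simp
          moreover have "g u * (c * g v) \<le> g u * g (v + h)"
            using that(1) g0[of u] by (intro mult_left_mono) (auto simp: d_def)
          ultimately have "g v * (c * g u) \<le> g v * g (u + h)"
            by (simp add: algebra_simps)
          then show ?thesis
            using g(2)[of v] False \<open>u < v\<close> by (simp add: d_def)
        qed
        have intd: "integrable lborel (\<lambda>y. k (z - y) * d y)" for z
        proof -
          have "integrable lborel (\<lambda>y. k (z + h - y) * g y)" by (rule int)
          from lborel_integrable_real_affine[OF this, of 1 h]
          have "integrable lborel (\<lambda>y. k (z - y) * g (y + h))"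
            by (simp add: algebra_simps)
          from Bochner_Integration.integrable_diff[OF this integrable_mult_right[OF int[of z], of c]]
          show ?thesis by (simp add: d_def algebra_simps)
        qed
        have cd: "conv k d z = conv k g (z + h) - c * conv k g z" for z
        proof -
          have i1: "integrable lborel (\<lambda>y. k (z - y) * g (y + h))"
            using lborel_integrable_real_affine[OF int[of "z + h"], of 1 h] by (simp add: algebra_simps)
          have "conv k d z = (LINT y|lborel. k (z - y) * g (y + h) - c * (k (z - y) * g y))"
            unfolding conv_def d_def by (simp add: algebra_simps)
          also have "\<dots> = conv k (\<lambda>y. g (y + h)) z - c * conv k g z"
            using i1 int[of z] by (simp add: conv_def)
          finally show ?thesis by (simp add: conv_shift)
        qed
        have neg: "conv k d x < 0" and pos: "0 < conv k d x'"
          using cd c \<open>\<not> _ \<le> _\<close> by auto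
        have "\<exists>v. 0 < d v"
        proof (rule ccontr)
          assume "\<nexists>v. 0 < d v"
          then have "conv k d x' \<le> 0"
            using k0 by (intro conv_nonpos) (auto simp: not_less)
          with pos show False by simp
        qed
        have "\<exists>u. d u < 0"
        proof (rule ccontr)
          assume "\<nexists>u. d u < 0"
          then have "0 \<le> conv k d x"
            using k0 by (intro conv_nonneg) (auto simp: not_less)
          with neg show False by simp
        qed
        then obtain b where b: "d b < 0" by blast
        have bdd: "bdd_above {v. 0 < d v}"
          using down[of _ b] b by (intro bdd_aboveI[of _ b]) (force simp: not_less[symmetric])
        define m where "m = Sup {v. 0 < d v}"
        have "0 \<le> d y" if "y < m" for y
          using that down bdd \<open>\<exists>v. 0 < d v\<close> unfolding m_def by (subst (asm) less_cSup_iff) auto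
        moreover have "d y \<le> 0" if "m < y" for y
          using that cSup_upper[OF _ bdd, of y] by (auto simp: m_def not_less[symmetric])
        ultimately have cmp: "k (x - m) * conv k d x' \<le> k (x' - m) * conv k d x"
          using x intd by (intro conv_compare lk) auto
        show False
        proof (cases "m < x")
          case True
          then have "0 < k (x - m) * conv k d x'" "k (x' - m) * conv k d x < 0"
            using pos neg k(2)[of "x - m"] k(2)[of "x' - m"] x by (auto simp: mult_pos_neg)
          with cmp show False by simp
        next
          case False
          have "0 \<le> k (x - y) * d y" for y
          proof (cases "y < m")
            case True
            then show ?thesis using k0 \<open>\<And>y. y < m \<Longrightarrow> 0 \<le> d y\<close> by simp
          next
            case F2: False
            then show ?thesis using k(1)[of "x - y"] False by simp
          qed
          then have "0 \<le> conv k d x" by (simp add: conv_def)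
          with neg show False by simp
        qed
      qed
      define r where "r = conv k g (x' + h) / conv k g x'"
      have "r * conv k g x \<le> conv k g (x + h)"
      proof (rule field_le_epsilon)
        fix e :: real assume "0 < e"
        \<comment> \<open>\<open>ratio\<close> wants a nonnegative level strictly below
          \<open>r\<close>; this one loses at most \<open>e\<close> after multiplication by
          \<open>conv k g x\<close>.\<close>
        define c where "c = max 0 (r - e / conv k g x)"
        have r0: "0 < r" using cpos[of "x' + h"] cpos[of x'] x by (simp add: r_def)
        have "c < r" using \<open>0 < e\<close> cpos[of x] x r0 by (auto simp: c_def)
        then have "c * conv k g x' < conv k g (x' + h)"
          using cpos[of x'] x by (simp add: r_def field_simps)
        then have "c * conv k g x \<le> conv k g (x + h)"
          by (intro ratio) (simp_all add: c_def)
        moreover have "r * conv k g x \<le> c * conv k g x + e"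
        proof -
          have "(r - c) * conv k g x \<le> (e / conv k g x) * conv k g x"
            using cpos[of x] x by (intro mult_right_mono) (auto simp: c_def)
          then show ?thesis using cpos[of x] x by (simp add: algebra_simps)
        qed
        ultimately show "r * conv k g x \<le> conv k g (x + h) + e" by simp
      qed
      then show ?thesis
        using cpos[of x'] x by (simp add: r_def field_simps)
    qed
  qed
qed

section \<open>Gamma and exponential kernels\<close>

definition gamma_kernel :: "real \<Rightarrow> real \<Rightarrow> real \<Rightarrow> real" where
  "gamma_kernel a s u = gamma_density a (u / s) / s"

definition exp_kernel :: "real \<Rightarrow> real \<Rightarrow> real" where
  "exp_kernel s u = (if 0 < u then exp (- u / s) / s else 0)"

lemma gamma_density_nonneg: "0 < a \<Longrightarrow> 0 \<le> gamma_density a t"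
  by (simp add: gamma_density_def Gamma_real_pos less_imp_le)

lemma gamma_density_pos: "0 < a \<Longrightarrow> 0 < t \<Longrightarrow> 0 < gamma_density a t"
  by (simp add: gamma_density_def Gamma_real_pos)

lemma gamma_density_eq_0: "t \<le> 0 \<Longrightarrow> gamma_density a t = 0"
  by (simp add: gamma_density_def)

lemma gamma_density_measurable [measurable]: "gamma_density a \<in> borel_measurable borel"
  unfolding gamma_density_def by measurable

lemma gamma_density_Suc: "0 < a \<Longrightarrow> t * gamma_density a t = a * gamma_density (a + 1) t"
proof (cases "0 < t")
  case True
  assume "0 < a"
  then have "Gamma (a + 1) = a * Gamma a"
    by (intro Gamma_plus1) (auto elim!: nonpos_Ints_cases)
  moreover have "t powr a = t * t powr (a - 1)"
    using True by (simp add: powr_diff)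
  ultimately show ?thesis
    using True \<open>0 < a\<close> Gamma_real_pos[of a] by (simp add: gamma_density_def field_simps)
qed (simp add: gamma_density_def)

text \<open>Raise \<open>t / b \<le> exp (t / b)\<close> to the power \<open>b\<close>. The maximum
  with 1 covers \<open>b = 0\<close>, where \<open>b powr b\<close> is 0 by convention.\<close>

lemma powr_exp_bound:
  fixes b t :: real
  assumes "0 \<le> b" "0 < t"
  shows "t powr b * exp (- t) \<le> max 1 (b powr b)"
proof (cases "b = 0")
  case True
  then show ?thesis using assms by simp
next
  case False
  then have b: "0 < b" using assms by simp
  have "t / b \<le> exp (t / b)"
    using exp_ge_add_one_self[of "t / b"] by linarith
  then have "(t / b) powr b \<le> exp (t / b) powr b"
    using b assms by (intro powr_mono2) auto
  also have "\<dots> = exp t"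
    using b by (simp add: exp_powr_real)
  finally have "t powr b \<le> b powr b * exp t"
    using b assms by (simp add: powr_divide field_simps)
  then have "t powr b * exp (- t) \<le> b powr b"
    by (simp add: exp_minus field_simps)
  then show ?thesis by simp
qed

lemma gamma_density_bounded:
  assumes "1 \<le> a"
  obtains B where "\<And>t. \<bar>gamma_density a t\<bar> \<le> B" "0 < B"
proof
  define B where "B = max 1 ((a - 1) powr (a - 1)) / Gamma a"
  have G: "0 < Gamma a" using assms by (intro Gamma_real_pos) simp
  show "0 < B" using G by (auto simp: B_def less_max_iff_disj)
  fix t :: real
  show "\<bar>gamma_density a t\<bar> \<le> B"
  proof (cases "0 < t")
    case True
    have "t powr (a - 1) * exp (- t) \<le> max 1 ((a - 1) powr (a - 1))"
      using assms True by (intro powr_exp_bound) auto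
    then have "t powr (a - 1) * exp (- t) / Gamma a \<le> B"
      unfolding B_def using G by (intro divide_right_mono) auto
    then show ?thesis
      using True G by (simp add: gamma_density_def)
  next
    case False
    then show ?thesis using \<open>0 < B\<close> by (simp add: gamma_density_def)
  qed
qed

lemma gamma_kernel_eq_0: "0 < s \<Longrightarrow> u \<le> 0 \<Longrightarrow> gamma_kernel a s u = 0"
  by (simp add: gamma_kernel_def gamma_density_def zero_less_divide_iff)

lemma gamma_kernel_pos: "0 < a \<Longrightarrow> 0 < s \<Longrightarrow> 0 < u \<Longrightarrow> 0 < gamma_kernel a s u"
  by (simp add: gamma_kernel_def gamma_density_pos)

lemma gamma_kernel_nonneg: "0 < a \<Longrightarrow> 0 < s \<Longrightarrow> 0 \<le> gamma_kernel a s u"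
  by (simp add: gamma_kernel_def gamma_density_nonneg)

lemma gamma_kernel_measurable [measurable]: "gamma_kernel a s \<in> borel_measurable borel"
  unfolding gamma_kernel_def by measurable

lemma gamma_kernel_bounded:
  assumes "1 \<le> a" "0 < s"
  obtains B where "\<And>u. \<bar>gamma_kernel a s u\<bar> \<le> B" "0 < B"
proof -
  obtain B where "\<And>t. \<bar>gamma_density a t\<bar> \<le> B" "0 < B"
    using gamma_density_bounded assms by blast
  then show ?thesis
    using assms by (intro that[of "B / s"]) (auto simp: gamma_kernel_def divide_right_mono)
qed

lemma gamma_kernel_integrable:
  assumes "integrable lborel (gamma_density a)" "0 < s"
  shows "integrable lborel (gamma_kernel a s)"
proof -
  have "integrable lborel (\<lambda>u. gamma_density a (0 + (1 / s) * u))"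
    using assms by (intro lborel_integrable_real_affine) auto
  then show ?thesis
    unfolding gamma_kernel_def by simp
qed

lemma gamma_kernel_Suc:
  assumes "0 < a" "0 < s"
  shows "u * gamma_kernel a s u = a * s * gamma_kernel (a + 1) s u"
  using gamma_density_Suc[OF assms(1), of "u / s"] assms by (simp add: gamma_kernel_def field_simps)

lemma exp_kernel_measurable [measurable]: "exp_kernel s \<in> borel_measurable borel"
  unfolding exp_kernel_def by measurable

lemma exp_kernel_nonneg: "0 < s \<Longrightarrow> 0 \<le> exp_kernel s u"
  by (simp add: exp_kernel_def)

lemma exp_kernel_eq_0: "u \<le> 0 \<Longrightarrow> exp_kernel s u = 0"
  by (simp add: exp_kernel_def)

lemma exp_kernel_pos: "0 < s \<Longrightarrow> 0 < u \<Longrightarrow> 0 < exp_kernel s u"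
  by (simp add: exp_kernel_def)

lemma exp_kernel_le: "0 < s \<Longrightarrow> \<bar>exp_kernel s u\<bar> \<le> 1 / s"
  by (simp add: exp_kernel_def divide_right_mono)

lemma exp_kernel_diff_bounded:
  assumes "0 < s" "0 < t"
  shows "\<bar>a * exp_kernel s u - b * exp_kernel t u\<bar> \<le> \<bar>a\<bar> * (1 / s) + \<bar>b\<bar> * (1 / t)"
proof -
  have "\<bar>a * exp_kernel s u - b * exp_kernel t u\<bar> \<le> \<bar>a\<bar> * \<bar>exp_kernel s u\<bar> + \<bar>b\<bar> * \<bar>exp_kernel t u\<bar>"
    by (simp add: abs_mult[symmetric] abs_triangle_ineq4)
  also have "\<dots> \<le> \<bar>a\<bar> * (1 / s) + \<bar>b\<bar> * (1 / t)"
    using assms by (intro add_mono mult_left_mono exp_kernel_le) auto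
  finally show ?thesis .
qed

text \<open>The inequality \<open>p * (q + h) \<le> (p + h) * q\<close> gives the claim for the
  affine factor and, as \<open>a - 1\<close> is nonnegative, for the power; the exponential factors
  agree on both sides. The affine factor makes room for mixtures of the shapes \<open>a\<close> and
  \<open>a + 1\<close>.\<close>

lemma log_concave_gamma_kernel_affine:
  assumes "1 \<le> a" "0 < s" "0 \<le> b" "0 \<le> c"
  shows "log_concave (\<lambda>u. (b + c * u) * gamma_kernel a s u)"
  unfolding log_concave_def
proof (intro allI impI, elim conjE)
  fix p q h :: real
  assume pq: "p \<le> q" "0 \<le> h"
  show "(b + c * p) * gamma_kernel a s p * ((b + c * (q + h)) * gamma_kernel a s (q + h))
    \<le> (b + c * (p + h)) * gamma_kernel a s (p + h) * ((b + c * q) * gamma_kernel a s q)"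
  proof (cases "0 < p")
    case False
    have nn: "0 \<le> (b + c * v) * gamma_kernel a s v" for v
    proof (cases "0 < v")
      case True
      then have "0 \<le> b + c * v" using assms by simp
      then show ?thesis
        using assms gamma_kernel_nonneg[of a s v] by simp
    qed (use gamma_kernel_eq_0[of s v a] assms in simp)
    have "0 \<le> (b + c * (p + h)) * gamma_kernel a s (p + h) * ((b + c * q) * gamma_kernel a s q)"
      by (intro mult_nonneg_nonneg[OF nn nn])
    then show ?thesis
      using False gamma_kernel_eq_0[of s p a] assms(2) by simp
  next
    case True
    have prod: "p * (q + h) \<le> (p + h) * q"
      using pq True by (simp add: algebra_simps mult_left_mono mult_right_mono)
    have "p / s * ((q + h) / s) = p * (q + h) / (s * s)" "(p + h) / s * (q / s) = (p + h) * q / (s * s)"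
      by simp_all
    then have "(p / s * ((q + h) / s)) powr (a - 1) \<le> ((p + h) / s * (q / s)) powr (a - 1)"
      using prod True pq assms by (intro powr_mono2) (auto intro!: divide_right_mono)
    then have pw: "(p / s) powr (a - 1) * ((q + h) / s) powr (a - 1)
        \<le> ((p + h) / s) powr (a - 1) * (q / s) powr (a - 1)"
      using True pq assms(2) by (subst (asm) (1 2) powr_mult) auto
    have aff: "(b + c * p) * (b + c * (q + h)) \<le> (b + c * (p + h)) * (b + c * q)"
    proof -
      have "c * c * (p * (q + h)) \<le> c * c * ((p + h) * q)"
        using prod assms by (intro mult_left_mono) auto
      then show ?thesis by (simp add: algebra_simps)
    qed
    have ap: "((b + c * p) * (b + c * (q + h))) * ((p / s) powr (a - 1) * ((q + h) / s) powr (a - 1))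
        \<le> ((b + c * (p + h)) * (b + c * q)) * (((p + h) / s) powr (a - 1) * (q / s) powr (a - 1))"
    proof (rule mult_mono[OF aff pw])
      show "0 \<le> (b + c * (p + h)) * (b + c * q)"
        using True pq assms by (intro mult_nonneg_nonneg add_nonneg_nonneg) auto
    qed simp
    define K where "K v = exp (- (v / s)) / (Gamma a * s)" for v
    have K: "K p * K (q + h) = K (p + h) * K q"
      by (simp add: K_def exp_add[symmetric] add_divide_distrib)
    have K0: "0 \<le> K p * K (q + h)"
      using Gamma_real_pos[of a] assms by (simp add: K_def)
    have eq: "(b + c * v) * gamma_kernel a s v = (b + c * v) * (v / s) powr (a - 1) * K v" if "0 < v" for v
      using that assms by (simp add: gamma_kernel_def gamma_density_def K_def)
    have pos: "0 < q" "0 < q + h" "0 < p + h" using True pq by auto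
    have "(b + c * p) * (b + c * (q + h)) * ((p / s) powr (a - 1) * ((q + h) / s) powr (a - 1)) * (K p * K (q + h))
        \<le> (b + c * (p + h)) * (b + c * q) * (((p + h) / s) powr (a - 1) * (q / s) powr (a - 1)) * (K (p + h) * K q)"
      using mult_right_mono[OF ap K0] by (simp only: K)
    then show ?thesis
      unfolding eq[OF True] eq[OF pos(1)] eq[OF pos(2)] eq[OF pos(3)]
      by (simp only: ac_simps)
  qed
qed

lemma log_concave_gamma_kernel: "1 \<le> a \<Longrightarrow> 0 < s \<Longrightarrow> log_concave (gamma_kernel a s)"
  using log_concave_gamma_kernel_affine[of a s 1 0] by simp

lemma has_integral_unique_lborel:
  fixes f :: "real \<Rightarrow> real"
  assumes "integrable lborel f" "(f has_integral v) UNIV"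
  shows "(LINT x|lborel. f x) = v"
  using has_integral_integral_lborel[OF assms(1)] assms(2) has_integral_unique by blast

text \<open>The exponential is the gamma law of shape 1 with the same scale, so the shapes add. In
  the integral the exponential factors combine to a constant and only a power of \<open>y\<close>
  remains.\<close>

lemma conv_gamma_exp_kernel:
  assumes a: "1 \<le> a" and s: "0 < s" and int: "integrable lborel (gamma_density a)"
  shows "conv (gamma_kernel a s) (exp_kernel s) x = gamma_kernel (a + 1) s x"
proof (cases "0 < x")
  case False
  then show ?thesis
    using s by (subst conv_eq_0) (auto simp: gamma_kernel_eq_0 exp_kernel_eq_0)
next
  case True
  have i1: "integrable lborel (\<lambda>y. gamma_kernel a s (x - y) * exp_kernel s y)"
    using a s int exp_kernel_le by (intro integrable_conv gamma_kernel_integrable) auto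
  have i2: "integrable lborel (\<lambda>y. exp_kernel s (x - y) * gamma_kernel a s y)"
    using lborel_integrable_real_affine[OF i1, of "-1" x] by (simp add: mult.commute)
  define C where "C = exp (- x / s) / (s * s * s powr (a - 1) * Gamma a)"
  have "((\<lambda>y. y powr (a - 1)) has_integral (x powr (a - 1 + 1) / (a - 1 + 1))) {0..x}"
    using a True by (intro has_integral_powr_from_0) auto
  from has_integral_mult_right[OF this, of C]
  have hi: "((\<lambda>y. C * y powr (a - 1)) has_integral (C * (x powr a / a))) {0..x}"
    by simp
  have "((\<lambda>y. exp_kernel s (x - y) * gamma_kernel a s y) has_integral (C * (x powr a / a))) {0..x}"
  proof (rule has_integral_spike_finite[OF _ _ hi])
    show "finite {0, x}" by simp
    fix y assume "y \<in> {0..x} - {0, x}"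
    then have y: "0 < y" "y < x" by auto
    have "exp (- (x - y) / s) * exp (- (y / s)) = exp (- x / s)"
      by (simp add: exp_add[symmetric] diff_divide_distrib)
    then show "exp_kernel s (x - y) * gamma_kernel a s y = C * y powr (a - 1)"
      using y s by (simp add: exp_kernel_def gamma_kernel_def gamma_density_def C_def powr_divide field_simps)
  qed
  then have "((\<lambda>y. exp_kernel s (x - y) * gamma_kernel a s y) has_integral (C * (x powr a / a))) UNIV"
    by (rule has_integral_on_superset) (use s in \<open>auto simp: gamma_kernel_eq_0 exp_kernel_eq_0 not_le\<close>)
  then have "conv (exp_kernel s) (gamma_kernel a s) x = C * (x powr a / a)"
    unfolding conv_def using i2 has_integral_unique_lborel by blast
  also have "\<dots> = gamma_kernel (a + 1) s x"
  proof -
    have "Gamma (a + 1) = a * Gamma a"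
      using a by (intro Gamma_plus1) (auto elim!: nonpos_Ints_cases)
    moreover have "s powr a = s * s powr (a - 1)"
      using s by (simp add: powr_diff)
    ultimately show ?thesis
      using True s a Gamma_real_pos[of a]
      by (simp add: gamma_kernel_def gamma_density_def C_def powr_divide field_simps)
  qed
  finally show ?thesis
    by (simp add: conv_commute)
qed

text \<open>The operator \<open>y + s y'\<close> inverts the convolution with \<^term>\<open>exp_kernel s\<close>.\<close>

lemma pm_sign_exp_operator:
  fixes y y' :: "real \<Rightarrow> real"
  assumes s: "0 < s" and y0: "y 0 = 0" and cont: "continuous_on {0..} y"
    and der: "\<And>x. 0 < x \<Longrightarrow> (y has_real_derivative y' x) (at x)"
    and pm: "pm_sign (\<lambda>x. y x + s * y' x)"
  shows "pm_sign y"
  unfolding pm_sign_def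
proof (intro allI impI, elim conjE)
  fix x x' :: real
  assume x: "0 < x" "x < x'" and pos: "0 < y x'"
  \<comment> \<open>Integrating factor: \<open>y + s * y'\<close> has the sign of \<open>E'\<close>.
    If \<open>y x \<le> 0 < y x'\<close>, then \<open>E'\<close> is positive at some point after
    \<open>x\<close>, hence at all earlier points, and \<open>E\<close> would have risen from
    \<open>E 0 = 0\<close> to a positive value at \<open>x\<close>.\<close>
  define E where "E z = exp (z / s) * y z" for z
  define E' where "E' z = exp (z / s) * (y z + s * y' z) / s" for z
  have E: "(E has_real_derivative E' z) (at z)" if "0 < z" for z
    unfolding E_def E'_def using s
    by (auto intro!: derivative_eq_intros der[OF that] simp: field_simps)
  show "0 < y x"
  proof (rule ccontr)
    assume neg: "\<not> 0 < y x"
    have "\<exists>z>x. z < x' \<and> E x' - E x = (x' - x) * E' z"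
      using x by (intro MVT2 E) auto
    then obtain z where z: "x < z" "z < x'" "E x' - E x = (x' - x) * E' z" by blast
    have "0 < E x'" "E x \<le> 0"
      using pos neg by (auto simp: E_def mult_nonneg_nonpos not_less)
    then have "0 < (x' - x) * E' z"
      using z(3) by linarith
    then have "0 < E' z"
      using x(2) by (simp add: zero_less_mult_iff)
    then have "0 < y z + s * y' z"
      using s by (simp add: E'_def zero_less_mult_iff zero_less_divide_iff)
    then have E'pos: "0 < E' u" if "0 < u" "u < z" for u
    proof -
      have "0 < y u + s * y' u"
        using pm that \<open>0 < y z + s * y' z\<close> unfolding pm_sign_def by blast
      then show ?thesis using s by (simp add: E'_def)
    qed
    have "E 0 < E x"
    proof (rule DERIV_pos_imp_increasing_open[OF x(1)])
      fix u assume "0 < u" "u < x"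
      then show "\<exists>D. (E has_real_derivative D) (at u) \<and> 0 < D"
        using E E'pos z by (meson order.strict_trans)
    next
      show "continuous_on {0..x} E"
        unfolding E_def by (intro continuous_intros continuous_on_subset[OF cont]) (use s in auto)
    qed
    then show False
      using y0 neg by (simp add: E_def zero_less_mult_iff)
  qed
qed

section \<open>Weighted sums of gamma variables\<close>

locale iid_gamma = prob_space M for M :: "'a measure" +
  fixes X :: "nat \<Rightarrow> 'a \<Rightarrow> real" and \<alpha> :: real and n :: nat
  assumes \<alpha>: "1 \<le> \<alpha>"
    and indep: "indep_vars (\<lambda>_. borel) X {..<n}"
    and dist: "\<And>i. i < n \<Longrightarrow> distributed M lborel (X i) (\<lambda>t. ennreal (gamma_density \<alpha> t))"
begin

definition wsum :: "(nat \<Rightarrow> real) \<Rightarrow> nat set \<Rightarrow> 'a \<Rightarrow> real" where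
  "wsum z I \<omega> = (\<Sum>i\<in>I. z i * X i \<omega>)"

text \<open>Convolution of \<open>d\<close> with the law of the partial sum over \<open>I\<close>.
  As an expectation it also covers empty \<open>I\<close> and zero weights, where that law may have
  no density.\<close>

definition smear :: "(nat \<Rightarrow> real) \<Rightarrow> nat set \<Rightarrow> (real \<Rightarrow> real) \<Rightarrow> real \<Rightarrow> real" where
  "smear z I d x = expectation (\<lambda>\<omega>. d (x - wsum z I \<omega>))"

lemma X_measurable: "i < n \<Longrightarrow> X i \<in> borel_measurable M"
  using distributed_measurable[OF dist] by simp

lemma wsum_measurable: "I \<subseteq> {..<n} \<Longrightarrow> wsum z I \<in> borel_measurable M"
  unfolding wsum_def by (intro borel_measurable_sum borel_measurable_times X_measurable) auto

lemma gamma_density_integrable: "0 < n \<Longrightarrow> integrable lborel (gamma_density \<alpha>)"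
proof -
  assume "0 < n"
  then show ?thesis
    using distributed_integrable[OF dist[of 0], of "\<lambda>_. 1"] gamma_density_nonneg[of \<alpha>] \<alpha> by simp
qed

lemma indep_X_wsum:
  assumes "i < n" "I \<subseteq> {..<n}" "i \<notin> I"
  shows "indep_var borel (X i) borel (wsum z I)"
proof -
  have "indep_vars (\<lambda>_. borel) X (insert i I)"
    using indep by (rule indep_vars_subset) (use assms in auto)
  then have "indep_vars (\<lambda>_. borel) (\<lambda>j \<omega>. (if j = i then 1 else z j) * X j \<omega>) (insert i I)"
    by (rule indep_vars_compose2) auto
  then have "indep_var borel (\<lambda>\<omega>. (if i = i then 1 else z i) * X i \<omega>)
      borel (\<lambda>\<omega>. \<Sum>j\<in>I. (if j = i then 1 else z j) * X j \<omega>)"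
    using assms finite_subset[of I "{..<n}"] by (intro indep_vars_sum) auto
  moreover have "(\<Sum>j\<in>I. (if j = i then 1 else z j) * X j \<omega>) = wsum z I \<omega>" for \<omega>
    using assms(3) unfolding wsum_def by (intro sum.cong) auto
  ultimately show ?thesis by simp
qed

lemma expectation_gamma:
  assumes "i < n" "g \<in> borel_measurable borel"
  shows "expectation (\<lambda>\<omega>. g (X i \<omega>)) = (LINT u|lborel. gamma_density \<alpha> u * g u)"
  using distributed_integral[OF dist[OF assms(1)], of g] assms gamma_density_nonneg[of \<alpha>] \<alpha> by simp

text \<open>Fubini for \<open>X i\<close> and the independent sum over \<open>I\<close>. The first
  order of integration exhibits a convolution; the second integrates over \<open>X i\<close> with
  the other variables frozen, which is how atoms and derivatives in the weight \<open>z i\<close>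
  are treated.\<close>

lemma
  fixes g :: "real \<times> real \<Rightarrow> real"
  assumes i: "i < n" "I \<subseteq> {..<n}" "i \<notin> I"
    and g[measurable]: "g \<in> borel_measurable (borel \<Otimes>\<^sub>M borel)" and B: "\<And>p. \<bar>g p\<bar> \<le> B"
  shows expectation_split: "expectation (\<lambda>\<omega>. g (X i \<omega>, wsum z I \<omega>))
      = (LINT u|lborel. gamma_density \<alpha> u * expectation (\<lambda>\<omega>. g (u, wsum z I \<omega>)))" (is ?A)
    and expectation_split': "expectation (\<lambda>\<omega>. g (X i \<omega>, wsum z I \<omega>))
      = expectation (\<lambda>\<omega>. LINT u|lborel. gamma_density \<alpha> u * g (u, wsum z I \<omega>))" (is ?B)
proof -
  note [measurable] = X_measurable[OF i(1)] wsum_measurable[OF i(2), of z]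
  define D1 where "D1 = distr M borel (X i)"
  define D2 where "D2 = distr M borel (wsum z I)"
  interpret D1: prob_space D1 unfolding D1_def by (rule prob_space_distr) simp
  interpret D2: prob_space D2 unfolding D2_def by (rule prob_space_distr) simp
  interpret P: pair_prob_space D1 D2 ..
  have sets[measurable_cong]: "sets D1 = sets borel" "sets D2 = sets borel"
    by (simp_all add: D1_def D2_def)
  have joint: "distr M (borel \<Otimes>\<^sub>M borel) (\<lambda>\<omega>. (X i \<omega>, wsum z I \<omega>)) = D1 \<Otimes>\<^sub>M D2"
    using indep_X_wsum[OF i, of z] unfolding indep_var_distribution_eq D1_def D2_def by simp
  have int: "integrable (D1 \<Otimes>\<^sub>M D2) g"
    using B by (intro P.integrable_const_bound[where B = B]) auto
  have E: "expectation (\<lambda>\<omega>. g (X i \<omega>, wsum z I \<omega>)) = integral\<^sup>L (D1 \<Otimes>\<^sub>M D2) g"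
    unfolding joint[symmetric] by (subst integral_distr) auto
  have D1: "(LINT u|D1. h u) = (LINT u|lborel. gamma_density \<alpha> u * h u)" if "h \<in> borel_measurable borel" for h :: "real \<Rightarrow> real"
    using that expectation_gamma[OF i(1) that] unfolding D1_def by (subst integral_distr) auto
  have D2: "(LINT u|D2. h u) = expectation (\<lambda>\<omega>. h (wsum z I \<omega>))" if "h \<in> borel_measurable borel" for h :: "real \<Rightarrow> real"
    using that unfolding D2_def by (subst integral_distr) auto
  have "integral\<^sup>L (D1 \<Otimes>\<^sub>M D2) g = (LINT u|D1. LINT v|D2. g (u, v))"
    using P.integral_fst'[OF int] by simp
  also have "\<dots> = (LINT u|lborel. gamma_density \<alpha> u * (LINT v|D2. g (u, v)))"
    by (rule D1) measurable
  also have "\<dots> = (LINT u|lborel. gamma_density \<alpha> u * expectation (\<lambda>\<omega>. g (u, wsum z I \<omega>)))"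
    by (subst D2) auto
  finally show ?A using E by simp
  have "integral\<^sup>L (D1 \<Otimes>\<^sub>M D2) g = (LINT v|D2. LINT u|D1. g (u, v))"
    using P.integral_snd[of "\<lambda>u v. g (u, v)"] int by simp
  also have "\<dots> = (LINT v|D2. LINT u|lborel. gamma_density \<alpha> u * g (u, v))"
    by (subst D1) auto
  also have "\<dots> = expectation (\<lambda>\<omega>. LINT u|lborel. gamma_density \<alpha> u * g (u, wsum z I \<omega>))"
    by (rule D2) measurable
  finally show ?B using E by simp
qed

lemma smear_empty: "smear z {} d = d"
  by (simp add: smear_def wsum_def fun_eq_iff prob_space)

lemma smear_cong: "(\<And>i. i \<in> I \<Longrightarrow> z i = z' i) \<Longrightarrow> smear z I d = smear z' I d"
  by (simp add: smear_def wsum_def fun_eq_iff cong: sum.cong)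

lemma smear_insert:
  assumes i: "i < n" "I \<subseteq> {..<n}" "i \<notin> I"
    and d[measurable]: "d \<in> borel_measurable borel" and B: "\<And>y. \<bar>d y\<bar> \<le> B"
  shows "smear z (insert i I) d x = (LINT u|lborel. gamma_density \<alpha> u * smear z I d (x - z i * u))"
proof -
  have fin: "finite I" using i(2) finite_subset by auto
  have "smear z (insert i I) d x = expectation (\<lambda>\<omega>. (\<lambda>p. d (x - z i * fst p - snd p)) (X i \<omega>, wsum z I \<omega>))"
    using fin i(3) by (simp add: smear_def wsum_def diff_diff_eq)
  also have "\<dots> = (LINT u|lborel. gamma_density \<alpha> u * expectation (\<lambda>\<omega>. d (x - z i * fst (u, wsum z I \<omega>) - snd (u, wsum z I \<omega>))))"
    using B by (intro expectation_split i) auto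
  finally show ?thesis by (simp add: smear_def)
qed

lemma smear_insert_conv:
  assumes i: "i < n" "I \<subseteq> {..<n}" "i \<notin> I" and z: "0 < z i"
    and d: "d \<in> borel_measurable borel" "\<And>y. \<bar>d y\<bar> \<le> B"
  shows "smear z (insert i I) d = conv (gamma_kernel \<alpha> (z i)) (smear z I d)"
proof
  fix x
  have "(LINT u|lborel. gamma_density \<alpha> u * smear z I d (x - z i * u))
      = \<bar>1 / z i\<bar> *\<^sub>R (LINT u|lborel. gamma_density \<alpha> (0 + 1 / z i * u) * smear z I d (x - z i * (0 + 1 / z i * u)))"
    using z by (intro lborel_integral_real_affine) simp
  also have "\<dots> = (LINT u|lborel. gamma_kernel \<alpha> (z i) u * smear z I d (x - u))"
    using z unfolding gamma_kernel_def by (subst integral_scaleR_right[symmetric]) (simp add: field_simps)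
  also have "\<dots> = conv (smear z I d) (gamma_kernel \<alpha> (z i)) x"
    by (simp add: conv_def mult.commute)
  finally show "smear z (insert i I) d x = conv (gamma_kernel \<alpha> (z i)) (smear z I d) x"
    using smear_insert[OF i d] by (simp add: conv_commute)
qed

lemma smear_measurable:
  assumes "I \<subseteq> {..<n}" and [measurable]: "d \<in> borel_measurable borel"
  shows "smear z I d \<in> borel_measurable borel"
proof -
  note [measurable] = wsum_measurable[OF assms(1), of z]
  show ?thesis unfolding smear_def by measurable
qed

lemma smear_bounded:
  assumes "I \<subseteq> {..<n}" and [measurable]: "d \<in> borel_measurable borel" and B: "\<And>y. \<bar>d y\<bar> \<le> B"
  shows "\<bar>smear z I d x\<bar> \<le> B"
proof -
  note [measurable] = wsum_measurable[OF assms(1), of z]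
  have int: "integrable M (\<lambda>\<omega>. d (x - wsum z I \<omega>))"
    using B by (intro integrable_const_bound[where B = B]) auto
  have "\<bar>smear z I d x\<bar> \<le> expectation (\<lambda>\<omega>. \<bar>d (x - wsum z I \<omega>)\<bar>)"
    unfolding smear_def by (rule integral_abs_bound)
  also have "\<dots> \<le> expectation (\<lambda>\<omega>. B)"
    using int B by (intro integral_mono) auto
  finally show ?thesis by (simp add: prob_space)
qed

lemma smear_add:
  assumes "I \<subseteq> {..<n}" and [measurable]: "d \<in> borel_measurable borel" "d' \<in> borel_measurable borel"
    and B: "\<And>y. \<bar>d y\<bar> \<le> B" and B': "\<And>y. \<bar>d' y\<bar> \<le> B'"
  shows "smear z I (\<lambda>y. a * d y + b * d' y) x = a * smear z I d x + b * smear z I d' x"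
proof -
  note [measurable] = wsum_measurable[OF assms(1), of z]
  have "integrable M (\<lambda>\<omega>. d (x - wsum z I \<omega>))"
    using B by (intro integrable_const_bound[where B = B]) auto
  moreover have "integrable M (\<lambda>\<omega>. d' (x - wsum z I \<omega>))"
    using B' by (intro integrable_const_bound[where B = B']) auto
  ultimately show ?thesis
    by (simp add: smear_def)
qed

lemma smear_exp_kernel_diff:
  assumes "I \<subseteq> {..<n}" "0 < s" "0 < t"
  shows "smear z I (\<lambda>u. a * exp_kernel s u - b * exp_kernel t u) x
    = a * smear z I (exp_kernel s) x - b * smear z I (exp_kernel t) x"
  using smear_add[of I "exp_kernel s" "exp_kernel t" "1 / s" "1 / t" z a "- b" x] assms exp_kernel_le
  by simp

lemma smear_kernel_integrable:
  assumes "i < n" "I \<subseteq> {..<n}" "0 < s"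
    and "d \<in> borel_measurable borel" "\<And>y. \<bar>d y\<bar> \<le> B"
  shows "integrable lborel (\<lambda>y. gamma_kernel \<alpha> s (x - y) * smear z I d y)"
  using assms smear_measurable[of I d z] smear_bounded[of I d B z]
  by (intro integrable_conv[where B = B] gamma_kernel_integrable gamma_density_integrable) auto

lemma smear_eq_0:
  assumes "finite I" "I \<subseteq> {..<n}" "\<And>i. i \<in> I \<Longrightarrow> 0 < z i"
    and d: "d \<in> borel_measurable borel" "\<And>y. \<bar>d y\<bar> \<le> B" "\<And>y. y \<le> 0 \<Longrightarrow> d y = 0"
    and "x \<le> 0"
  shows "smear z I d x = 0"
  using assms(1-3) \<open>x \<le> 0\<close>
proof (induction I arbitrary: x)
  case empty
  then show ?case using d by (simp add: smear_empty)
next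
  case (insert i I)
  show ?case
    using insert d gamma_kernel_eq_0[of "z i" _ \<alpha>]
    by (subst smear_insert_conv[where B = B]) (auto intro!: conv_eq_0)
qed

text \<open>Each further variable is a convolution with a log-concave kernel, so a sign pattern
  found after smearing with few coordinates survives all the others.\<close>

lemma pm_sign_smear_Un:
  assumes "finite J" "I \<union> J \<subseteq> {..<n}" "I \<inter> J = {}" "\<And>i. i \<in> I \<union> J \<Longrightarrow> 0 < z i"
    and d: "d \<in> borel_measurable borel" "\<And>y. \<bar>d y\<bar> \<le> B" "\<And>y. y \<le> 0 \<Longrightarrow> d y = 0"
    and pm: "pm_sign (smear z I d)"
  shows "pm_sign (smear z (J \<union> I) d)"
  using assms(1-4)
proof (induction J)
  case empty
  then show ?case using pm by simp
next
  case (insert j J)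
  have z: "0 < z j" "j < n" "J \<union> I \<subseteq> {..<n}" "j \<notin> J \<union> I" and fin: "finite (J \<union> I)"
    using insert finite_subset[of "J \<union> I" "{..<n}"] by auto
  have "pm_sign (conv (gamma_kernel \<alpha> (z j)) (smear z (J \<union> I) d))"
  proof (rule pm_sign_conv)
    show "log_concave (gamma_kernel \<alpha> (z j))"
      using \<alpha> z by (intro log_concave_gamma_kernel)
    show "smear z (J \<union> I) d y = 0" if "y \<le> 0" for y
      using that insert d fin by (intro smear_eq_0[where B = B]) auto
    show "pm_sign (smear z (J \<union> I) d)"
      using insert by (intro insert.IH) auto
    show "integrable lborel (\<lambda>y. gamma_kernel \<alpha> (z j) (x - y) * smear z (J \<union> I) d y)" for x
      using z d by (intro smear_kernel_integrable[where B = B]) auto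
  qed (use z \<alpha> gamma_kernel_eq_0 gamma_kernel_pos in auto)
  then show ?case
    using z d by (simp add: smear_insert_conv[where B = B])
qed

lemma smear_pos:
  assumes "finite I" "I \<subseteq> {..<n}" "\<And>i. i \<in> I \<Longrightarrow> 0 < z i"
    and d: "d \<in> borel_measurable borel" "\<And>y. \<bar>d y\<bar> \<le> B" "\<And>y. y \<le> 0 \<Longrightarrow> d y = 0" "\<And>y. 0 < y \<Longrightarrow> 0 < d y"
    and "0 < x"
  shows "0 < smear z I d x"
  using assms(1-3) \<open>0 < x\<close>
proof (induction I arbitrary: x)
  case empty
  then show ?case using d by (simp add: smear_empty)
next
  case (insert i I)
  have "0 < conv (gamma_kernel \<alpha> (z i)) (smear z I d) x"
  proof (rule conv_pos)
    show "smear z I d y = 0" if "y \<le> 0" for y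
      using that insert d by (intro smear_eq_0[where B = B]) auto
    show "integrable lborel (\<lambda>y. gamma_kernel \<alpha> (z i) (x - y) * smear z I d y)"
      using insert d by (intro smear_kernel_integrable[where B = B]) auto
  qed (use insert \<alpha> gamma_kernel_eq_0 gamma_kernel_pos in auto)
  then show ?case
    using insert d by (subst smear_insert_conv[where B = B]) auto
qed

end

section \<open>Two coordinates\<close>

lemma log_concave_deriv:
  fixes H H' :: "real \<Rightarrow> real"
  assumes lc: "log_concave H" and der: "\<And>x. 0 < x \<Longrightarrow> (H has_real_derivative H' x) (at x)"
    and x: "0 < x" "x < y"
  shows "H x * H' y \<le> H' x * H y"
proof -
  have D: "((\<lambda>h. (H (u + h) - H u) / h) \<longlongrightarrow> H' u) (at_right 0)" if "0 < u" for u
    using der[OF that] unfolding DERIV_def by (rule tendsto_mono[OF at_le, rotated]) simp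
  have "((\<lambda>h. H x * ((H (y + h) - H y) / h)) \<longlongrightarrow> H x * H' y) (at_right 0)"
    using x by (intro tendsto_mult tendsto_const D) simp
  moreover have "((\<lambda>h. ((H (x + h) - H x) / h) * H y) \<longlongrightarrow> H' x * H y) (at_right 0)"
    using x by (intro tendsto_mult tendsto_const D)
  moreover have "eventually (\<lambda>h. H x * ((H (y + h) - H y) / h) \<le> ((H (x + h) - H x) / h) * H y) (at_right 0)"
    unfolding eventually_at_right_field
  proof (intro exI[of _ 1] conjI allI impI)
    fix h :: real assume h: "0 < h"
    have "H x * H (y + h) \<le> H (x + h) * H y"
      using lc x h unfolding log_concave_def by simp
    then have "H x * (H (y + h) - H y) \<le> (H (x + h) - H x) * H y"
      by (simp add: algebra_simps)
    then show "H x * ((H (y + h) - H y) / h) \<le> ((H (x + h) - H x) / h) * H y"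
      using h by (simp add: divide_right_mono)
  qed simp
  ultimately show ?thesis
    by (intro tendsto_le[of "at_right 0"]) auto
qed

text \<open>The logarithmic derivative \<open>H' / H\<close> decreases, and \<open>H'\<close> has
  its sign.\<close>

lemma pm_sign_log_concave_deriv:
  fixes H H' :: "real \<Rightarrow> real"
  assumes lc: "log_concave H" and der: "\<And>x. 0 < x \<Longrightarrow> (H has_real_derivative H' x) (at x)"
    and pos: "\<And>x. 0 < x \<Longrightarrow> 0 < H x"
  shows "pm_sign H'"
  unfolding pm_sign_def
proof (intro allI impI, elim conjE)
  fix x y :: real
  assume x: "0 < x" "x < y" and "0 < H' y"
  then have "0 < H x * H' y" using pos[of x] by simp
  also have "\<dots> \<le> H' x * H y"
    using log_concave_deriv[OF lc der x] .
  finally show "0 < H' x"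
    using pos[of y] x by (simp add: zero_less_mult_iff)
qed

lemma pm_sign_triple:
  fixes f g h :: "real \<Rightarrow> real"
  assumes fg: "\<And>a b. 0 \<le> a \<Longrightarrow> 0 \<le> b \<Longrightarrow> pm_sign (\<lambda>x. a * f x + b * g x)"
    and gh: "\<And>a b. 0 \<le> a \<Longrightarrow> 0 \<le> b \<Longrightarrow> pm_sign (\<lambda>x. a * g x + b * h x)"
    and fh: "\<And>a b. 0 \<le> a \<Longrightarrow> 0 \<le> b \<Longrightarrow> pm_sign (\<lambda>x. a * f x + b * h x)"
    and abc: "0 \<le> a" "0 \<le> b" "0 \<le> c"
  shows "pm_sign (\<lambda>x. a * f x + b * g x + c * h x)"
proof -
  text \<open>The cone of triples of nonnegative coefficients with nonpositive value at \<open>x\<close> is spanned by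
    triples with at most two nonzero entries.\<close>
  have split1: "a * m1 + b * m2 + c * m3 \<le> 0"
    if n: "n3 > 0" "n1 \<le> 0" "n2 \<le> 0" "a * n1 + b * n2 + c * n3 \<le> 0" "0 \<le> a" "0 \<le> b" "0 \<le> c"
      and p13: "\<And>a c. 0 \<le> a \<Longrightarrow> 0 \<le> c \<Longrightarrow> a * n1 + c * n3 \<le> 0 \<Longrightarrow> a * m1 + c * m3 \<le> 0"
      and p23: "\<And>b c. 0 \<le> b \<Longrightarrow> 0 \<le> c \<Longrightarrow> b * n2 + c * n3 \<le> 0 \<Longrightarrow> b * m2 + c * m3 \<le> 0"
    for a b c n1 n2 n3 m1 m2 m3 :: real
  proof -
    \<comment> \<open>The share of \<open>c\<close> that is paired with \<open>a\<close>: as much as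
      \<open>a * n1\<close> can offset, but at most \<open>c\<close>. The rest is paired with
      \<open>b\<close>.\<close>
    define c1 where "c1 = min c (- a * n1 / n3)"
    have c1: "0 \<le> c1" "c1 \<le> c"
      using n by (auto simp: c1_def mult_nonneg_nonpos divide_nonpos_pos)
    have "c1 * n3 \<le> - a * n1"
      using n by (simp add: c1_def min_mult_distrib_right min.coboundedI2)
    then have "a * m1 + c1 * m3 \<le> 0"
      using n c1 by (intro p13) auto
    moreover have "b * n2 + (c - c1) * n3 \<le> 0"
    proof (cases "c1 = c")
      case True
      then show ?thesis using n by (simp add: mult_nonneg_nonpos)
    next
      case False
      then have "c1 * n3 = - a * n1" using n by (simp add: c1_def min_def split: if_splits)
      then show ?thesis using n(4) by (simp add: algebra_simps)
    qed
    then have "b * m2 + (c - c1) * m3 \<le> 0"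
      using n c1 by (intro p23) auto
    ultimately show ?thesis by (simp add: algebra_simps)
  qed
  have split2: "a * m1 + b * m2 + c * m3 \<le> 0"
    if n: "n3 \<le> 0" "n1 > 0" "n2 > 0" "a * n1 + b * n2 + c * n3 \<le> 0" "0 \<le> a" "0 \<le> b" "0 \<le> c"
      and p13: "\<And>a c. 0 \<le> a \<Longrightarrow> 0 \<le> c \<Longrightarrow> a * n1 + c * n3 \<le> 0 \<Longrightarrow> a * m1 + c * m3 \<le> 0"
      and p23: "\<And>b c. 0 \<le> b \<Longrightarrow> 0 \<le> c \<Longrightarrow> b * n2 + c * n3 \<le> 0 \<Longrightarrow> b * m2 + c * m3 \<le> 0"
    for a b c n1 n2 n3 m1 m2 m3 :: real
  proof (cases "n3 = 0")
    case True
    have "0 \<le> a * n1" "0 \<le> b * n2" using n by auto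
    moreover have "a * n1 + b * n2 \<le> 0" using n(4) True by simp
    ultimately have "a * n1 = 0" "b * n2 = 0" by linarith+
    then have "a = 0" "b = 0" using n(2,3) by (metis mult_eq_0_iff less_irrefl)+
    then show ?thesis using p13[of 0 c] n True by simp
  next
    case False
    define c1 where "c1 = a * n1 / (- n3)"
    have e: "c1 * n3 = - a * n1" using False by (simp add: c1_def)
    have "0 \<le> c1" using n False by (simp add: c1_def divide_nonneg_nonpos)
    have "b * n2 + (c - c1) * n3 \<le> 0" using e n(4) by (simp add: algebra_simps)
    moreover have "0 \<le> b * n2" using n by simp
    ultimately have "(c - c1) * n3 \<le> 0" by linarith
    then have "0 \<le> c - c1" using False n by (auto simp: mult_le_0_iff)
    have "a * m1 + c1 * m3 \<le> 0"
      using n e \<open>0 \<le> c1\<close> by (intro p13) auto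
    moreover have "b * m2 + (c - c1) * m3 \<le> 0"
      using n \<open>0 \<le> c - c1\<close> \<open>b * n2 + (c - c1) * n3 \<le> 0\<close> by (intro p23) auto
    ultimately show ?thesis by (simp add: algebra_simps)
  qed
  show ?thesis
    unfolding pm_sign_def
  proof (intro allI impI, elim conjE, rule ccontr)
    fix x y :: real
    assume x: "0 < x" "x < y" and pos: "0 < a * f y + b * g y + c * h y"
      and "\<not> 0 < a * f x + b * g x + c * h x"
    then have le: "a * f x + b * g x + c * h x \<le> 0" by simp
    have p12: "a * f y + b * g y \<le> 0" if "0 \<le> a" "0 \<le> b" "a * f x + b * g x \<le> 0" for a b
      using fg[OF that(1,2)] that(3) x unfolding pm_sign_def by (metis not_less)
    have p23: "a * g y + b * h y \<le> 0" if "0 \<le> a" "0 \<le> b" "a * g x + b * h x \<le> 0" for a b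
      using gh[OF that(1,2)] that(3) x unfolding pm_sign_def by (metis not_less)
    have p13: "a * f y + b * h y \<le> 0" if "0 \<le> a" "0 \<le> b" "a * f x + b * h x \<le> 0" for a b
      using fh[OF that(1,2)] that(3) x unfolding pm_sign_def by (metis not_less)
    have p21: "b * g y + a * f y \<le> 0" if "0 \<le> b" "0 \<le> a" "b * g x + a * f x \<le> 0" for a b
      using p12[of a b] that by (simp add: add.commute)
    have p31: "b * h y + a * f y \<le> 0" if "0 \<le> b" "0 \<le> a" "b * h x + a * f x \<le> 0" for a b
      using p13[of a b] that by (simp add: add.commute)
    have p32: "b * h y + a * g y \<le> 0" if "0 \<le> b" "0 \<le> a" "b * h x + a * g x \<le> 0" for a b
      using p23[of a b] that by (simp add: add.commute)
    \<comment> \<open>Exactly one positive value at \<open>x\<close> leads to \<open>split1\<close>,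
      exactly two lead to \<open>split2\<close>; when all three have the same sign nothing has to be
      balanced.\<close>
    consider "f x \<le> 0 \<and> g x \<le> 0 \<and> h x \<le> 0" | "f x \<le> 0 \<and> g x \<le> 0 \<and> 0 < h x"
      | "f x \<le> 0 \<and> 0 < g x \<and> h x \<le> 0" | "f x \<le> 0 \<and> 0 < g x \<and> 0 < h x"
      | "0 < f x \<and> g x \<le> 0 \<and> h x \<le> 0" | "0 < f x \<and> g x \<le> 0 \<and> 0 < h x"
      | "0 < f x \<and> 0 < g x \<and> h x \<le> 0" | "0 < f x \<and> 0 < g x \<and> 0 < h x"
      by linarith
    then have "a * f y + b * g y + c * h y \<le> 0"
    proof cases
      case 1
      have "a * f y + 0 * g y \<le> 0"
        using 1 abc by (intro p12) (auto simp: mult_nonneg_nonpos)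
      moreover have "b * g y + c * h y \<le> 0"
        using 1 abc by (intro p23) (auto simp: mult_nonneg_nonpos add_nonpos_nonpos)
      ultimately show ?thesis by simp
    next
      case 2
      then show ?thesis using abc le by (intro split1[OF _ _ _ le _ _ _ p13 p23]) auto
    next
      case 3
      then have "a * f y + c * h y + b * g y \<le> 0"
        using abc le by (intro split1[of "g x" "f x" "h x", OF _ _ _ _ _ _ _ p12 p32]) (auto simp: add_ac)
      then show ?thesis by simp
    next
      case 4
      then have "b * g y + c * h y + a * f y \<le> 0"
        using abc le by (intro split2[of "f x" "g x" "h x", OF _ _ _ _ _ _ _ p21 p31]) (auto simp: add_ac)
      then show ?thesis by simp
    next
      case 5
      then have "b * g y + c * h y + a * f y \<le> 0"
        using abc le by (intro split1[of "f x" "g x" "h x", OF _ _ _ _ _ _ _ p21 p31]) (auto simp: add_ac)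
      then show ?thesis by simp
    next
      case 6
      then have "a * f y + c * h y + b * g y \<le> 0"
        using abc le by (intro split2[of "g x" "f x" "h x", OF _ _ _ _ _ _ _ p12 p32]) (auto simp: add_ac)
      then show ?thesis by simp
    next
      case 7
      then show ?thesis using abc le by (intro split2[OF _ _ _ le _ _ _ p13 p23]) auto
    next
      case 8
      then have "0 \<le> a * f x" "0 \<le> b * g x" "0 \<le> c * h x" using abc by auto
      then have "a * f x = 0" "b * g x = 0" "c * h x = 0" using le by linarith+
      then have "a = 0" "b = 0" "c = 0" using 8 by (metis mult_eq_0_iff less_irrefl)+
      then show ?thesis by simp
    qed
    with pos show False by simp
  qed
qed

text \<open>Division by \<open>exp (- u / t)\<close> leaves a decreasing exponential minus a
  constant, since \<open>1 / t \<le> 1 / s\<close>.\<close>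

lemma pm_sign_exp_kernels:
  assumes st: "0 < s" "s \<le> t" and A: "0 \<le> A"
  shows "pm_sign (\<lambda>u. A * exp_kernel s u - B * exp_kernel t u)"
  unfolding pm_sign_def
proof (intro allI impI, elim conjE)
  fix x y :: real
  assume x: "0 < x" "x < y" and "0 < A * exp_kernel s y - B * exp_kernel t y"
  have e: "A * exp_kernel s u - B * exp_kernel t u = (A / s * exp (- (1 / s - 1 / t) * u) - B / t) * exp (- u / t)"
    if "0 < u" for u
  proof -
    have "exp (- u / s) = exp (- (1 / s - 1 / t) * u) * exp (- u / t)"
      by (simp add: exp_add[symmetric] algebra_simps)
    then show ?thesis using that by (simp add: exp_kernel_def algebra_simps)
  qed
  have "0 < A / s * exp (- (1 / s - 1 / t) * y) - B / t"
    using \<open>0 < A * _ - _\<close> e[of y] x by (simp add: zero_less_mult_iff)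
  moreover have "A / s * exp (- (1 / s - 1 / t) * y) \<le> A / s * exp (- (1 / s - 1 / t) * x)"
  proof -
    have "0 \<le> 1 / s - 1 / t" using st by (simp add: frac_le)
    then have "- (1 / s - 1 / t) * y \<le> - (1 / s - 1 / t) * x"
      using x by (intro mult_left_mono_neg) auto
    then have "exp (- (1 / s - 1 / t) * y) \<le> exp (- (1 / s - 1 / t) * x)"
      by (simp only: exp_le_cancel_iff)
    then show ?thesis using A st by (intro mult_left_mono) auto
  qed
  ultimately show "0 < A * exp_kernel s x - B * exp_kernel t x"
    using e[of x] x by simp
qed

lemma isCont_gamma_density:
  assumes "t \<noteq> 0"
  shows "isCont (gamma_density a) t"
proof (cases "0 < t")
  case True
  have "isCont (\<lambda>t. t powr (a - 1) * exp (- t) / Gamma a) t"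
    using True by (cases "Gamma a = 0") (auto intro!: continuous_intros)
  moreover have "eventually (\<lambda>u. gamma_density a u = u powr (a - 1) * exp (- u) / Gamma a) (nhds t)"
    using eventually_nhds_in_open[of "{0<..}" t] True by (auto elim!: eventually_mono simp: gamma_density_def)
  ultimately show ?thesis by (simp add: isCont_cong)
next
  case False
  have "eventually (\<lambda>u. u \<in> {..<0}) (nhds t)"
    using False assms by (intro eventually_nhds_in_open) auto
  then have "eventually (\<lambda>u. gamma_density a u = 0) (nhds t)"
    by eventually_elim (simp add: gamma_density_def)
  then show ?thesis by (simp add: isCont_cong)
qed

lemma isCont_gamma_kernel:
  assumes "u \<noteq> 0" "0 < s"
  shows "isCont (gamma_kernel a s) u"
proof -
  have "isCont (\<lambda>v. gamma_density a (v / s)) u"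
    using assms by (intro isCont_o2[OF _ isCont_gamma_density]) (auto intro!: continuous_intros)
  then show ?thesis
    unfolding gamma_kernel_def using assms by (auto intro!: continuous_intros)
qed

text \<open>The gamma kernel of shape 1 jumps at 0, so continuity of \<open>k\<close> is asked only
  elsewhere. For each \<open>x\<close> the jump affects the single point \<open>y = x\<close>, which
  dominated convergence ignores.\<close>

lemma isCont_conv:
  fixes k g :: "real \<Rightarrow> real"
  assumes [measurable]: "k \<in> borel_measurable borel" and g: "integrable lborel g"
    and B: "\<And>u. \<bar>k u\<bar> \<le> B" and k: "\<And>u. u \<noteq> 0 \<Longrightarrow> isCont k u"
  shows "isCont (conv k g) x"
  unfolding continuous_at_sequentially
proof (intro allI impI)
  note [measurable] = borel_measurable_integrable[OF g]
  fix X assume X: "X \<longlonglongrightarrow> x"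
  have "(\<lambda>i. LINT y|lborel. k (X i - y) * g y) \<longlonglongrightarrow> (LINT y|lborel. k (x - y) * g y)"
  proof (rule integral_dominated_convergence[where w = "\<lambda>y. B * \<bar>g y\<bar>"])
    show "AE y in lborel. (\<lambda>i. k (X i - y) * g y) \<longlonglongrightarrow> k (x - y) * g y"
      using AE_lborel_singleton[of x]
    proof eventually_elim
      case (elim y)
      then have "isCont k (x - y)" by (intro k) simp
      moreover have "(\<lambda>i. X i - y) \<longlonglongrightarrow> x - y" by (intro tendsto_intros X)
      ultimately show ?case
        by (intro tendsto_mult tendsto_const isCont_tendsto_compose[of _ k])
    qed
    show "AE y in lborel. norm (k (X i - y) * g y) \<le> B * \<bar>g y\<bar>" for i
      using B by (auto simp: abs_mult intro!: mult_right_mono)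
    show "integrable lborel (\<lambda>y. B * \<bar>g y\<bar>)"
      using g by auto
  qed auto
  then show "((conv k g) \<circ> X) \<longlonglongrightarrow> conv k g x"
    by (simp add: conv_def comp_def)
qed

text \<open>This becomes \<open>x\<^sup>2 * L' x \<le> 0\<close> in
  \<open>pm_sign_q_qe_diff\<close>. The left side decreases in \<open>\<mu>\<close>, so
  \<open>\<mu> = \<xi>\<close> is the worst case; it is then affine in \<open>h\<close>, and at the
  endpoint \<open>h = \<kappa>\<close> it equals
  \<open>- (1 - \<xi>) * (\<kappa> - \<xi>)\<close>.\<close>

lemma key_inequality:
  fixes \<kappa> h \<xi> \<mu> :: real
  assumes "1 \<le> \<kappa>" "0 \<le> h" "h \<le> \<kappa>" "0 \<le> \<xi>" "\<xi> \<le> 1" "\<xi> \<le> \<mu>"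
  shows "- h + 2 * h * \<xi> - (\<kappa> - 1) * \<mu> - \<mu>\<^sup>2 \<le> 0"
proof -
  have m: "(\<kappa> - 1) * \<xi> \<le> (\<kappa> - 1) * \<mu>" "\<xi>\<^sup>2 \<le> \<mu>\<^sup>2"
    using assms by (auto intro: mult_left_mono power_mono)
  have "h * (2 * \<xi> - 1) \<le> (\<kappa> - 1) * \<xi> + \<xi>\<^sup>2"
  proof (cases "2 * \<xi> \<le> 1")
    case True
    then have "h * (2 * \<xi> - 1) \<le> 0" using assms by (simp add: mult_nonneg_nonpos)
    then show ?thesis using assms by (smt (verit) mult_nonneg_nonneg zero_le_power2)
  next
    case False
    then have "h * (2 * \<xi> - 1) \<le> \<kappa> * (2 * \<xi> - 1)"
      using assms by (intro mult_right_mono) auto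
    moreover have "0 \<le> (1 - \<xi>) * (\<kappa> - \<xi>)"
      using assms by (intro mult_nonneg_nonneg) auto
    ultimately show ?thesis by (simp add: algebra_simps power2_eq_square)
  qed
  then show ?thesis using m by (simp add: algebra_simps)
qed

section \<open>The density of two weighted gamma variables and its exponential smearings\<close>

locale gamma_pair = iid_gamma +
  fixes z :: "nat \<Rightarrow> real" and k l :: nat
  assumes kl: "k < n" "l < n" "k \<noteq> l" and zk: "0 < z k" and zl: "0 < z l"
begin

definition q :: "real \<Rightarrow> real" where
  "q = conv (gamma_kernel \<alpha> (z k)) (gamma_kernel \<alpha> (z l))"

text \<open>The density of the pair sum with an independent exponential variable of mean
  \<open>s\<close> added; it solves \<open>y + s * y' = q\<close> with
  \<open>y 0 = 0\<close>.\<close>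

definition qe :: "real \<Rightarrow> real \<Rightarrow> real" where
  "qe s = smear z {k, l} (exp_kernel s)"

text \<open>The formula comes from solving the derivative of the identity \<open>qe_sum\<close> for
  the derivative of \<open>q\<close>; see \<open>q_deriv\<close>.\<close>

definition q' :: "real \<Rightarrow> real" where
  "q' x = ((2 * \<alpha> - 1) * q x - \<alpha> * (qe (z k) x + qe (z l) x)) / x"

lemma kernel_int: "0 < s \<Longrightarrow> integrable lborel (gamma_kernel \<alpha> s)"
  using kl by (intro gamma_kernel_integrable gamma_density_integrable) auto

lemma kernel_bdd_int:
  assumes "0 < s" "0 < t" "1 \<le> a"
  shows "integrable lborel (\<lambda>y. gamma_kernel \<alpha> s (x - y) * gamma_kernel a t y)"
proof -
  obtain B where "\<And>u. \<bar>gamma_kernel a t u\<bar> \<le> B" using gamma_kernel_bounded assms by blast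
  then show ?thesis using assms by (intro integrable_conv[where B = B] kernel_int) auto
qed

lemma q_pos: "0 < x \<Longrightarrow> 0 < q x"
  unfolding q_def using zk zl \<alpha>
  by (intro conv_pos kernel_bdd_int gamma_kernel_eq_0 gamma_kernel_pos) auto

lemma q_eq_0: "x \<le> 0 \<Longrightarrow> q x = 0"
  unfolding q_def using zk zl by (intro conv_eq_0 gamma_kernel_eq_0)

lemma q_nonneg: "0 \<le> q x"
  using q_pos[of x] q_eq_0[of x] by (cases "0 < x") auto

lemma q_isCont: "isCont q x"
proof -
  obtain B where "\<And>u. \<bar>gamma_kernel \<alpha> (z k) u\<bar> \<le> B" using gamma_kernel_bounded \<alpha> zk by blast
  then show ?thesis
    unfolding q_def using zk zl by (intro isCont_conv[where B = B] kernel_int isCont_gamma_kernel) auto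
qed

lemma q_continuous: "continuous_on S q"
  using q_isCont continuous_at_imp_continuous_on by blast

lemma distributed_scaled:
  assumes "i < n" "0 < s"
  shows "distributed M lborel (\<lambda>\<omega>. s * X i \<omega>) (\<lambda>x. ennreal (gamma_kernel \<alpha> s x))"
proof -
  have "distributed M lborel (\<lambda>\<omega>. 0 + s * X i \<omega>) (\<lambda>x. ennreal (gamma_density \<alpha> ((x - 0) / s)) / ennreal \<bar>s\<bar>)"
    using assms by (intro distributed_affine dist) auto
  moreover have "ennreal (gamma_density \<alpha> (x / s)) / ennreal s = ennreal (gamma_kernel \<alpha> s x)" for x
    using assms \<alpha> by (simp add: gamma_kernel_def divide_ennreal gamma_density_nonneg)
  ultimately show ?thesis using assms by simp
qed

lemma distributed_pair: "distributed M lborel (wsum z {k, l}) (\<lambda>x. ennreal (q x))"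
proof -
  have "indep_var borel ((\<lambda>u. z k * u) \<circ> X k) borel ((\<lambda>u. u) \<circ> wsum z {l})"
    using kl by (intro indep_var_compose[OF indep_X_wsum]) auto
  then have "indep_var borel (\<lambda>\<omega>. z k * X k \<omega>) borel (\<lambda>\<omega>. z l * X l \<omega>)"
    by (simp add: comp_def wsum_def[abs_def])
  from distributed_convolution[OF this distributed_scaled distributed_scaled]
  have "distributed M lborel (\<lambda>\<omega>. z k * X k \<omega> + z l * X l \<omega>)
     (\<lambda>x. \<integral>\<^sup>+ y. ennreal (gamma_kernel \<alpha> (z k) (x - y)) * ennreal (gamma_kernel \<alpha> (z l) y) \<partial>lborel)"
    using kl zk zl by simp
  moreover have "(\<integral>\<^sup>+ y. ennreal (gamma_kernel \<alpha> (z k) (x - y)) * ennreal (gamma_kernel \<alpha> (z l) y) \<partial>lborel) = ennreal (q x)" for x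
    unfolding q_def conv_def using zk zl \<alpha>
    by (subst nn_integral_eq_integral[symmetric])
       (auto intro!: kernel_bdd_int simp: gamma_kernel_nonneg ennreal_mult)
  moreover have "(\<lambda>\<omega>. z k * X k \<omega> + z l * X l \<omega>) = wsum z {k, l}"
    using kl by (simp add: wsum_def fun_eq_iff)
  ultimately show ?thesis by simp
qed

lemma q_integrable: "integrable lborel q"
  using distributed_integrable[OF distributed_pair, of "\<lambda>_. 1"] q_nonneg by simp

lemma smear_pair:
  assumes "d \<in> borel_measurable borel"
  shows "smear z {k, l} d x = conv d q x"
  using distributed_integral[OF distributed_pair, of "\<lambda>y. d (x - y)"] assms q_nonneg
  by (simp add: smear_def conv_def mult.commute)

text \<open>Splitting \<open>exp (- (x - y) / s)\<close> into a factor in \<open>x\<close> and a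
  factor in \<open>y\<close> moves \<open>x\<close> out of the integrand, so that the fundamental
  theorem of calculus gives the derivative.\<close>

lemma qe_eq:
  assumes s: "0 < s" and x: "0 \<le> x"
  shows "qe s x = exp (- x / s) / s * integral {0..x} (\<lambda>y. exp (y / s) * q y)"
proof -
  have i: "integrable lborel (\<lambda>y. q (x - y) * exp_kernel s y)"
    using s exp_kernel_le[OF s] by (intro integrable_conv[where B = "1 / s"] q_integrable) auto
  have i2: "integrable lborel (\<lambda>y. exp_kernel s (x - y) * q y)"
    using lborel_integrable_real_affine[OF i, of "-1" x] by (simp add: mult.commute)
  have "(\<lambda>y. exp (y / s) * q y) integrable_on {0..x}"
    by (intro integrable_continuous_real continuous_intros q_continuous) (use s in auto)
  then have "((\<lambda>y. exp (y / s) * q y) has_integral integral {0..x} (\<lambda>y. exp (y / s) * q y)) {0..x}"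
    by blast
  from has_integral_mult_right[OF this, of "exp (- x / s) / s"]
  have "((\<lambda>y. exp_kernel s (x - y) * q y) has_integral
      exp (- x / s) / s * integral {0..x} (\<lambda>y. exp (y / s) * q y)) {0..x}"
  proof (rule has_integral_spike_finite[rotated 2])
    fix y assume y: "y \<in> {0..x} - {x}"
    have "exp (- (x - y) / s) = exp (- x / s) * exp (y / s)"
      by (simp add: exp_add[symmetric] diff_divide_distrib)
    then show "exp_kernel s (x - y) * q y = exp (- x / s) / s * (exp (y / s) * q y)"
      using y by (simp add: exp_kernel_def)
  qed simp
  then have "((\<lambda>y. exp_kernel s (x - y) * q y) has_integral
      exp (- x / s) / s * integral {0..x} (\<lambda>y. exp (y / s) * q y)) UNIV"
    by (rule has_integral_on_superset) (auto simp: q_eq_0 exp_kernel_eq_0 not_le)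
  then show ?thesis
    unfolding qe_def using i2 has_integral_unique_lborel
    by (subst smear_pair) (auto simp: conv_def)
qed

lemma qe_0: "0 < s \<Longrightarrow> qe s 0 = 0"
  by (subst qe_eq) auto

lemma qe_deriv:
  assumes s: "0 < s" and x: "0 < x"
  shows "(qe s has_real_derivative (q x - qe s x) / s) (at x)"
proof -
  define I where "I x = integral {0..x} (\<lambda>y. exp (y / s) * q y)" for x
  have "continuous_on {0..x + 1} (\<lambda>y. exp (y / s) * q y)"
    by (intro continuous_intros q_continuous) (use s in auto)
  then have "(I has_real_derivative exp (x / s) * q x) (at x within {0..x + 1})"
    unfolding I_def using x by (intro integral_has_real_derivative) auto
  then have I: "(I has_real_derivative exp (x / s) * q x) (at x)"
    using x by (subst (asm) at_within_interior) auto
  have "((\<lambda>x. exp (- x / s) / s) has_real_derivative exp (- x / s) * (- 1 / s) / s) (at x)"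
    using s by (auto intro!: derivative_eq_intros)
  from DERIV_mult[OF this I]
  have "((\<lambda>x. exp (- x / s) / s * I x) has_real_derivative
      exp (- x / s) * (- 1 / s) / s * I x + exp (- x / s) / s * (exp (x / s) * q x)) (at x)"
    by (simp add: ac_simps)
  moreover have "exp (- x / s) * (- 1 / s) / s * I x + exp (- x / s) / s * (exp (x / s) * q x) = (q x - qe s x) / s"
  proof -
    have "exp (- x / s) * exp (x / s) = 1" by (simp add: exp_minus)
    then have "exp (- x / s) / s * (exp (x / s) * q x) = q x / s"
      by (simp add: mult.assoc[symmetric] mult.commute)
    then show ?thesis
      using s x by (simp add: qe_eq I_def diff_divide_distrib)
  qed
  ultimately have D: "((\<lambda>x. exp (- x / s) / s * I x) has_real_derivative (q x - qe s x) / s) (at x)"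
    by simp
  have "eventually (\<lambda>u. u \<in> {0<..}) (nhds x)"
    using x by (intro eventually_nhds_in_open) auto
  then have "eventually (\<lambda>u. exp (- u / s) / s * I u = qe s u) (nhds x)"
    by eventually_elim (use s in \<open>auto simp: qe_eq I_def\<close>)
  from DERIV_cong_ev[OF refl this refl] D show ?thesis by simp
qed

lemma qe_continuous: "0 < s \<Longrightarrow> continuous_on {0..} (qe s)"
proof -
  assume s: "0 < s"
  have "continuous_on {0..b} (qe s)" for b
  proof -
    have "(\<lambda>y. exp (y / s) * q y) integrable_on {0..b}"
      by (intro integrable_continuous_real continuous_intros q_continuous) (use s in auto)
    then have "continuous_on {0..b} (\<lambda>x. exp (- x / s) / s * integral {0..x} (\<lambda>y. exp (y / s) * q y))"
      using s by (intro continuous_intros indefinite_integral_continuous_1) auto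
    then show ?thesis
      by (rule continuous_on_eq) (use s in \<open>auto simp: qe_eq\<close>)
  qed
  then have c: "continuous_on {0..<b} (qe s)" for b
    by (rule continuous_on_subset[of "{0..b}"]) auto
  show ?thesis
    unfolding continuous_on_eq_continuous_within
  proof
    fix x :: real assume "x \<in> {0..}"
    then have "continuous (at x within {0..<x + 1}) (qe s)"
      using c[of "x + 1"] by (auto simp: continuous_on_eq_continuous_within)
    moreover have "at x within {0..<x + 1} = at x within {0..}"
      using \<open>x \<in> {0..}\<close> by (intro at_within_nhd[of x "{..<x + 1}"]) auto
    ultimately show "continuous (at x within {0..}) (qe s)" by simp
  qed
qed

lemma smear_single:
  assumes "i < n" "0 < z i"
  shows "smear z {i} (exp_kernel (z i)) = gamma_kernel (\<alpha> + 1) (z i)"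
proof -
  have "smear z {i} (exp_kernel (z i)) = conv (gamma_kernel \<alpha> (z i)) (smear z {} (exp_kernel (z i)))"
    using assms exp_kernel_le by (intro smear_insert_conv[where B = "1 / z i"]) auto
  then show ?thesis
    using assms conv_gamma_exp_kernel[OF \<alpha> assms(2) gamma_density_integrable] by (simp add: smear_empty fun_eq_iff)
qed

text \<open>An exponential variable of mean \<open>z i\<close> merges with the gamma variable of the
  same scale and raises its shape by one.\<close>

lemma
  shows qe_conv_k: "qe (z k) = conv (gamma_kernel \<alpha> (z l)) (gamma_kernel (\<alpha> + 1) (z k))" (is ?K)
    and qe_conv_l: "qe (z l) = conv (gamma_kernel \<alpha> (z k)) (gamma_kernel (\<alpha> + 1) (z l))" (is ?L)
proof -
  have "qe (z i) = conv (gamma_kernel \<alpha> (z j)) (gamma_kernel (\<alpha> + 1) (z i))"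
    if "{i, j} = {k, l}" "i \<noteq> j" for i j
  proof -
    have ij: "i < n" "j < n" "0 < z i" "0 < z j" "{k, l} = insert j {i}"
      using that kl zk zl by (auto simp: doubleton_eq_iff)
    have "smear z (insert j {i}) (exp_kernel (z i)) = conv (gamma_kernel \<alpha> (z j)) (smear z {i} (exp_kernel (z i)))"
      using ij that exp_kernel_le by (intro smear_insert_conv[where B = "1 / z i"]) auto
    then show ?thesis using ij smear_single unfolding qe_def by simp
  qed
  from this[of k l] this[of l k] show ?K ?L
    using kl by (auto simp: insert_commute)
qed

text \<open>Size biasing: multiplying a gamma kernel by its argument raises the shape by one, up to
  the factor \<open>\<alpha> * z i\<close>. Write \<open>x = y + (x - y)\<close> under the
  convolution integral that defines \<open>q\<close>.\<close>

lemma qe_sum: "z k * qe (z k) x + z l * qe (z l) x = x * q x / \<alpha>"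
proof -
  have a: "0 < \<alpha>" using \<alpha> by simp
  have suc: "z i * gamma_kernel (\<alpha> + 1) (z i) y = y * gamma_kernel \<alpha> (z i) y / \<alpha>" if "0 < z i" for i y
    using gamma_kernel_Suc[OF a that, of y] a by (simp add: field_simps)
  have k1: "z k * qe (z k) x = (LINT y|lborel. gamma_kernel \<alpha> (z l) (x - y) * (y * gamma_kernel \<alpha> (z k) y)) / \<alpha>"
  proof -
    have "z k * qe (z k) x = z k * (LINT y|lborel. gamma_kernel \<alpha> (z l) (x - y) * gamma_kernel (\<alpha> + 1) (z k) y)"
      by (simp add: qe_conv_k conv_def)
    also have "\<dots> = (LINT y|lborel. gamma_kernel \<alpha> (z l) (x - y) * (z k * gamma_kernel (\<alpha> + 1) (z k) y))"
      by (subst integral_mult_right_zero[symmetric]) (simp only: ac_simps)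
    finally show ?thesis by (simp add: suc[OF zk])
  qed
  have l1: "z l * qe (z l) x = (LINT y|lborel. ((x - y) * gamma_kernel \<alpha> (z l) (x - y)) * gamma_kernel \<alpha> (z k) y) / \<alpha>"
  proof -
    have "z l * qe (z l) x = z l * conv (gamma_kernel (\<alpha> + 1) (z l)) (gamma_kernel \<alpha> (z k)) x"
      by (simp add: qe_conv_l conv_commute[of "gamma_kernel \<alpha> (z k)"])
    also have "\<dots> = (LINT y|lborel. (z l * gamma_kernel (\<alpha> + 1) (z l) (x - y)) * gamma_kernel \<alpha> (z k) y)"
      unfolding conv_def by (subst integral_mult_right_zero[symmetric]) (simp only: ac_simps)
    finally show ?thesis by (simp add: suc[OF zl])
  qed
  have i1: "integrable lborel (\<lambda>y. gamma_kernel \<alpha> (z l) (x - y) * (y * gamma_kernel \<alpha> (z k) y))"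
    using integrable_mult_right[OF kernel_bdd_int[OF zl zk, of "\<alpha> + 1" x], of "\<alpha> * z k"] \<alpha> zk
    by (simp add: gamma_kernel_Suc a mult.left_commute)
  have i3: "integrable lborel (\<lambda>y. gamma_kernel \<alpha> (z l) (x - y) * gamma_kernel \<alpha> (z k) y)"
    using kernel_bdd_int zl zk \<alpha> by simp
  have i2: "integrable lborel (\<lambda>y. ((x - y) * gamma_kernel \<alpha> (z l) (x - y)) * gamma_kernel \<alpha> (z k) y)"
    using Bochner_Integration.integrable_diff[OF integrable_mult_right[OF i3, of x] i1] by (simp add: algebra_simps)
  have "z k * qe (z k) x + z l * qe (z l) x
     = (LINT y|lborel. gamma_kernel \<alpha> (z l) (x - y) * (y * gamma_kernel \<alpha> (z k) y)
          + ((x - y) * gamma_kernel \<alpha> (z l) (x - y)) * gamma_kernel \<alpha> (z k) y) / \<alpha>"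
    unfolding k1 l1 using i1 i2 by (simp add: add_divide_distrib)
  also have "\<dots> = (LINT y|lborel. x * (gamma_kernel \<alpha> (z l) (x - y) * gamma_kernel \<alpha> (z k) y)) / \<alpha>"
    by (simp add: algebra_simps)
  also have "\<dots> = x * q x / \<alpha>"
    by (simp add: q_def conv_commute[of "gamma_kernel \<alpha> (z k)"]) (simp add: conv_def)
  finally show ?thesis .
qed

text \<open>Differentiating \<open>qe_sum\<close> avoids differentiating a convolution whose kernels
  need not be differentiable at 0; the smeared densities are smooth enough by
  \<open>qe_deriv\<close>.\<close>

lemma q_deriv:
  assumes x: "0 < x"
  shows "(q has_real_derivative q' x) (at x)"
proof -
  define S where "S x = z k * qe (z k) x + z l * qe (z l) x" for x
  have S: "S x = x * q x / \<alpha>" for x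
    by (simp add: S_def qe_sum)
  have "(S has_real_derivative z k * ((q x - qe (z k) x) / z k) + z l * ((q x - qe (z l) x) / z l)) (at x)"
    unfolding S_def using x zk zl by (intro DERIV_add DERIV_cmult qe_deriv)
  then have "(S has_real_derivative (q x - qe (z k) x) + (q x - qe (z l) x)) (at x)"
    using zk zl by simp
  from DERIV_divide[OF DERIV_cmult[OF this, of \<alpha>] DERIV_ident] x
  have "((\<lambda>x. \<alpha> * S x / x) has_real_derivative
     (\<alpha> * ((q x - qe (z k) x) + (q x - qe (z l) x)) * x - \<alpha> * S x * 1) / (x * x)) (at x)"
    by simp
  moreover have "(\<alpha> * ((q x - qe (z k) x) + (q x - qe (z l) x)) * x - \<alpha> * S x * 1) / (x * x) = q' x"
    using x \<alpha> unfolding S q'_def by (simp add: field_simps)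
  ultimately have D: "((\<lambda>x. \<alpha> * S x / x) has_real_derivative q' x) (at x)"
    by simp
  have "eventually (\<lambda>u. u \<in> {0<..}) (nhds x)"
    using x by (intro eventually_nhds_in_open) auto
  then have "eventually (\<lambda>u. \<alpha> * S u / u = q u) (nhds x)"
    by eventually_elim (use \<alpha> in \<open>auto simp: S\<close>)
  from DERIV_cong_ev[OF refl this refl] D show ?thesis by simp
qed

text \<open>The second term is \<open>b\<close> times the derivative of \<open>qe (z l)\<close>, so
  the whole is the derivative of \<open>a * q + b * qe (z l)\<close>. That function is one
  convolution of two log-concave kernels, hence log-concave.\<close>

lemma pm_sign_q_qe_l:
  assumes ab: "0 \<le> a" "0 \<le> b"
  shows "pm_sign (\<lambda>x. a * q' x + b * ((q x - qe (z l) x) / z l))"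
proof (cases "a = 0 \<and> b = 0")
  case True
  then show ?thesis by (simp add: pm_sign_def)
next
  case False
  \<comment> \<open>Size biasing turns \<open>c * u * gamma_kernel \<alpha> (z l) u\<close> into
    \<open>b * gamma_kernel (\<alpha> + 1) (z l) u\<close>.\<close>
  define c where "c = b / (\<alpha> * z l)"
  define j where "j u = (a + c * u) * gamma_kernel \<alpha> (z l) u" for u
  define H where "H = conv (gamma_kernel \<alpha> (z k)) j"
  have c: "0 \<le> c" "a = 0 \<Longrightarrow> 0 < c"
    using ab False zl \<alpha> by (auto simp: c_def)
  have j_alt: "j u = a * gamma_kernel \<alpha> (z l) u + b * gamma_kernel (\<alpha> + 1) (z l) u" for u
  proof -
    have "c * (u * gamma_kernel \<alpha> (z l) u) = b * gamma_kernel (\<alpha> + 1) (z l) u"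
      using \<alpha> zl by (simp add: gamma_kernel_Suc c_def)
    then show ?thesis by (simp add: j_def algebra_simps)
  qed
  have i1: "integrable lborel (\<lambda>y. gamma_kernel \<alpha> (z k) (x - y) * gamma_kernel \<alpha> (z l) y)"
    and i2: "integrable lborel (\<lambda>y. gamma_kernel \<alpha> (z k) (x - y) * gamma_kernel (\<alpha> + 1) (z l) y)" for x
    using zk zl \<alpha> by (auto intro!: kernel_bdd_int)
  have int: "integrable lborel (\<lambda>y. gamma_kernel \<alpha> (z k) (x - y) * j y)" for x
    using Bochner_Integration.integrable_add[OF integrable_mult_right[OF i1[of x], of a] integrable_mult_right[OF i2[of x], of b]]
    by (simp add: j_alt algebra_simps)
  have j0: "j y = 0" if "y \<le> 0" for y
    using that zl by (simp add: j_def gamma_kernel_eq_0)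
  have jpos: "0 < j y" if "0 < y" for y
  proof -
    have "0 < a + c * y"
      using that c ab by (cases "a = 0") (auto intro!: add_pos_nonneg)
    then show ?thesis using that \<alpha> zl by (simp add: j_def gamma_kernel_pos)
  qed
  have H: "H x = a * q x + b * qe (z l) x" for x
  proof -
    have "H x = (LINT y|lborel. a * (gamma_kernel \<alpha> (z k) (x - y) * gamma_kernel \<alpha> (z l) y)
        + b * (gamma_kernel \<alpha> (z k) (x - y) * gamma_kernel (\<alpha> + 1) (z l) y))"
      unfolding H_def conv_def j_alt by (simp add: algebra_simps)
    also have "\<dots> = a * q x + b * qe (z l) x"
      using i1[of x] i2[of x] unfolding qe_conv_l q_def by (simp add: conv_def)
    finally show ?thesis .
  qed
  have "log_concave H"
    unfolding H_def
  proof (rule log_concave_conv)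
    show "log_concave j"
      unfolding j_def using \<alpha> zl ab c by (intro log_concave_gamma_kernel_affine) auto
  qed (use \<alpha> zk log_concave_gamma_kernel gamma_kernel_eq_0 gamma_kernel_pos int j0 jpos in auto)
  moreover have "(H has_real_derivative a * q' x + b * ((q x - qe (z l) x) / z l)) (at x)" if "0 < x" for x
    unfolding H[abs_def] using that zl by (intro DERIV_add DERIV_cmult q_deriv qe_deriv)
  moreover have "0 < H x" if "0 < x" for x
    unfolding H_def using that \<alpha> zk int j0 jpos
    by (intro conv_pos gamma_kernel_eq_0 gamma_kernel_pos) auto
  ultimately show ?thesis
    by (rule pm_sign_log_concave_deriv)
qed

text \<open>The locale imposes no order on \<open>z k\<close> and \<open>z l\<close>, so every
  statement about \<open>z l\<close> transfers to \<open>z k\<close>.\<close>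

lemma swap: "gamma_pair M X \<alpha> n z l k"
  using kl zk zl by unfold_locales auto

lemma swap_q: "gamma_pair.q \<alpha> z l k = q"
  using gamma_pair.q_def[OF swap] by (simp add: q_def conv_commute fun_eq_iff)

lemma swap_qe: "gamma_pair.qe M X z l k = qe"
  using gamma_pair.qe_def[OF swap] by (simp add: qe_def fun_eq_iff insert_commute)

lemma swap_q': "gamma_pair.q' M X \<alpha> z l k = q'"
  using gamma_pair.q'_def[OF swap] by (simp add: q'_def fun_eq_iff swap_q swap_qe add.commute)

lemma pm_sign_q_qe_k:
  assumes "0 \<le> a" "0 \<le> b"
  shows "pm_sign (\<lambda>x. a * q' x + b * ((q x - qe (z k) x) / z k))"
  using gamma_pair.pm_sign_q_qe_l[OF swap assms] by (simp add: swap_q swap_q' swap_qe)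

text \<open>The operator \<open>1 + z l * D\<close> sends the derivative of \<open>qe (z l)\<close>
  to \<open>q'\<close> and the divided difference of \<open>qe (z k)\<close> and
  \<open>qe (z l)\<close> to the derivative of \<open>qe (z k)\<close>. This is the combination
  treated in \<open>pm_sign_q_qe_k\<close>.\<close>

lemma pm_sign_qe_pair:
  assumes ab: "0 \<le> b" "0 \<le> c" and lt: "z k < z l"
  shows "pm_sign (\<lambda>x. b * ((q x - qe (z l) x) / z l) + c * ((qe (z k) x - qe (z l) x) / (z l - z k)))"
proof (rule pm_sign_exp_operator[OF zl])
  show "b * ((q 0 - qe (z l) 0) / z l) + c * ((qe (z k) 0 - qe (z l) 0) / (z l - z k)) = 0"
    using zk zl by (simp add: q_eq_0 qe_0)
  show "continuous_on {0..} (\<lambda>x. b * ((q x - qe (z l) x) / z l) + c * ((qe (z k) x - qe (z l) x) / (z l - z k)))"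
    using zk zl lt by (intro continuous_intros q_continuous qe_continuous) auto
  define D where "D x = b * ((q' x - (q x - qe (z l) x) / z l) / z l)
       + c * (((q x - qe (z k) x) / z k - (q x - qe (z l) x) / z l) / (z l - z k))" for x
  show "((\<lambda>x. b * ((q x - qe (z l) x) / z l) + c * ((qe (z k) x - qe (z l) x) / (z l - z k)))
      has_real_derivative D x) (at x)" if "0 < x" for x
    unfolding D_def using that zk zl
    by (intro DERIV_add DERIV_cmult DERIV_cdivide DERIV_diff q_deriv qe_deriv)
  have "b * ((q x - qe (z l) x) / z l) + c * ((qe (z k) x - qe (z l) x) / (z l - z k)) + z l * D x
      = b * q' x + c * ((q x - qe (z k) x) / z k)" for x
  proof -
    have 1: "(q x - qe (z l) x) / z l + z l * ((q' x - (q x - qe (z l) x) / z l) / z l) = q' x"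
      using zl by (simp add: field_simps)
    have "(qe (z k) x - qe (z l) x) + z l * ((q x - qe (z k) x) / z k - (q x - qe (z l) x) / z l)
        = (z l - z k) * ((q x - qe (z k) x) / z k)"
      using zk zl by (simp add: field_simps)
    then have "((qe (z k) x - qe (z l) x) + z l * ((q x - qe (z k) x) / z k - (q x - qe (z l) x) / z l)) / (z l - z k)
        = (q x - qe (z k) x) / z k"
      using lt by (simp only: nonzero_mult_div_cancel_left)
    then have 2: "(qe (z k) x - qe (z l) x) / (z l - z k)
        + z l * (((q x - qe (z k) x) / z k - (q x - qe (z l) x) / z l) / (z l - z k)) = (q x - qe (z k) x) / z k"
      by (simp add: add_divide_distrib)
    show ?thesis
      unfolding D_def using arg_cong[OF 1, of "\<lambda>t. b * t"] arg_cong[OF 2, of "\<lambda>t. c * t"] by (simp add: algebra_simps)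
  qed
  then show "pm_sign (\<lambda>x. b * ((q x - qe (z l) x) / z l) + c * ((qe (z k) x - qe (z l) x) / (z l - z k)) + z l * D x)"
    using pm_sign_q_qe_k[OF ab] by simp
qed

text \<open>By size biasing, \<open>x * G x\<close> is the conditional mean of
  \<open>z l * X l - z k * X k\<close> given that the pair sum equals \<open>x\<close>; the
  denominator is \<open>x * q x / \<alpha>\<close>.\<close>

definition G :: "real \<Rightarrow> real" where
  "G x = (z l * qe (z l) x - z k * qe (z k) x) / (z k * qe (z k) x + z l * qe (z l) x)"

definition \<delta> :: real where
  "\<delta> = (1 / z k - 1 / z l) / 2"

text \<open>The right side of the Riccati equation: \<open>qe_deriv\<close> expresses the
  derivatives of \<open>qe\<close> through \<open>q\<close> and \<open>qe\<close>, and both are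
  multiples of \<open>q\<close> with factors depending on \<open>x\<close> and \<open>G x\<close>
  alone.\<close>

definition G' :: "real \<Rightarrow> real" where
  "G' x = \<delta> * (1 - (G x)\<^sup>2) - 2 * \<alpha> * G x / x"

lemma denominator_pos: "0 < x \<Longrightarrow> 0 < z k * qe (z k) x + z l * qe (z l) x"
  using q_pos[of x] \<alpha> by (simp add: qe_sum)

lemma qe_l_G: "0 < x \<Longrightarrow> z l * qe (z l) x = (1 + G x) * (x * q x / \<alpha>) / 2"
  and qe_k_G: "0 < x \<Longrightarrow> z k * qe (z k) x = (1 - G x) * (x * q x / \<alpha>) / 2"
  unfolding qe_sum[symmetric] G_def using denominator_pos[of x] by (simp_all add: field_simps)

lemma q'_G: "0 < x \<Longrightarrow> q' x = q x * ((2 * \<alpha> - 1) / x - (1 / z k + 1 / z l) / 2 + \<delta> * G x)"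
proof -
  assume x: "0 < x"
  define u v where "u = 1 / z k" and "v = 1 / z l"
  have "qe (z k) x = (1 - G x) * (x * q x / \<alpha>) / 2 / z k" "qe (z l) x = (1 + G x) * (x * q x / \<alpha>) / 2 / z l"
    using qe_k_G[OF x] qe_l_G[OF x] zk zl by (metis less_irrefl nonzero_mult_div_cancel_left)+
  then have "\<alpha> * qe (z k) x = (1 - G x) * (x * q x) / 2 * u" "\<alpha> * qe (z l) x = (1 + G x) * (x * q x) / 2 * v"
    using \<alpha> by (simp_all add: u_def v_def)
  then have W: "\<alpha> * (qe (z k) x + qe (z l) x) = x * q x * ((1 - G x) * u + (1 + G x) * v) / 2"
    by (simp add: field_simps)
  show ?thesis
    unfolding q'_def W \<delta>_def u_def[symmetric] v_def[symmetric] using x by (simp add: field_simps)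
qed

lemma G_deriv:
  assumes x: "0 < x"
  shows "(G has_real_derivative G' x) (at x)"
proof -
  define N where "N x = z l * qe (z l) x - z k * qe (z k) x" for x
  define V where "V x = z k * qe (z k) x + z l * qe (z l) x" for x
  have V: "V x \<noteq> 0" "V x = x * q x / \<alpha>" using denominator_pos[OF x] by (auto simp: V_def qe_sum)
  have "(N has_real_derivative z l * ((q x - qe (z l) x) / z l) - z k * ((q x - qe (z k) x) / z k)) (at x)"
    unfolding N_def using x zk zl by (intro DERIV_diff DERIV_cmult qe_deriv)
  then have N: "(N has_real_derivative qe (z k) x - qe (z l) x) (at x)"
    using zk zl by simp
  have "(V has_real_derivative z k * ((q x - qe (z k) x) / z k) + z l * ((q x - qe (z l) x) / z l)) (at x)"
    unfolding V_def using x zk zl by (intro DERIV_add DERIV_cmult qe_deriv)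
  moreover have "z k * ((q x - qe (z k) x) / z k) + z l * ((q x - qe (z l) x) / z l) = 2 * q x - qe (z k) x - qe (z l) x"
    using zk zl by simp
  ultimately have V': "(V has_real_derivative 2 * q x - qe (z k) x - qe (z l) x) (at x)"
    by simp
  have "((\<lambda>x. N x / V x) has_real_derivative
      ((qe (z k) x - qe (z l) x) * V x - N x * (2 * q x - qe (z k) x - qe (z l) x)) / (V x * V x)) (at x)"
    by (rule DERIV_divide[OF N V' V(1)])
  moreover have "((qe (z k) x - qe (z l) x) * V x - N x * (2 * q x - qe (z k) x - qe (z l) x)) / (V x * V x) = G' x"
  proof -
    define u v where "u = 1 / z k" and "v = 1 / z l"
    have k: "qe (z k) x = (1 - G x) * V x / 2 * u" and l: "qe (z l) x = (1 + G x) * V x / 2 * v"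
      using qe_k_G[OF x, folded V(2)] qe_l_G[OF x, folded V(2)] zk zl by (simp_all add: field_simps u_def v_def)
    have n: "N x = G x * V x"
      using V(1) by (simp add: G_def N_def V_def)
    have qx: "q x = \<alpha> * V x / x" using x \<alpha> V(2) by (simp add: field_simps)
    have "(qe (z k) x - qe (z l) x) * V x - N x * (2 * q x - qe (z k) x - qe (z l) x)
        = (V x * V x) * (((1 - G x) * u - (1 + G x) * v) / 2
            - G x * (2 * \<alpha> / x - ((1 - G x) * u + (1 + G x) * v) / 2))"
      unfolding k l n qx using x by (simp add: field_simps)
    also have "((1 - G x) * u - (1 + G x) * v) / 2 - G x * (2 * \<alpha> / x - ((1 - G x) * u + (1 + G x) * v) / 2) = G' x"
      unfolding G'_def \<delta>_def u_def[symmetric] v_def[symmetric] by (simp add: algebra_simps power2_eq_square add_divide_distrib diff_divide_distrib)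
    finally show ?thesis using V(1) by simp
  qed
  ultimately show ?thesis
    by (simp add: G_def[abs_def] N_def V_def)
qed

lemma G_nonneg:
  assumes lt: "z k < z l" and x: "0 < x"
  shows "0 \<le> G x"
proof -
  have "0 \<le> z l * exp_kernel (z l) u - z k * exp_kernel (z k) u" for u
  proof (cases "0 < u")
    case True
    then have "u / z l \<le> u / z k" using lt zk by (intro divide_left_mono) auto
    then show ?thesis using True zk zl by (simp add: exp_kernel_def)
  qed (simp add: exp_kernel_def)
  then have "0 \<le> smear z {k, l} (\<lambda>u. z l * exp_kernel (z l) u - z k * exp_kernel (z k) u) x"
    unfolding smear_def by (intro Bochner_Integration.integral_nonneg) simp
  then have "0 \<le> z l * qe (z l) x - z k * qe (z k) x"
    using smear_exp_kernel_diff[of "{k, l}"] kl zk zl by (simp add: qe_def)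
  then show ?thesis
    unfolding G_def using denominator_pos[OF x] by simp
qed

text \<open>For a constant \<open>c\<close>, the difference \<open>c - G\<close> times the positive
  denominator is a combination of \<open>qe (z k)\<close> and \<open>qe (z l)\<close>, hence the
  smearing of two exponential kernels, and changes sign only from + to -. So \<open>G\<close> cannot
  fall below a level once it is above it.\<close>

lemma G_mono:
  assumes lt: "z k < z l" and x: "0 < x" "x \<le> y"
  shows "G x \<le> G y"
proof (rule field_le_epsilon)
  fix e :: real assume e: "0 < e"
  \<comment> \<open>The summand \<open>e\<close> makes \<open>c - G y\<close> strictly positive, as
    \<open>pm_sign\<close> requires.\<close>
  define c where "c = G y + e"
  have c: "0 \<le> c" using G_nonneg[OF lt, of y] x e by (simp add: c_def)
  define d where "d u = (c + 1) * z k * exp_kernel (z k) u - (1 - c) * z l * exp_kernel (z l) u" for u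
  have pm0: "pm_sign (smear z ({k, l} \<union> {}) d)"
  proof (rule pm_sign_smear_Un)
    show "pm_sign (smear z {} d)"
      unfolding smear_empty d_def using zk lt c by (intro pm_sign_exp_kernels) auto
    show "d \<in> borel_measurable borel" unfolding d_def by measurable
    show "\<bar>d y\<bar> \<le> \<bar>(c + 1) * z k\<bar> * (1 / z k) + \<bar>(1 - c) * z l\<bar> * (1 / z l)" for y
      unfolding d_def by (rule exp_kernel_diff_bounded[OF zk zl])
  qed (use kl zk zl in \<open>auto simp: d_def exp_kernel_eq_0\<close>)
  have sm: "smear z {k, l} d u = (c - G u) * (z k * qe (z k) u + z l * qe (z l) u)" if "0 < u" for u
  proof -
    have "smear z {k, l} d u = (c + 1) * z k * qe (z k) u - (1 - c) * z l * qe (z l) u"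
      unfolding d_def qe_def using smear_exp_kernel_diff[of "{k, l}"] kl zk zl by simp
    moreover have "G u * (z k * qe (z k) u + z l * qe (z l) u) = z l * qe (z l) u - z k * qe (z k) u"
      using denominator_pos[OF that] by (simp add: G_def)
    ultimately show ?thesis by (simp add: algebra_simps)
  qed
  have pm: "pm_sign (\<lambda>u. (c - G u) * (z k * qe (z k) u + z l * qe (z l) u))"
    unfolding pm_sign_def
  proof (intro allI impI, elim conjE)
    fix u v :: real
    assume "0 < u" "u < v" "0 < (c - G v) * (z k * qe (z k) v + z l * qe (z l) v)"
    then show "0 < (c - G u) * (z k * qe (z k) u + z l * qe (z l) u)"
      using pm0 sm[of u] sm[of v] unfolding pm_sign_def Un_empty_right by (metis order.strict_trans)
  qed
  have "0 < (c - G y) * (z k * qe (z k) y + z l * qe (z l) y)"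
    using denominator_pos[of y] x e by (simp add: c_def)
  then have "0 < (c - G x) * (z k * qe (z k) x + z l * qe (z l) x)"
  proof (cases "x = y")
    case False
    then have "x < y" using x by simp
    then show ?thesis
      using pm x(1) \<open>0 < (c - G y) * _\<close> unfolding pm_sign_def by blast
  qed simp
  then show "G x \<le> G y + e"
    using denominator_pos[OF x(1)] by (simp add: zero_less_mult_iff c_def)
qed

lemma G'_nonneg:
  assumes lt: "z k < z l" and x: "0 < x"
  shows "0 \<le> G' x"
proof (rule mono_on_imp_deriv_nonneg[OF _ G_deriv[OF x]])
  show "mono_on {0<..} G"
    using G_mono[OF lt] by (intro mono_onI) auto
qed (use x in \<open>simp add: interior_open\<close>)

text \<open>Log-concavity of \<open>q\<close> makes \<open>- q' / q\<close> increasing; by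
  \<open>q'_G\<close> its derivative is
  \<open>(2 * \<alpha> - 1) / x\<^sup>2 - \<delta> * G' x\<close>.\<close>

lemma G'_le:
  assumes x: "0 < x"
  shows "\<delta> * x\<^sup>2 * G' x \<le> 2 * \<alpha> - 1"
proof -
  define f where "f x = (1 / z k + 1 / z l) / 2 - (2 * \<alpha> - 1) / x - \<delta> * G x" for x
  have lc: "log_concave q"
    unfolding q_def
    by (rule log_concave_conv) (use \<alpha> zk zl log_concave_gamma_kernel gamma_kernel_eq_0 gamma_kernel_pos kernel_bdd_int in auto)
  have f: "f x = - (q' x / q x)" if "0 < x" for x
    using q'_G[OF that] q_pos[OF that] by (simp add: f_def)
  have "mono_on {0<..} f"
  proof (rule mono_onI)
    fix x y :: real assume xy: "x \<in> {0<..}" "y \<in> {0<..}" "x \<le> y"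
    have "q x * q' y \<le> q' x * q y"
      using log_concave_deriv[OF lc q_deriv, of x y] xy by (cases "x = y") auto
    then have "q' y / q y \<le> q' x / q x"
      using q_pos[of x] q_pos[of y] xy by (simp add: field_simps)
    then show "f x \<le> f y" using f xy by simp
  qed
  moreover have "(f has_real_derivative (2 * \<alpha> - 1) / x\<^sup>2 - \<delta> * G' x) (at x)"
    unfolding f_def using x
    by (auto intro!: derivative_eq_intros G_deriv simp: power2_eq_square minus_divide_left)
  ultimately have "0 \<le> (2 * \<alpha> - 1) / x\<^sup>2 - \<delta> * G' x"
    using x by (intro mono_on_imp_deriv_nonneg[of "{0<..}" f]) (auto simp: interior_open)
  then have "\<delta> * G' x \<le> (2 * \<alpha> - 1) / x\<^sup>2" by simp
  then show ?thesis using x by (simp add: field_simps)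
qed

text \<open>An antiderivative is \<open>H\<close>, because
  \<open>z l * qe (z l) - z k * qe (z k)\<close> has derivative \<open>qe (z k) - qe (z l)\<close>.
  It factors as \<open>q * P\<close> with \<open>P\<close> affine in \<open>x * G x\<close>. In
  contrast to \<open>pm_sign_q_qe_l\<close>, the decrease of \<open>H' / H\<close> is read off from
  the Riccati equation and not from a convolution.\<close>

lemma pm_sign_q_qe_diff:
  assumes ac: "0 \<le> a" "0 \<le> c" and lt: "z k < z l"
  shows "pm_sign (\<lambda>x. a * q' x + c * ((qe (z k) x - qe (z l) x) / (z l - z k)))"
proof (cases "a = 0 \<or> c = 0")
  case True
  then show ?thesis
    using pm_sign_q_qe_l[OF ac(1), of 0] pm_sign_qe_pair[OF _ ac(2) lt, of 0] by auto
next
  case False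
  define \<kappa> where "\<kappa> = 2 * \<alpha> - 1"
  define e where "e = c / (\<alpha> * (z l - z k))"
  define P where "P x = a + e * (x * G x)" for x
  define P' where "P' x = e * (G x + x * G' x)" for x
  define G'' where "G'' x = - 2 * \<delta> * G x * G' x - 2 * \<alpha> * G' x / x + 2 * \<alpha> * G x / x\<^sup>2" for x
  define H where "H x = a * q x + c * ((z l * qe (z l) x - z k * qe (z k) x) / (z l - z k))" for x
  define H' where "H' x = a * q' x + c * ((qe (z k) x - qe (z l) x) / (z l - z k))" for x
  \<comment> \<open>The logarithmic derivative of \<open>H\<close>: that of \<open>q\<close>, taken
    from \<open>q'_G\<close>, plus that of \<open>P\<close>.\<close>
  define L where "L x = \<kappa> / x - (1 / z k + 1 / z l) / 2 + \<delta> * G x + P' x / P x" for x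
  define L' where "L' x = - \<kappa> / x\<^sup>2 + \<delta> * G' x + (e * (2 * G' x + x * G'' x) * P x - P' x * P' x) / (P x * P x)" for x
  have a: "0 < a" and e: "0 < e" and \<kappa>: "1 \<le> \<kappa>"
    using False ac \<alpha> lt by (auto simp: e_def \<kappa>_def)
  have P: "0 < P x" if "0 < x" for x
    using a e G_nonneg[OF lt that] that unfolding P_def by (intro add_pos_nonneg) auto
  have Pd: "(P has_real_derivative P' x) (at x)" if "0 < x" for x
    unfolding P_def P'_def using that by (auto intro!: derivative_eq_intros G_deriv)
  have G'd: "(G' has_real_derivative G'' x) (at x)" if "0 < x" for x
  proof -
    have "((\<lambda>x. \<delta> * (1 - (G x)\<^sup>2) - 2 * \<alpha> * G x / x) has_real_derivative G'' x) (at x)"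
      unfolding G''_def using that
      by (auto intro!: derivative_eq_intros G_deriv simp: power2_eq_square field_simps)
    moreover have "G' = (\<lambda>x. \<delta> * (1 - (G x)\<^sup>2) - 2 * \<alpha> * G x / x)"
      by (simp add: fun_eq_iff G'_def)
    ultimately show ?thesis by simp
  qed
  have P'd: "(P' has_real_derivative e * (2 * G' x + x * G'' x)) (at x)" if "0 < x" for x
    unfolding P'_def using that
    by (auto intro!: derivative_eq_intros G_deriv G'd simp: algebra_simps)
  have Hd: "(H has_real_derivative H' x) (at x)" if "0 < x" for x
  proof -
    have "(H has_real_derivative a * q' x + c * ((z l * ((q x - qe (z l) x) / z l) - z k * ((q x - qe (z k) x) / z k)) / (z l - z k))) (at x)"
      unfolding H_def using that zk zl by (intro DERIV_add DERIV_cmult DERIV_cdivide DERIV_diff q_deriv qe_deriv)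
    then show ?thesis using zk zl by (simp add: H'_def)
  qed
  have HP: "H x = q x * P x" if "0 < x" for x
  proof -
    have "z l * qe (z l) x - z k * qe (z k) x = G x * (x * q x / \<alpha>)"
    proof -
      have "(1 + g) * w / 2 - (1 - g) * w / 2 = g * w" for g w :: real
        by (simp add: field_simps)
      then show ?thesis unfolding qe_l_G[OF that] qe_k_G[OF that] .
    qed
    then show ?thesis
      by (simp add: H_def P_def e_def algebra_simps)
  qed
  have HL: "H' x = H x * L x" if "0 < x" for x
  proof -
    have "((\<lambda>x. q x * P x) has_real_derivative q' x * P x + P' x * q x) (at x)"
      by (rule DERIV_mult[OF q_deriv[OF that] Pd[OF that]])
    moreover have "eventually (\<lambda>u. u \<in> {0<..}) (nhds x)"
      using that by (intro eventually_nhds_in_open) auto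
    then have "eventually (\<lambda>u. q u * P u = H u) (nhds x)"
      by eventually_elim (simp add: HP)
    ultimately have "(H has_real_derivative q' x * P x + P' x * q x) (at x)"
      using DERIV_cong_ev[OF refl _ refl, of "\<lambda>u. q u * P u" H x] by simp
    then have "H' x = q' x * P x + P' x * q x"
      using Hd[OF that] DERIV_unique by blast
    also have "P' x * q x = q x * P x * (P' x / P x)"
      using P[OF that] by simp
    also have "q' x = q x * (\<kappa> / x - (1 / z k + 1 / z l) / 2 + \<delta> * G x)"
      using q'_G[OF that] by (simp add: \<kappa>_def)
    finally have "H' x = q x * (\<kappa> / x - (1 / z k + 1 / z l) / 2 + \<delta> * G x) * P x + q x * P x * (P' x / P x)" .
    moreover have "a * b * c + a * c * d = a * c * (b + d)" for a b c d :: real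
      by (simp add: algebra_simps)
    ultimately show ?thesis
      unfolding HP[OF that] L_def by presburger
  qed
  have Ld: "(L has_real_derivative L' x) (at x)" if "0 < x" for x
  proof -
    have k: "((\<lambda>x. \<kappa> / x) has_real_derivative - \<kappa> / x\<^sup>2) (at x)"
      using that by (auto intro!: derivative_eq_intros simp: power2_eq_square)
    have "(L has_real_derivative - \<kappa> / x\<^sup>2 - 0 + \<delta> * G' x
        + (e * (2 * G' x + x * G'' x) * P x - P' x * P' x) / (P x * P x)) (at x)"
      unfolding L_def
      by (intro DERIV_add DERIV_diff DERIV_const DERIV_cmult DERIV_divide k G_deriv Pd P'd)
         (use that P[OF that] in auto)
    then show ?thesis by (simp add: L'_def)
  qed
  have L'_le: "L' x \<le> 0" if x: "0 < x" for x
  proof -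
    \<comment> \<open>Dimensionless quantities: \<open>\<xi>\<close> is the share of the second
      summand in \<open>P\<close>, \<open>\<mu>\<close> the logarithmic derivative of
      \<open>P\<close> in logarithmic scale, and \<open>h\<close> the slack in
      \<open>G'_le\<close>.\<close>
    define \<xi> where "\<xi> = e * x * G x / P x"
    define \<mu> where "\<mu> = x * P' x / P x"
    define h where "h = \<kappa> - \<delta> * x\<^sup>2 * G' x"
    have G0: "0 \<le> G x" "0 \<le> G' x"
      using G_nonneg[OF lt x] G'_nonneg[OF lt x] .
    have "0 \<le> \<delta>" using lt zk zl by (simp add: \<delta>_def frac_le)
    have "- h + 2 * h * \<xi> - (\<kappa> - 1) * \<mu> - \<mu>\<^sup>2 \<le> 0"
    proof (rule key_inequality[OF \<kappa>])
      show "0 \<le> h" using G'_le[OF x] by (simp add: h_def \<kappa>_def)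
      show "h \<le> \<kappa>" using G0 \<open>0 \<le> \<delta>\<close> by (simp add: h_def)
      show "0 \<le> \<xi>" using G0 e x P[OF x] by (simp add: \<xi>_def)
      show "\<xi> \<le> 1" using a P[OF x] by (simp add: \<xi>_def P_def field_simps)
      have "e * x * G x \<le> x * P' x"
        using e x G0 by (simp add: P'_def algebra_simps)
      then show "\<xi> \<le> \<mu>"
        using P[OF x] by (simp add: \<xi>_def \<mu>_def divide_right_mono)
    qed
    also have "- h + 2 * h * \<xi> - (\<kappa> - 1) * \<mu> - \<mu>\<^sup>2 = x\<^sup>2 * L' x"
    proof -
      define \<eta> where "\<eta> = e * x\<^sup>2 * G' x / P x"
      have mu: "\<mu> = \<xi> + \<eta>"
        by (simp add: \<mu>_def \<xi>_def \<eta>_def P'_def algebra_simps add_divide_distrib power2_eq_square)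
      have "x\<^sup>2 * (e * (2 * G' x + x * G'' x)) / P x
          = 2 * \<alpha> * \<xi> + (2 - 2 * \<alpha>) * \<eta> - 2 * (\<delta> * x\<^sup>2 * G' x) * \<xi>"
        unfolding \<xi>_def \<eta>_def G''_def using x P[OF x] by (simp add: field_simps power2_eq_square)
      moreover have "x\<^sup>2 * ((e * (2 * G' x + x * G'' x) * P x - P' x * P' x) / (P x * P x))
          = x\<^sup>2 * (e * (2 * G' x + x * G'' x)) / P x - \<mu>\<^sup>2"
        unfolding \<mu>_def using P[OF x] by (simp add: field_simps power2_eq_square)
      moreover have "x\<^sup>2 * (- \<kappa> / x\<^sup>2 + \<delta> * G' x) = - h"
        using x by (simp add: h_def field_simps)
      ultimately have "x\<^sup>2 * L' x = - h + (2 * \<alpha> * \<xi> + (2 - 2 * \<alpha>) * \<eta> - 2 * (\<delta> * x\<^sup>2 * G' x) * \<xi>) - \<mu>\<^sup>2"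
        unfolding L'_def by (simp add: distrib_left)
      moreover have "2 * \<alpha> * \<xi> + (2 - 2 * \<alpha>) * \<eta> - 2 * (\<delta> * x\<^sup>2 * G' x) * \<xi> = 2 * h * \<xi> - (\<kappa> - 1) * \<mu>"
        unfolding mu h_def \<kappa>_def by (simp add: algebra_simps)
      ultimately show ?thesis by simp
    qed
    finally show ?thesis
      using x by (simp add: mult_le_0_iff)
  qed
  have L_anti: "L y \<le> L x" if "0 < x" "x < y" for x y
    using that Ld L'_le by (intro DERIV_nonpos_imp_nonincreasing[of x y L]) (auto intro: order.trans, meson less_le_trans)
  have Hpos: "0 < H x" if "0 < x" for x
    using HP[OF that] P[OF that] q_pos[OF that] by simp
  have "pm_sign H'"
    unfolding pm_sign_def
  proof (intro allI impI, elim conjE)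
    fix x y :: real assume xy: "0 < x" "x < y" "0 < H' y"
    then have "0 < L y" using HL[of y] Hpos[of y] by (simp add: zero_less_mult_iff)
    then have "0 < L x" using L_anti[OF xy(1,2)] by simp
    then show "0 < H' x" using HL[OF xy(1)] Hpos[OF xy(1)] by simp
  qed
  then show ?thesis by (simp add: H'_def[abs_def])
qed

text \<open>The three functions are the derivatives of \<open>q\<close>, of \<open>q\<close> smeared
  by one exponential kernel, and of \<open>q\<close> smeared by both.\<close>

lemma pm_sign_combination:
  assumes "0 \<le> a" "0 \<le> b" "0 \<le> c" and lt: "z k < z l"
  shows "pm_sign (\<lambda>x. a * q' x + b * ((q x - qe (z l) x) / z l) + c * ((qe (z k) x - qe (z l) x) / (z l - z k)))"
  using assms pm_sign_q_qe_l pm_sign_qe_pair pm_sign_q_qe_diff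
  by (intro pm_sign_triple) auto

text \<open>
  With \<open>P = (1 + s D) (1 + t D)\<close>, applying \<open>P\<close> to the function in question yields
  \<open>A (t - s) q' + C (z l - z k) (P q\<^sup>+)'\<close>, where \<open>q\<^sup>+\<close> is the convolution of \<open>q\<close> with both
  exponential kernels; the Newton expansion of \<open>P\<close> at the roots \<open>- 1 / z k\<close>, \<open>- 1 / z l\<close> has
  nonnegative coefficients because \<open>s, t \<le> z k < z l\<close>.
\<close>

lemma pm_sign_qe_four:
  assumes AC: "0 \<le> A" "0 \<le> C" and st: "0 < s" "s \<le> t" "t \<le> z k" and lt: "z k < z l"
  shows "pm_sign (\<lambda>x. A * (qe s x - qe t x) + C * (qe (z k) x - qe (z l) x))"
proof -
  define wk wl where "wk = 1 - s / z k" and "wl = 1 - s / z l"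
  \<comment> \<open>\<open>B1\<close> is \<open>1 + s * D\<close> applied to the function in
    question, using \<open>qe s + s * (qe s)' = q\<close>; \<open>B1'\<close> is its derivative. The
    operator \<open>1 + t * D\<close> is applied to \<open>B1\<close> next, and both are inverted by
    \<open>pm_sign_exp_operator\<close>.\<close>
  define B1 where "B1 x = A * ((1 - s / t) * (q x - qe t x)) + C * (wk * qe (z k) x - wl * qe (z l) x + (wl - wk) * q x)" for x
  define B1' where "B1' x = A * ((1 - s / t) * (q' x - (q x - qe t x) / t))
     + C * (wk * ((q x - qe (z k) x) / z k) - wl * ((q x - qe (z l) x) / z l) + (wl - wk) * q' x)" for x
  \<comment> \<open>The values of the polynomial \<open>(1 + s * D) * (1 + t * D)\<close> at
    \<open>- 1 / z k\<close> and \<open>- 1 / z l\<close>.\<close>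
  define Wk Wl where "Wk = wk * (1 - t / z k)" and "Wl = wl * (1 - t / z l)"
  have t: "0 < t" using st by simp
  have "pm_sign (\<lambda>x. (A * (t - s) + C * (s * t * (1 / z k - 1 / z l))) * q' x
      + (C * ((Wl - Wk) * z l)) * ((q x - qe (z l) x) / z l)
      + (C * (Wk * (z l - z k))) * ((qe (z k) x - qe (z l) x) / (z l - z k)))"
  proof (rule pm_sign_combination[OF _ _ _ lt])
    have "1 / z l \<le> 1 / z k" using zk lt by (simp add: frac_le)
    then show "0 \<le> A * (t - s) + C * (s * t * (1 / z k - 1 / z l))"
      using AC st t by (intro add_nonneg_nonneg mult_nonneg_nonneg) auto
    have w: "0 \<le> wk" "wk \<le> wl" "0 \<le> 1 - t / z k" "1 - t / z k \<le> 1 - t / z l"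
      using st t zk zl lt unfolding wk_def wl_def by (auto simp: divide_left_mono)
    then have "Wk \<le> Wl" unfolding Wk_def Wl_def by (intro mult_mono) auto
    then show "0 \<le> C * ((Wl - Wk) * z l)" using AC zl by simp
    show "0 \<le> C * (Wk * (z l - z k))" using AC lt w by (simp add: Wk_def)
  qed
  also have "(\<lambda>x. (A * (t - s) + C * (s * t * (1 / z k - 1 / z l))) * q' x
      + (C * ((Wl - Wk) * z l)) * ((q x - qe (z l) x) / z l)
      + (C * (Wk * (z l - z k))) * ((qe (z k) x - qe (z l) x) / (z l - z k))) = (\<lambda>x. B1 x + t * B1' x)"
  proof
    fix x
    have 1: "(t - s) * q' x = (1 - s / t) * (q x - qe t x) + t * ((1 - s / t) * (q' x - (q x - qe t x) / t))"
      using t by (simp add: field_simps)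
    define u v where "u = 1 / z k" and "v = 1 / z l"
    have 2: "(s * t * (u - v)) * q' x + (Wl - Wk) * (q x - qe (z l) x) + Wk * (qe (z k) x - qe (z l) x)
      = (wk * qe (z k) x - wl * qe (z l) x + (wl - wk) * q x)
       + t * (wk * ((q x - qe (z k) x) / z k) - wl * ((q x - qe (z l) x) / z l) + (wl - wk) * q' x)"
      unfolding Wk_def Wl_def wk_def wl_def divide_inverse
      by (simp add: u_def v_def divide_inverse algebra_simps)
    have "(C * ((Wl - Wk) * z l)) * ((q x - qe (z l) x) / z l) = C * ((Wl - Wk) * (q x - qe (z l) x))"
      "(C * (Wk * (z l - z k))) * ((qe (z k) x - qe (z l) x) / (z l - z k)) = C * (Wk * (qe (z k) x - qe (z l) x))"
      using zl lt by simp_all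
    then have "(A * (t - s) + C * (s * t * (1 / z k - 1 / z l))) * q' x
      + (C * ((Wl - Wk) * z l)) * ((q x - qe (z l) x) / z l)
      + (C * (Wk * (z l - z k))) * ((qe (z k) x - qe (z l) x) / (z l - z k))
      = A * ((t - s) * q' x)
      + C * ((s * t * (u - v)) * q' x + (Wl - Wk) * (q x - qe (z l) x) + Wk * (qe (z k) x - qe (z l) x))"
      unfolding u_def v_def by (simp only: distrib_left distrib_right mult.assoc add.assoc)
    also have "\<dots> = B1 x + t * B1' x"
    proof -
      have gen: "A * (p + t * p') + C * (r + t * r') = (A * p + C * r) + t * (A * p' + C * r')" for p p' r r'
        by (simp add: algebra_simps)
      show ?thesis unfolding 1 2 B1_def B1'_def by (rule gen)
    qed
    finally show "(A * (t - s) + C * (s * t * (1 / z k - 1 / z l))) * q' x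
      + (C * ((Wl - Wk) * z l)) * ((q x - qe (z l) x) / z l)
      + (C * (Wk * (z l - z k))) * ((qe (z k) x - qe (z l) x) / (z l - z k)) = B1 x + t * B1' x" .
  qed
  finally have pm2: "pm_sign (\<lambda>x. B1 x + t * B1' x)" .
  have pm1: "pm_sign B1"
  proof (rule pm_sign_exp_operator[OF t _ _ _ pm2])
    show "B1 0 = 0" using t zk zl by (simp add: B1_def q_eq_0 qe_0)
    show "continuous_on {0..} B1"
      unfolding B1_def using t zk zl by (intro continuous_intros q_continuous qe_continuous)
    show "(B1 has_real_derivative B1' x) (at x)" if "0 < x" for x
      unfolding B1_def B1'_def using that t zk zl
      by (intro DERIV_add DERIV_cmult DERIV_diff q_deriv qe_deriv)
  qed
  define B' where "B' x = A * ((q x - qe s x) / s - (q x - qe t x) / t)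
     + C * ((q x - qe (z k) x) / z k - (q x - qe (z l) x) / z l)" for x
  have "(\<lambda>x. (A * (qe s x - qe t x) + C * (qe (z k) x - qe (z l) x)) + s * B' x) = B1"
  proof
    fix x
    define E where "E = (q x - qe s x) / s"
    have E: "q x = qe s x + s * E" using st by (simp add: E_def)
    then show "(A * (qe s x - qe t x) + C * (qe (z k) x - qe (z l) x)) + s * B' x = B1 x"
      unfolding B'_def B1_def wk_def wl_def E_def[symmetric]
      using arg_cong[OF E, of "\<lambda>r. A * r"] by (simp add: algebra_simps divide_inverse)
  qed
  with pm1 have pm1': "pm_sign (\<lambda>x. (A * (qe s x - qe t x) + C * (qe (z k) x - qe (z l) x)) + s * B' x)"
    by simp
  show ?thesis
  proof (rule pm_sign_exp_operator[OF st(1) _ _ _ pm1'])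
    show "A * (qe s 0 - qe t 0) + C * (qe (z k) 0 - qe (z l) 0) = 0"
      using st t zk zl by (simp add: qe_0)
    show "continuous_on {0..} (\<lambda>x. A * (qe s x - qe t x) + C * (qe (z k) x - qe (z l) x))"
      using st t zk zl by (intro continuous_intros qe_continuous)
    show "((\<lambda>x. A * (qe s x - qe t x) + C * (qe (z k) x - qe (z l) x)) has_real_derivative B' x) (at x)"
      if "0 < x" for x
      unfolding B'_def using that st t zk zl
      by (intro DERIV_add DERIV_cmult DERIV_diff qe_deriv)
  qed
qed

end

section \<open>Dependence of the distribution function on the weights\<close>

lemma isCont_exp_kernel2:
  fixes S U :: "nat \<Rightarrow> real"
  assumes "S \<longlonglongrightarrow> s" "U \<longlonglongrightarrow> u" "0 < s" "u \<noteq> 0"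
  shows "(\<lambda>m. exp_kernel (S m) (U m)) \<longlonglongrightarrow> exp_kernel s u"
proof (cases "0 < u")
  case True
  have ev: "eventually (\<lambda>m. 0 < U m) sequentially"
    by (rule order_tendstoD(1)[OF assms(2) True])
  have eq: "eventually (\<lambda>m. exp (- U m / S m) / S m = exp_kernel (S m) (U m)) sequentially"
    using ev by (rule eventually_mono) (simp add: exp_kernel_def)
  have "(\<lambda>m. exp (- U m / S m) / S m) \<longlonglongrightarrow> exp (- u / s) / s"
    using assms by (intro tendsto_intros) auto
  from Lim_transform_eventually[OF this eq] show ?thesis
    using True by (simp add: exp_kernel_def)
next
  case False
  then have "u < 0" using assms by simp
  have ev: "eventually (\<lambda>m. U m < 0) sequentially"
    by (rule order_tendstoD(2)[OF assms(2) \<open>u < 0\<close>])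
  have eq: "eventually (\<lambda>m. 0 = exp_kernel (S m) (U m)) sequentially"
    using ev by (rule eventually_mono) (simp add: exp_kernel_def)
  from Lim_transform_eventually[OF tendsto_const eq] show ?thesis
    using \<open>u < 0\<close> by (simp add: exp_kernel_def)
qed

context iid_gamma
begin

definition F :: "(nat \<Rightarrow> real) \<Rightarrow> real \<Rightarrow> real" where
  "F z = smear z {..<n} (indicator {0..})"

definition \<phi> :: "nat \<Rightarrow> (nat \<Rightarrow> real) \<Rightarrow> real \<Rightarrow> real" where
  "\<phi> i z = smear z {..<n} (exp_kernel (z i))"

lemma F_eq_prob: "F z x = prob {\<omega> \<in> space M. wsum z {..<n} \<omega> \<le> x}"
proof -
  note [measurable] = wsum_measurable[of "{..<n}" z, OF order_refl]
  have "F z x = expectation (indicator {\<omega> \<in> space M. wsum z {..<n} \<omega> \<le> x})"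
    unfolding F_def smear_def by (intro Bochner_Integration.integral_cong) (auto simp: indicator_def)
  also have "\<dots> = prob {\<omega> \<in> space M. wsum z {..<n} \<omega> \<le> x}"
    by simp
  finally show ?thesis .
qed

lemma wsum_split:
  assumes "i < n"
  shows "wsum z {..<n} \<omega> = z i * X i \<omega> + wsum z ({..<n} - {i}) \<omega>"
  unfolding wsum_def using assms by (simp add: sum.remove[of "{..<n}" i])

lemma X_pos: "i < n \<Longrightarrow> AE \<omega> in M. 0 < X i \<omega>"
proof -
  assume i: "i < n"
  note [measurable] = X_measurable[OF i]
  have "expectation (indicator {\<omega> \<in> space M. X i \<omega> \<le> 0}) = expectation (\<lambda>\<omega>. indicator {..0} (X i \<omega>))"
    by (intro Bochner_Integration.integral_cong) (auto simp: indicator_def)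
  also have "\<dots> = (LINT u|lborel. gamma_density \<alpha> u * indicator {..0} u)"
    by (rule expectation_gamma[OF i]) simp
  also have "(\<lambda>u. gamma_density \<alpha> u * indicator {..0} u) = (\<lambda>_. 0)"
    by (auto simp: fun_eq_iff indicator_def gamma_density_eq_0)
  finally have "prob {\<omega> \<in> space M. X i \<omega> \<le> 0} = 0" by simp
  then have "AE \<omega> in M. \<not> X i \<omega> \<le> 0"
    by (subst AE_iff_measurable[OF _ refl]) (auto simp: emeasure_eq_measure)
  then show ?thesis by eventually_elim simp
qed

text \<open>With the other variables frozen, the event \<open>wsum z {..<n} \<omega> = x\<close>
  leaves a single value for \<open>X i\<close>, a null set for its density.\<close>

lemma wsum_neq:
  assumes i: "i < n" "0 < z i"
  shows "AE \<omega> in M. wsum z {..<n} \<omega> \<noteq> x"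
proof -
  note [measurable] = wsum_measurable[of "{..<n}" z, OF order_refl]
  have zero: "(LINT u|lborel. gamma_density \<alpha> u * indicator {x} (z i * u + w)) = 0" for w :: real
  proof -
    have "AE u in lborel. gamma_density \<alpha> u * indicator {x} (z i * u + w) = 0"
      using AE_lborel_singleton[of "(x - w) / z i"]
      by eventually_elim (use i in \<open>auto simp: indicator_def field_simps\<close>)
    then show ?thesis by (rule integral_eq_zero_AE)
  qed
  have "prob {\<omega> \<in> space M. wsum z {..<n} \<omega> = x} = expectation (indicator {\<omega> \<in> space M. wsum z {..<n} \<omega> = x})"
    by simp
  also have "\<dots> = expectation (\<lambda>\<omega>. (\<lambda>p. indicator {x} (z i * fst p + snd p)) (X i \<omega>, wsum z ({..<n} - {i}) \<omega>))"
    by (intro Bochner_Integration.integral_cong) (auto simp: indicator_def wsum_split[OF i(1), of z])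
  also have "\<dots> = expectation (\<lambda>\<omega>. LINT u|lborel. gamma_density \<alpha> u *
      indicator {x} (z i * fst (u, wsum z ({..<n} - {i}) \<omega>) + snd (u, wsum z ({..<n} - {i}) \<omega>)))"
    using i by (intro expectation_split'[where B = 1]) (auto simp: indicator_def)
  also have "\<dots> = 0" by (simp add: zero)
  finally have "prob {\<omega> \<in> space M. wsum z {..<n} \<omega> = x} = 0" by simp
  then show ?thesis
    by (subst AE_iff_measurable[OF _ refl]) (auto simp: emeasure_eq_measure)
qed

lemma wsum_tendsto:
  assumes "\<And>i. i < n \<Longrightarrow> (\<lambda>m. Z m i) \<longlonglongrightarrow> z i"
  shows "(\<lambda>m. wsum (Z m) {..<n} \<omega>) \<longlonglongrightarrow> wsum z {..<n} \<omega>"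
  unfolding wsum_def using assms by (intro tendsto_sum tendsto_mult tendsto_const) auto

text \<open>The indicators converge off the event that the limiting sum equals \<open>x\<close>,
  which one positive limiting weight makes null. The other weights may tend to 0, as the final
  approximation by positive weights requires.\<close>

lemma F_tendsto:
  assumes Z: "\<And>i. i < n \<Longrightarrow> (\<lambda>m. Z m i) \<longlonglongrightarrow> z i" and i: "i < n" "0 < z i"
  shows "(\<lambda>m. F (Z m) x) \<longlonglongrightarrow> F z x"
  unfolding F_def smear_def
proof (rule integral_dominated_convergence[where w = "\<lambda>_. 1"])
  note [measurable] = wsum_measurable[of "{..<n}", OF order_refl]
  show "(\<lambda>\<omega>. indicator {0..} (x - wsum z {..<n} \<omega>)) \<in> borel_measurable M"
    and "(\<lambda>\<omega>. indicator {0..} (x - wsum (Z m) {..<n} \<omega>)) \<in> borel_measurable M" for m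
    by measurable
  show "AE \<omega> in M. (\<lambda>m. indicator {0..} (x - wsum (Z m) {..<n} \<omega>)) \<longlonglongrightarrow> (indicator {0..} (x - wsum z {..<n} \<omega>) :: real)"
    using wsum_neq[of i z x, OF i]
  proof eventually_elim
    case (elim \<omega>)
    note W = wsum_tendsto[of Z z \<omega>, OF Z]
    show ?case
    proof (cases "wsum z {..<n} \<omega> < x")
      case True
      have "eventually (\<lambda>m. wsum (Z m) {..<n} \<omega> < x) sequentially"
        by (rule order_tendstoD(2)[OF W True])
      then have "eventually (\<lambda>m. 1 = (indicator {0..} (x - wsum (Z m) {..<n} \<omega>) :: real)) sequentially"
        by eventually_elim (simp add: indicator_def)
      moreover have "(indicator {0..} (x - wsum z {..<n} \<omega>) :: real) = 1"
        using True by (simp add: indicator_def)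
      ultimately show ?thesis
        using Lim_transform_eventually[OF tendsto_const] by metis
    next
      case False
      then have "x < wsum z {..<n} \<omega>" using elim by simp
      have "eventually (\<lambda>m. x < wsum (Z m) {..<n} \<omega>) sequentially"
        by (rule order_tendstoD(1)[OF W \<open>x < _\<close>])
      then have "eventually (\<lambda>m. 0 = (indicator {0..} (x - wsum (Z m) {..<n} \<omega>) :: real)) sequentially"
        by eventually_elim (simp add: indicator_def)
      moreover have "(indicator {0..} (x - wsum z {..<n} \<omega>) :: real) = 0"
        using \<open>x < _\<close> by (simp add: indicator_def)
      ultimately show ?thesis
        using Lim_transform_eventually[OF tendsto_const] by metis
    qed
  qed
qed (auto simp: indicator_def)

lemma \<phi>_tendsto:
  assumes Z: "\<And>i. i < n \<Longrightarrow> (\<lambda>m. Z m i) \<longlonglongrightarrow> z i" and i: "i < n" and c: "0 < c" "\<And>m. c \<le> Z m i"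
  shows "(\<lambda>m. \<phi> i (Z m) x) \<longlonglongrightarrow> \<phi> i z x"
  unfolding \<phi>_def smear_def
proof (rule integral_dominated_convergence[where w = "\<lambda>_. 1 / c"])
  note [measurable] = wsum_measurable[of "{..<n}", OF order_refl]
  have "c \<le> z i"
    by (rule LIMSEQ_le_const[OF Z[OF i]]) (use c in auto)
  then have zi: "0 < z i" using c by simp
  show "(\<lambda>\<omega>. exp_kernel (z i) (x - wsum z {..<n} \<omega>)) \<in> borel_measurable M"
    and "(\<lambda>\<omega>. exp_kernel (Z m i) (x - wsum (Z m) {..<n} \<omega>)) \<in> borel_measurable M" for m
    by measurable
  show "AE \<omega> in M. (\<lambda>m. exp_kernel (Z m i) (x - wsum (Z m) {..<n} \<omega>)) \<longlonglongrightarrow> exp_kernel (z i) (x - wsum z {..<n} \<omega>)"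
    using wsum_neq[of i z x, OF i zi]
    by eventually_elim (intro isCont_exp_kernel2 Z i zi tendsto_diff tendsto_const wsum_tendsto, auto)
  show "AE \<omega> in M. norm (exp_kernel (Z m i) (x - wsum (Z m) {..<n} \<omega>)) \<le> 1 / c" for m
  proof (rule AE_I2)
    fix \<omega>
    have "0 < Z m i" using c(1) c(2)[of m] by simp
    then have "\<bar>exp_kernel (Z m i) (x - wsum (Z m) {..<n} \<omega>)\<bar> \<le> 1 / Z m i"
      by (rule exp_kernel_le)
    also have "\<dots> \<le> 1 / c" using c(1) c(2)[of m] by (simp add: frac_le)
    finally show "norm (exp_kernel (Z m i) (x - wsum (Z m) {..<n} \<omega>)) \<le> 1 / c" by simp
  qed
qed auto

lemma \<phi>_pos:
  assumes "i < n" "\<And>j. j < n \<Longrightarrow> 0 < z j" "0 < x"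
  shows "0 < \<phi> i z x"
  unfolding \<phi>_def using assms exp_kernel_le[of "z i"]
  by (intro smear_pos[where B = "1 / z i"]) (auto simp: exp_kernel_eq_0 exp_kernel_pos)

lemma F_antimono:
  assumes "\<And>i. i < n \<Longrightarrow> z i \<le> z' i"
  shows "F z' x \<le> F z x"
proof -
  note [measurable] = wsum_measurable[of "{..<n}", OF order_refl]
  have "AE \<omega> in M. \<forall>i\<in>{..<n}. 0 < X i \<omega>"
    by (rule AE_finite_allI) (auto intro: X_pos)
  then have "AE \<omega> in M. wsum z {..<n} \<omega> \<le> wsum z' {..<n} \<omega>"
  proof eventually_elim
    case (elim \<omega>)
    then show ?case
      unfolding wsum_def using assms by (intro sum_mono mult_right_mono) (auto intro: less_imp_le)
  qed
  then show ?thesis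
    unfolding F_eq_prob by (intro finite_measure_mono_AE) auto
qed

section \<open>Differentiating the distribution function in a single weight\<close>

definition gamma_cdf :: "real \<Rightarrow> real" where
  "gamma_cdf t = (LINT u|lborel. gamma_density \<alpha> u * indicator {..t} u)"

lemma gamma_cdf_nonpos: "t \<le> 0 \<Longrightarrow> gamma_cdf t = 0"
proof -
  assume "t \<le> 0"
  then have "(\<lambda>u. gamma_density \<alpha> u * indicator {..t} u) = (\<lambda>_. 0)"
    by (auto simp: fun_eq_iff indicator_def gamma_density_eq_0)
  then show ?thesis by (simp add: gamma_cdf_def)
qed

lemma gamma_cdf_deriv:
  assumes n: "0 < n" and t: "0 < t"
  shows "(gamma_cdf has_real_derivative gamma_density \<alpha> t) (at t)"
proof -
  have int: "integrable lborel (\<lambda>u. gamma_density \<alpha> u * indicator {..b} u)" for b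
    using gamma_density_integrable[OF n] by (intro integrable_real_mult_indicator) auto
  have hi: "(gamma_density \<alpha> has_integral gamma_cdf b) {0..b}" for b
  proof -
    have "((\<lambda>u. gamma_density \<alpha> u * indicator {..b} u) has_integral gamma_cdf b) UNIV"
      unfolding gamma_cdf_def by (rule has_integral_integral_lborel[OF int])
    then have "((\<lambda>u. if u \<in> {0..b} then gamma_density \<alpha> u else 0) has_integral gamma_cdf b) UNIV"
      by (rule has_integral_eq[rotated]) (auto simp: indicator_def gamma_density_eq_0)
    then show ?thesis by (simp only: has_integral_restrict_UNIV)
  qed
  have "gamma_density \<alpha> integrable_on {0..t + 1}"
    using hi by blast
  then have "((\<lambda>u. integral {0..u} (gamma_density \<alpha>)) has_vector_derivative gamma_density \<alpha> t) (at t within ({0..t + 1} - {}))"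
    using t isCont_gamma_density[of t \<alpha>]
    by (intro integral_has_vector_derivative_continuous_at) (auto intro: continuous_at_imp_continuous_at_within)
  moreover have "(\<lambda>u. integral {0..u} (gamma_density \<alpha>)) = gamma_cdf"
    using hi by (simp add: fun_eq_iff integral_unique)
  ultimately have "(gamma_cdf has_real_derivative gamma_density \<alpha> t) (at t within {0..t + 1})"
    by (simp add: has_real_derivative_iff_has_vector_derivative)
  then show ?thesis
    using t by (subst (asm) at_within_interior) auto
qed

text \<open>The chain rule produces the factor \<open>c / s\<close>, which size biasing absorbs into
  a higher shape.\<close>

lemma gamma_cdf_scaled_deriv:
  assumes n: "0 < n" and s: "0 < s"
  shows "((\<lambda>s. gamma_cdf (c / s)) has_real_derivative - \<alpha> * gamma_kernel (\<alpha> + 1) s c) (at s)"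
proof (cases "0 < c")
  case True
  have "((\<lambda>s. c / s) has_real_derivative - c / (s * s)) (at s)"
    using s by (auto intro!: derivative_eq_intros)
  moreover have "(gamma_cdf has_real_derivative gamma_density \<alpha> (c / s)) (at (c / s))"
    using n True s by (intro gamma_cdf_deriv) auto
  ultimately have "((\<lambda>s. gamma_cdf (c / s)) has_real_derivative gamma_density \<alpha> (c / s) * (- c / (s * s))) (at s)"
    using DERIV_chain2 by blast
  moreover have "gamma_density \<alpha> (c / s) * (- c / (s * s)) = - (c / s * gamma_density \<alpha> (c / s)) / s"
    by simp
  moreover have "\<dots> = - \<alpha> * gamma_kernel (\<alpha> + 1) s c"
    using \<alpha> gamma_density_Suc[of \<alpha> "c / s"] by (simp add: gamma_kernel_def)
  ultimately show ?thesis by metis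
next
  case False
  have "eventually (\<lambda>u. u \<in> {0<..}) (nhds s)"
    using s by (intro eventually_nhds_in_open) auto
  then have "eventually (\<lambda>u. 0 = gamma_cdf (c / u)) (nhds s)"
    by eventually_elim (use False in \<open>simp add: gamma_cdf_nonpos divide_nonpos_pos\<close>)
  then have "((\<lambda>u. gamma_cdf (c / u)) has_real_derivative 0) (at s)"
    by (rule iffD1[OF DERIV_cong_ev[OF refl _ refl]]) (rule DERIV_const)
  then show ?thesis
    using False s gamma_kernel_eq_0[of s c "\<alpha> + 1"] by simp
qed

lemma F_eq_cdf:
  assumes i: "i < n" and s: "0 < s"
  shows "F (z(i := s)) x = expectation (\<lambda>\<omega>. gamma_cdf ((x - wsum z ({..<n} - {i}) \<omega>) / s))"
proof -
  have split: "wsum (z(i := s)) {..<n} \<omega> = s * X i \<omega> + wsum z ({..<n} - {i}) \<omega>" for \<omega>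
    unfolding wsum_split[OF i, of "z(i := s)"] by (simp add: wsum_def)
  have "F (z(i := s)) x = expectation (\<lambda>\<omega>. (\<lambda>p. indicator {0..} (x - s * fst p - snd p)) (X i \<omega>, wsum z ({..<n} - {i}) \<omega>))"
    unfolding F_def smear_def
    by (intro Bochner_Integration.integral_cong refl) (simp add: split diff_diff_eq)
  also have "\<dots> = expectation (\<lambda>\<omega>. LINT u|lborel. gamma_density \<alpha> u *
      indicator {0..} (x - s * fst (u, wsum z ({..<n} - {i}) \<omega>) - snd (u, wsum z ({..<n} - {i}) \<omega>)))"
    using i by (intro expectation_split'[where B = 1]) (auto simp: indicator_def)
  also have "\<dots> = expectation (\<lambda>\<omega>. gamma_cdf ((x - wsum z ({..<n} - {i}) \<omega>) / s))"
    unfolding gamma_cdf_def using s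
    by (intro Bochner_Integration.integral_cong refl arg_cong2[where f = "(*)"])
       (auto simp: indicator_def field_simps)
  finally show ?thesis .
qed

text \<open>The exponential variable in \<open>\<phi>\<close> merges with \<open>s * X i\<close>.
  The resulting kernel of shape \<open>\<alpha> + 1\<close> is the one that appears when
  \<open>F\<close> is differentiated in the weight.\<close>

lemma \<phi>_eq_kernel:
  assumes i: "i < n" and s: "0 < s"
  shows "\<phi> i (z(i := s)) x = expectation (\<lambda>\<omega>. gamma_kernel (\<alpha> + 1) s (x - wsum z ({..<n} - {i}) \<omega>))"
proof -
  have split: "wsum (z(i := s)) {..<n} \<omega> = s * X i \<omega> + wsum z ({..<n} - {i}) \<omega>" for \<omega>
    unfolding wsum_split[OF i, of "z(i := s)"] by (simp add: wsum_def)
  have "\<phi> i (z(i := s)) x = expectation (\<lambda>\<omega>. (\<lambda>p. exp_kernel s (x - s * fst p - snd p)) (X i \<omega>, wsum z ({..<n} - {i}) \<omega>))"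
    unfolding \<phi>_def smear_def
    by (intro Bochner_Integration.integral_cong refl) (simp add: split diff_diff_eq)
  also have "\<dots> = expectation (\<lambda>\<omega>. LINT u|lborel. gamma_density \<alpha> u *
      exp_kernel s (x - s * fst (u, wsum z ({..<n} - {i}) \<omega>) - snd (u, wsum z ({..<n} - {i}) \<omega>)))"
    using i exp_kernel_le[OF s] by (intro expectation_split'[where B = "1 / s"]) auto
  also have "\<dots> = expectation (\<lambda>\<omega>. gamma_kernel (\<alpha> + 1) s (x - wsum z ({..<n} - {i}) \<omega>))"
  proof (intro Bochner_Integration.integral_cong refl)
    fix \<omega>
    define c where "c = x - wsum z ({..<n} - {i}) \<omega>"
    have "gamma_kernel (\<alpha> + 1) s c = conv (exp_kernel s) (gamma_kernel \<alpha> s) c"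
      using conv_gamma_exp_kernel[OF \<alpha> s gamma_density_integrable] i by (simp add: conv_commute)
    also have "\<dots> = \<bar>s\<bar> *\<^sub>R (LINT u|lborel. exp_kernel s (c - (0 + s * u)) * gamma_kernel \<alpha> s (0 + s * u))"
      unfolding conv_def using s by (intro lborel_integral_real_affine) simp
    also have "\<dots> = (LINT u|lborel. gamma_density \<alpha> u * exp_kernel s (c - s * u))"
      using s by (simp add: gamma_kernel_def mult.commute)
    finally show "(LINT u|lborel. gamma_density \<alpha> u *
        exp_kernel s (x - s * fst (u, wsum z ({..<n} - {i}) \<omega>) - snd (u, wsum z ({..<n} - {i}) \<omega>)))
      = gamma_kernel (\<alpha> + 1) s (x - wsum z ({..<n} - {i}) \<omega>)"
      by (simp add: c_def algebra_simps)
  qed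
  finally show ?thesis .
qed

lemma gamma_cdf_measurable [measurable]: "gamma_cdf \<in> borel_measurable borel"
proof -
  have "(\<lambda>t. LINT u|lborel. gamma_density \<alpha> u * (if u \<le> t then 1 else 0)) \<in> borel_measurable borel"
    by measurable
  then show ?thesis
    by (simp add: gamma_cdf_def[abs_def] indicator_def of_bool_def)
qed

lemma F_deriv:
  assumes i: "i < n" and s: "0 < s"
  shows "((\<lambda>s. F (z(i := s)) x) has_real_derivative - \<alpha> * \<phi> i (z(i := s)) x) (at s)"
proof -
  define W where "W = wsum z ({..<n} - {i})"
  note [measurable] = X_measurable[OF i]
  have [measurable]: "W \<in> borel_measurable M"
    unfolding W_def by (intro wsum_measurable) auto
  have n: "0 < n" using i by simp
  obtain B where B: "\<And>u. \<bar>gamma_density (\<alpha> + 1) u\<bar> \<le> B" "0 < B"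
    using gamma_density_bounded[of "\<alpha> + 1"] \<alpha> by auto
  define g where "g r c = gamma_cdf (c / r)" for r c
  have gd: "((\<lambda>r. g r c) has_real_derivative - \<alpha> * gamma_kernel (\<alpha> + 1) r c) (at r)" if "0 < r" for r c
    unfolding g_def by (rule gamma_cdf_scaled_deriv[OF n that])
  \<comment> \<open>A common bound for the derivatives in the weight over all
    \<open>r > s / 2\<close>; through the mean value theorem it dominates the difference
    quotients.\<close>
  define w where "w = \<alpha> * (2 * B / s)"
  have kb: "\<bar>\<alpha> * gamma_kernel (\<alpha> + 1) r c\<bar> \<le> w" if "s / 2 < r" for r c
  proof -
    have "0 < r" using that s by linarith
    then have "\<bar>gamma_kernel (\<alpha> + 1) r c\<bar> \<le> B / r"
      using B by (simp add: gamma_kernel_def divide_right_mono)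
    also have "\<dots> \<le> B / (s / 2)" using that s B by (intro divide_left_mono) auto
    finally have "\<alpha> * \<bar>gamma_kernel (\<alpha> + 1) r c\<bar> \<le> \<alpha> * (B / (s / 2))"
      using \<alpha> by (intro mult_left_mono) auto
    then show ?thesis using \<alpha> by (simp add: abs_mult w_def mult.commute)
  qed
  have gb: "\<bar>(g r c - g s c) / (r - s)\<bar> \<le> w" if "s / 2 < r" "r \<noteq> s" for r c
  proof -
    have "\<exists>\<xi>>s / 2. g r c - g s c = (r - s) * (- \<alpha> * gamma_kernel (\<alpha> + 1) \<xi> c)"
    proof (cases "r < s")
      case True
      have "\<exists>\<xi>>r. \<xi> < s \<and> g s c - g r c = (s - r) * (- \<alpha> * gamma_kernel (\<alpha> + 1) \<xi> c)"
        using True that s by (intro MVT2 gd) auto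
      then obtain \<xi> where "r < \<xi>" "g s c - g r c = (s - r) * (- \<alpha> * gamma_kernel (\<alpha> + 1) \<xi> c)" by blast
      then show ?thesis using that by (intro exI[of _ \<xi>]) (auto simp: algebra_simps)
    next
      case False
      have "\<exists>\<xi>>s. \<xi> < r \<and> g r c - g s c = (r - s) * (- \<alpha> * gamma_kernel (\<alpha> + 1) \<xi> c)"
        using False that s by (intro MVT2 gd) auto
      then obtain \<xi> where "s < \<xi>" "g r c - g s c = (r - s) * (- \<alpha> * gamma_kernel (\<alpha> + 1) \<xi> c)" by blast
      then show ?thesis using s by (intro exI[of _ \<xi>]) auto
    qed
    then obtain \<xi> where "s / 2 < \<xi>" "g r c - g s c = (r - s) * (- \<alpha> * gamma_kernel (\<alpha> + 1) \<xi> c)" by blast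
    then have "(g r c - g s c) / (r - s) = - (\<alpha> * gamma_kernel (\<alpha> + 1) \<xi> c)"
      using that by simp
    then show ?thesis using kb[OF \<open>s / 2 < \<xi>\<close>, of c] by simp
  qed
  have gint: "integrable M (\<lambda>\<omega>. g r (x - W \<omega>))" for r
  proof (rule integrable_const_bound[where B = 1])
    show "AE \<omega> in M. norm (g r (x - W \<omega>)) \<le> 1"
    proof (rule AE_I2)
      fix \<omega>
      have "gamma_cdf t = prob {\<omega> \<in> space M. X i \<omega> \<le> t}" for t
      proof -
        have "gamma_cdf t = expectation (\<lambda>\<omega>. indicator {..t} (X i \<omega>))"
          unfolding gamma_cdf_def by (rule expectation_gamma[OF i, symmetric]) simp
        also have "\<dots> = expectation (indicator {\<omega> \<in> space M. X i \<omega> \<le> t})"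
          by (intro Bochner_Integration.integral_cong) (auto simp: indicator_def)
        also have "\<dots> = prob {\<omega> \<in> space M. X i \<omega> \<le> t}" by simp
        finally show ?thesis .
      qed
      then show "norm (g r (x - W \<omega>)) \<le> 1" by (simp add: g_def)
    qed
    show "(\<lambda>\<omega>. g r (x - W \<omega>)) \<in> borel_measurable M"
      unfolding g_def by measurable
  qed
  have FE: "F (z(i := r)) x = expectation (\<lambda>\<omega>. g r (x - W \<omega>))" if "0 < r" for r
    using F_eq_cdf[OF i that] by (simp add: g_def W_def)
  have "((\<lambda>r. (F (z(i := r)) x - F (z(i := s)) x) / (r - s)) \<longlongrightarrow> - \<alpha> * \<phi> i (z(i := s)) x) (at s within {s / 2<..})"
    unfolding tendsto_at_iff_sequentially
  proof (intro allI impI)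
    fix R assume "\<forall>m. R m \<in> {s / 2<..} - {s}" and R: "R \<longlonglongrightarrow> s"
    then have Rm: "s / 2 < R m" "R m \<noteq> s" "0 < R m" for m
      using s by (auto simp: less_trans[of 0 "s / 2"])
    have "(\<lambda>m. expectation (\<lambda>\<omega>. (g (R m) (x - W \<omega>) - g s (x - W \<omega>)) / (R m - s)))
        \<longlonglongrightarrow> expectation (\<lambda>\<omega>. - \<alpha> * gamma_kernel (\<alpha> + 1) s (x - W \<omega>))"
    proof (rule integral_dominated_convergence[where w = "\<lambda>_. w"])
      show "AE \<omega> in M. (\<lambda>m. (g (R m) (x - W \<omega>) - g s (x - W \<omega>)) / (R m - s))
          \<longlonglongrightarrow> - \<alpha> * gamma_kernel (\<alpha> + 1) s (x - W \<omega>)"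
      proof (rule AE_I2)
        fix \<omega>
        have "((\<lambda>r. (g r (x - W \<omega>) - g s (x - W \<omega>)) / (r - s)) \<longlongrightarrow> - \<alpha> * gamma_kernel (\<alpha> + 1) s (x - W \<omega>)) (at s)"
          using gd[OF s, of "x - W \<omega>"] by (simp only: has_field_derivative_iff)
        then show "(\<lambda>m. (g (R m) (x - W \<omega>) - g s (x - W \<omega>)) / (R m - s))
          \<longlonglongrightarrow> - \<alpha> * gamma_kernel (\<alpha> + 1) s (x - W \<omega>)"
          using R Rm unfolding tendsto_at_iff_sequentially comp_def by auto
      qed
      show "(\<lambda>\<omega>. (g (R m) (x - W \<omega>) - g s (x - W \<omega>)) / (R m - s)) \<in> borel_measurable M" for m
        unfolding g_def by measurable
      show "AE \<omega> in M. norm ((g (R m) (x - W \<omega>) - g s (x - W \<omega>)) / (R m - s)) \<le> w" for m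
        using gb[OF Rm(1,2)] by (auto simp: real_norm_def)
    qed auto
    moreover have "expectation (\<lambda>\<omega>. (g (R m) (x - W \<omega>) - g s (x - W \<omega>)) / (R m - s))
        = (F (z(i := R m)) x - F (z(i := s)) x) / (R m - s)" for m
      using gint by (simp add: FE[OF Rm(3)] FE[OF s])
    moreover have "expectation (\<lambda>\<omega>. - \<alpha> * gamma_kernel (\<alpha> + 1) s (x - W \<omega>)) = - \<alpha> * \<phi> i (z(i := s)) x"
      unfolding \<phi>_eq_kernel[OF i s] W_def by simp
    ultimately show "((\<lambda>r. (F (z(i := r)) x - F (z(i := s)) x) / (r - s)) \<circ> R) \<longlonglongrightarrow> - \<alpha> * \<phi> i (z(i := s)) x"
      by (simp only: comp_def)
  qed
  moreover have "at s within {s / 2<..} = at s"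
    using s by (intro at_within_open) auto
  ultimately show ?thesis
    by (simp add: has_field_derivative_iff)
qed

lemma F_strict_antimono:
  assumes z: "\<And>j. j < n \<Longrightarrow> 0 < z j" and le: "\<And>j. j < n \<Longrightarrow> z j \<le> z' j" and i: "i < n" "z i < z' i" and x: "0 < x"
  shows "F z' x < F z x"
proof -
  have "F z' x \<le> F (z(i := z' i)) x"
    using le by (intro F_antimono) auto
  also have "F (z(i := z' i)) x < F (z(i := z i)) x"
  proof (rule DERIV_neg_imp_decreasing[OF i(2)])
    fix s assume s: "z i \<le> s" "s \<le> z' i"
    then have "0 < s" using z[OF i(1)] by simp
    moreover have "0 < \<phi> i (z(i := s)) x"
      using i z x \<open>0 < s\<close> by (intro \<phi>_pos) auto
    ultimately show "\<exists>D. ((\<lambda>s. F (z(i := s)) x) has_real_derivative D) (at s) \<and> D < 0"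
      using F_deriv[OF i(1), of s z x] \<alpha> by (intro exI[of _ "- \<alpha> * \<phi> i (z(i := s)) x"]) auto
  qed
  finally show ?thesis by simp
qed

section \<open>First-order expansion in all weights\<close>

lemma F_increment:
  assumes i: "i < n" and pos: "0 < z i" "0 < r"
  shows "\<exists>\<xi>. min (z i) r \<le> \<xi> \<and> \<xi> \<le> max (z i) r \<and> F (z(i := r)) x - F z x = - \<alpha> * (r - z i) * \<phi> i (z(i := \<xi>)) x"
proof -
  define f where "f s = F (z(i := s)) x" for s
  have d: "(f has_real_derivative - \<alpha> * \<phi> i (z(i := s)) x) (at s)" if "0 < s" for s
    unfolding f_def by (rule F_deriv[OF i that])
  consider "z i = r" | "z i < r" | "r < z i" by linarith
  then have "\<exists>\<xi>. min (z i) r \<le> \<xi> \<and> \<xi> \<le> max (z i) r \<and> f r - f (z i) = (r - z i) * (- \<alpha> * \<phi> i (z(i := \<xi>)) x)"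
  proof cases
    case 1
    then show ?thesis by (intro exI[of _ r]) auto
  next
    case 2
    have "\<exists>\<xi>>z i. \<xi> < r \<and> f r - f (z i) = (r - z i) * (- \<alpha> * \<phi> i (z(i := \<xi>)) x)"
      using 2 pos by (intro MVT2 d) auto
    then show ?thesis using 2 by (auto simp: min_def max_def intro: less_imp_le)
  next
    case 3
    have "\<exists>\<xi>>r. \<xi> < z i \<and> f (z i) - f r = (z i - r) * (- \<alpha> * \<phi> i (z(i := \<xi>)) x)"
      using 3 pos by (intro MVT2 d) auto
    then obtain \<xi> where "r < \<xi>" "\<xi> < z i" "f (z i) - f r = (z i - r) * (- \<alpha> * \<phi> i (z(i := \<xi>)) x)" by blast
    then show ?thesis using 3 by (intro exI[of _ \<xi>]) (auto simp: algebra_simps)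
  qed
  then show ?thesis by (simp add: f_def algebra_simps)
qed

text \<open>Coordinates are changed one at a time. Each step is a mean value theorem in one weight,
  with an intermediate vector that tends to \<open>z\<close>, so joint continuity of
  \<open>\<phi>\<close> gives the limit.\<close>

lemma F_directional_derivative:
  assumes z: "\<And>i. i < n \<Longrightarrow> 0 < z i"
  shows "((\<lambda>t. (F (\<lambda>i. z i + t * w i) x - F z x) / t) \<longlongrightarrow> - \<alpha> * (\<Sum>i<n. w i * \<phi> i z x)) (at_right 0)"
proof -
  define c where "c = Min (insert 1 (z ` {..<n}))"
  have c: "0 < c" "\<And>i. i < n \<Longrightarrow> c \<le> z i"
    using z by (auto simp: c_def)
  define K where "K = Max (insert 1 ((\<lambda>i. \<bar>w i\<bar>) ` {..<n}))"
  have K: "0 < K" "\<And>i. i < n \<Longrightarrow> \<bar>w i\<bar> \<le> K"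
    by (auto simp: K_def Max_gr_iff)
  \<comment> \<open>Keeps every weight above \<open>c / 2\<close> along the segment, which supplies
    the lower bound in \<open>\<phi>_tendsto\<close>.\<close>
  define b where "b = c / (2 * K)"
  have b: "0 < b" using c K by (simp add: b_def)
  show ?thesis
  proof (rule tendsto_at_right_sequentially[OF b])
    fix T :: "nat \<Rightarrow> real"
    assume T: "\<And>m. 0 < T m" "\<And>m. T m < b" "T \<longlonglongrightarrow> 0"
    \<comment> \<open>Hybrid vectors: the first \<open>k\<close> coordinates are already
      moved.\<close>
    define Z where "Z m k i = z i + (if i < k then T m * w i else 0)" for m k i
    have half: "c / 2 \<le> z i + T m * w i" if "i < n" for i m
    proof -
      have "T m * \<bar>w i\<bar> \<le> b * K"
        using T(1)[of m] T(2)[of m] K(2)[OF that] by (intro mult_mono) auto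
      also have "b * K = c / 2" using K by (simp add: b_def)
      finally have "\<bar>T m * w i\<bar> \<le> c / 2" using T(1)[of m] by (simp add: abs_mult)
      then show ?thesis using c(2)[OF that] by linarith
    qed
    have Zlim: "(\<lambda>m. Z m k i) \<longlonglongrightarrow> z i" for k i
    proof (cases "i < k")
      case True
      have "(\<lambda>m. z i + T m * w i) \<longlonglongrightarrow> z i + 0 * w i" by (intro tendsto_intros T)
      then show ?thesis using True by (simp add: Z_def)
    qed (simp add: Z_def)
    have step: "(\<lambda>m. (F (Z m k) x - F z x) / T m) \<longlonglongrightarrow> - \<alpha> * (\<Sum>i<k. w i * \<phi> i z x)" if "k \<le> n" for k
      using that
    proof (induction k)
      case 0
      have "Z m 0 = z" for m by (simp add: Z_def fun_eq_iff)
      then show ?case by simp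
    next
      case (Suc k)
      then have k: "k < n" by simp
      have Zk: "Z m (Suc k) = (Z m k)(k := z k + T m * w k)" "Z m k k = z k" for m
        by (auto simp: Z_def fun_eq_iff less_Suc_eq)
      have "\<forall>m. \<exists>\<xi>. min (z k) (z k + T m * w k) \<le> \<xi> \<and> \<xi> \<le> max (z k) (z k + T m * w k)
          \<and> F (Z m (Suc k)) x - F (Z m k) x = - \<alpha> * (z k + T m * w k - z k) * \<phi> k ((Z m k)(k := \<xi>)) x"
      proof
        fix m
        have "0 < Z m k k" "0 < z k + T m * w k"
          using z[OF k] half[OF k, of m] c(1) by (auto simp: Zk)
        from F_increment[of k "Z m k" "z k + T m * w k" x, OF k this]
        show "\<exists>\<xi>. min (z k) (z k + T m * w k) \<le> \<xi> \<and> \<xi> \<le> max (z k) (z k + T m * w k)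
          \<and> F (Z m (Suc k)) x - F (Z m k) x = - \<alpha> * (z k + T m * w k - z k) * \<phi> k ((Z m k)(k := \<xi>)) x"
          by (simp only: Zk)
      qed
      then obtain \<xi> where \<xi>: "\<And>m. min (z k) (z k + T m * w k) \<le> \<xi> m" "\<And>m. \<xi> m \<le> max (z k) (z k + T m * w k)"
        and eq: "\<And>m. F (Z m (Suc k)) x - F (Z m k) x = - \<alpha> * (z k + T m * w k - z k) * \<phi> k ((Z m k)(k := \<xi> m)) x"
        by metis
      have lim: "(\<lambda>m. z k + T m * w k) \<longlonglongrightarrow> z k"
        using tendsto_add[OF tendsto_const tendsto_mult[OF T(3) tendsto_const], of "z k" "w k"] by simp
      have \<xi>lim: "\<xi> \<longlonglongrightarrow> z k"
      proof (rule tendsto_sandwich[where f = "\<lambda>m. min (z k) (z k + T m * w k)" and h = "\<lambda>m. max (z k) (z k + T m * w k)"])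
        show "(\<lambda>m. min (z k) (z k + T m * w k)) \<longlonglongrightarrow> z k"
          using tendsto_min[OF tendsto_const lim, of "z k"] by simp
        show "(\<lambda>m. max (z k) (z k + T m * w k)) \<longlonglongrightarrow> z k"
          using tendsto_max[OF tendsto_const lim, of "z k"] by simp
      qed (use \<xi> in auto)
      have "(\<lambda>m. \<phi> k ((Z m k)(k := \<xi> m)) x) \<longlonglongrightarrow> \<phi> k z x"
      proof (rule \<phi>_tendsto[OF _ k])
        show "(\<lambda>m. ((Z m k)(k := \<xi> m)) i) \<longlonglongrightarrow> z i" for i
          using \<xi>lim Zlim[of k i] by (cases "i = k") auto
        show "0 < c / 2" using c by simp
        show "c / 2 \<le> ((Z m k)(k := \<xi> m)) k" for m
          using \<xi>(1)[of m] half[OF k, of m] c(1) c(2)[OF k] by (simp add: min_def split: if_splits)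
      qed
      then have "(\<lambda>m. (F (Z m k) x - F z x) / T m + - \<alpha> * w k * \<phi> k ((Z m k)(k := \<xi> m)) x)
          \<longlonglongrightarrow> - \<alpha> * (\<Sum>i<k. w i * \<phi> i z x) + - \<alpha> * w k * \<phi> k z x"
        using Suc by (intro tendsto_intros) auto
      moreover have "(F (Z m k) x - F z x) / T m + - \<alpha> * w k * \<phi> k ((Z m k)(k := \<xi> m)) x
          = (F (Z m (Suc k)) x - F z x) / T m" for m
      proof -
        have "F (Z m (Suc k)) x = F (Z m k) x + T m * (- \<alpha> * w k * \<phi> k ((Z m k)(k := \<xi> m)) x)"
          using eq[of m] by (simp add: algebra_simps)
        then show ?thesis using T(1)[of m] by (simp add: field_simps)
      qed
      ultimately show ?case by (simp add: algebra_simps)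
    qed
    have "F (Z m n) = F (\<lambda>i. z i + T m * w i)" for m
      unfolding F_def by (rule smear_cong) (simp add: Z_def)
    then show "(\<lambda>m. (F (\<lambda>i. z i + T m * w i) x - F z x) / T m) \<longlonglongrightarrow> - \<alpha> * (\<Sum>i<n. w i * \<phi> i z x)"
      using step[OF order_refl] by simp
  qed
qed

lemma F_first_order:
  assumes z: "\<And>i. i < n \<Longrightarrow> 0 < z i" and e: "0 < e"
  shows "eventually (\<lambda>t. \<bar>F (\<lambda>i. z i + t * w i) x - F z x + t * \<alpha> * (\<Sum>i<n. w i * \<phi> i z x)\<bar> < e * t) (at_right 0)"
proof -
  have "eventually (\<lambda>t. dist ((F (\<lambda>i. z i + t * w i) x - F z x) / t) (- \<alpha> * (\<Sum>i<n. w i * \<phi> i z x)) < e) (at_right 0)"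
    by (rule tendstoD[OF F_directional_derivative[of z] e]) (rule z)
  moreover have "eventually (\<lambda>t::real. 0 < t) (at_right 0)"
    by (rule eventually_at_right_less)
  ultimately show ?thesis
  proof eventually_elim
    case (elim t)
    have "F (\<lambda>i. z i + t * w i) x - F z x + t * \<alpha> * (\<Sum>i<n. w i * \<phi> i z x)
      = t * ((F (\<lambda>i. z i + t * w i) x - F z x) / t - (- \<alpha> * (\<Sum>i<n. w i * \<phi> i z x)))"
      using elim(2) by (simp add: field_simps)
    then show ?case
      using elim by (simp add: dist_real_def abs_mult mult.commute[of e])
  qed
qed

section \<open>Sign patterns of combinations of the weight derivatives\<close>

lemma pm_sign_smear_all:
  assumes I: "I \<subseteq> {..<n}" and z: "\<And>j. j < n \<Longrightarrow> 0 < z j"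
    and d: "d \<in> borel_measurable borel" "\<And>y. \<bar>d y\<bar> \<le> B" "\<And>y. y \<le> 0 \<Longrightarrow> d y = 0"
    and pm: "pm_sign (smear z I d)"
  shows "pm_sign (smear z {..<n} d)"
proof -
  have "pm_sign (smear z (({..<n} - I) \<union> I) d)"
    using I z d by (intro pm_sign_smear_Un[where B = B] pm) auto
  moreover have "({..<n} - I) \<union> I = {..<n}" using I by blast
  ultimately show ?thesis by simp
qed

text \<open>Here the sign pattern is present in the exponential kernels before any smearing.\<close>

lemma pm_sign_\<phi>_pair:
  assumes z: "\<And>j. j < n \<Longrightarrow> 0 < z j" and ij: "i < n" "j < n" "z i \<le> z j" and A: "0 \<le> A"
  shows "pm_sign (\<lambda>x. A * \<phi> i z x - B * \<phi> j z x)"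
proof -
  have "pm_sign (smear z {..<n} (\<lambda>u. A * exp_kernel (z i) u - B * exp_kernel (z j) u))"
    using ij z A exp_kernel_diff_bounded[of "z i" "z j" A _ B]
    by (intro pm_sign_smear_all[of "{}" _ _ "\<bar>A\<bar> * (1 / z i) + \<bar>B\<bar> * (1 / z j)"])
       (auto simp: smear_empty exp_kernel_eq_0 intro!: pm_sign_exp_kernels)
  moreover have "smear z {..<n} (\<lambda>u. A * exp_kernel (z i) u - B * exp_kernel (z j) u)
      = (\<lambda>x. A * \<phi> i z x - B * \<phi> j z x)"
    using ij z by (simp add: smear_exp_kernel_diff[OF order_refl] \<phi>_def fun_eq_iff)
  ultimately show ?thesis by simp
qed

lemma pm_sign_\<phi>_four:
  assumes z: "\<And>j. j < n \<Longrightarrow> 0 < z j" and ij: "i < n" "j < n" "k < n" "l < n"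
    and le: "z i \<le> z j" "z j \<le> z k" "z k < z l" and AC: "0 \<le> A" "0 \<le> C"
  shows "pm_sign (\<lambda>x. A * (\<phi> i z x - \<phi> j z x) + C * (\<phi> k z x - \<phi> l z x))"
proof -
  interpret gamma_pair M X \<alpha> n z k l
    using ij le z by unfold_locales auto
  define d1 where "d1 u = A * exp_kernel (z i) u - A * exp_kernel (z j) u" for u
  define d2 where "d2 u = C * exp_kernel (z k) u - C * exp_kernel (z l) u" for u
  define b1 where "b1 = \<bar>A\<bar> * (1 / z i) + \<bar>A\<bar> * (1 / z j)"
  define b2 where "b2 = \<bar>C\<bar> * (1 / z k) + \<bar>C\<bar> * (1 / z l)"
  have b: "\<bar>d1 u\<bar> \<le> b1" "\<bar>d2 u\<bar> \<le> b2" for u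
    unfolding d1_def d2_def b1_def b2_def using ij z by (intro exp_kernel_diff_bounded; simp)+
  have [measurable]: "d1 \<in> borel_measurable borel" "d2 \<in> borel_measurable borel"
    unfolding d1_def d2_def by measurable
  have sm: "smear z I (\<lambda>u. 1 * d1 u + 1 * d2 u) x
      = A * (smear z I (exp_kernel (z i)) x - smear z I (exp_kernel (z j)) x)
        + C * (smear z I (exp_kernel (z k)) x - smear z I (exp_kernel (z l)) x)" if "I \<subseteq> {..<n}" for I x
  proof -
    have "smear z I (\<lambda>u. 1 * d1 u + 1 * d2 u) x = 1 * smear z I d1 x + 1 * smear z I d2 x"
      by (rule smear_add[OF that _ _ b]) measurable
    then show ?thesis
      unfolding d1_def d2_def using ij z that by (simp add: smear_exp_kernel_diff right_diff_distrib)
  qed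
  have "pm_sign (smear z {..<n} (\<lambda>u. 1 * d1 u + 1 * d2 u))"
  proof (rule pm_sign_smear_all[of "{k, l}" _ _ "b1 + b2"])
    have "smear z {k, l} (\<lambda>u. 1 * d1 u + 1 * d2 u) = (\<lambda>x. A * (qe (z i) x - qe (z j) x) + C * (qe (z k) x - qe (z l) x))"
      using sm[of "{k, l}"] ij by (simp add: fun_eq_iff qe_def)
    then show "pm_sign (smear z {k, l} (\<lambda>u. 1 * d1 u + 1 * d2 u))"
      using pm_sign_qe_four[of A C "z i" "z j"] AC ij le z by simp
    show "\<bar>1 * d1 y + 1 * d2 y\<bar> \<le> b1 + b2" for y
      using b(1)[of y] b(2)[of y] by linarith
  qed (use ij z in \<open>auto simp: d1_def d2_def exp_kernel_eq_0\<close>)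
  moreover have "smear z {..<n} (\<lambda>u. 1 * d1 u + 1 * d2 u)
      = (\<lambda>x. A * (\<phi> i z x - \<phi> j z x) + C * (\<phi> k z x - \<phi> l z x))"
    using sm[OF order_refl] by (simp add: fun_eq_iff \<phi>_def)
  ultimately show ?thesis by simp
qed

text \<open>The vector \<open>u\<close> is tangent to the level set at \<open>x0\<close>, points
  towards \<open>t\<close> in every coordinate, and does not increase \<open>F\<close> at
  \<open>y\<close> to first order. A small step along \<open>u\<close> leaves the level set
  slightly; moving \<open>r\<close> up or \<open>s\<close> down, both also towards \<open>t\<close>,
  restores it at a cost below the gain in the penalty.\<close>

lemma descent:
  fixes z t u :: "nat \<Rightarrow> real"
  assumes z: "\<And>i. i < n \<Longrightarrow> 0 < z i" and x: "0 < x0" "0 < y" and \<epsilon>: "0 < \<epsilon>"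
    and level: "(\<Sum>i<n. u i * \<phi> i z x0) = 0" and y: "0 \<le> (\<Sum>i<n. u i * \<phi> i z y)"
    and up: "\<And>i. i < n \<Longrightarrow> 0 < u i \<Longrightarrow> z i < t i" and dn: "\<And>i. i < n \<Longrightarrow> u i < 0 \<Longrightarrow> t i < z i"
    and rs: "r < n" "z r < t r" "s < n" "t s < z s" and u: "i0 < n" "u i0 \<noteq> 0"
    and t: "\<And>i. i < n \<Longrightarrow> 0 < t i"
  obtains \<tau> b c z' where "0 < \<tau>" "0 \<le> b" "0 \<le> c"
    and "z' = (\<lambda>i. z i + \<tau> * u i + (if i = r then b else 0) - (if i = s then c else 0))"
    and "F z' x0 = F z x0"
    and "\<And>i. i < n \<Longrightarrow> z i < t i \<Longrightarrow> z i \<le> z' i \<and> z' i < t i"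
    and "\<And>i. i < n \<Longrightarrow> t i < z i \<Longrightarrow> t i < z' i \<and> z' i \<le> z i"
    and "\<And>i. i < n \<Longrightarrow> z i = t i \<Longrightarrow> z' i = t i"
    and "F z' y + \<epsilon> * (\<Sum>i<n. \<bar>t i - z' i\<bar>) < F z y + \<epsilon> * (\<Sum>i<n. \<bar>t i - z i\<bar>)"
proof -
  have "r \<noteq> s" using rs by auto
  define U where "U = (\<Sum>i<n. \<bar>u i\<bar>)"
  have U: "0 < U"
    unfolding U_def using u by (intro sum_pos2[of _ i0]) auto
  have \<phi>y: "0 < \<phi> s z y" and \<phi>r: "0 < \<phi> r z x0" and \<phi>s: "0 < \<phi> s z x0"
    using rs x z by (auto intro!: \<phi>_pos)
  \<comment> \<open>Lowering coordinate \<open>s\<close> by \<open>\<tau> * \<sigma>\<close> costs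
    \<open>\<tau> * \<epsilon> * U / 4\<close> at \<open>y\<close> to first order. With a remainder
    of at most the same size, the loss stays below half of the penalty gain
    \<open>\<epsilon> * \<tau> * U\<close>.\<close>
  define \<sigma> where "\<sigma> = \<epsilon> * U / (4 * \<alpha> * \<phi> s z y)"
  have \<sigma>: "0 < \<sigma>" using \<epsilon> U \<alpha> \<phi>y by (simp add: \<sigma>_def)
  \<comment> \<open>The two extreme corrections: along \<open>w1\<close> the value at
    \<open>x0\<close> drops, along \<open>w2\<close> it rises.\<close>
  define w1 where "w1 i = u i + (if i = r then \<sigma> else 0)" for i
  define w2 where "w2 i = u i - (if i = s then \<sigma> else 0)" for i
  have w1: "(\<Sum>i<n. w1 i * \<phi> i z v) = (\<Sum>i<n. u i * \<phi> i z v) + \<sigma> * \<phi> r z v" for v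
    using rs by (simp add: w1_def distrib_right sum.distrib if_distrib[of "\<lambda>c. c * _"] cong: if_cong)
  have w2: "(\<Sum>i<n. w2 i * \<phi> i z v) = (\<Sum>i<n. u i * \<phi> i z v) - \<sigma> * \<phi> s z v" for v
    using rs by (simp add: w2_def left_diff_distrib sum_subtractf if_distrib[of "\<lambda>c. c * _"] cong: if_cong)
  define gap where "gap = Min ((\<lambda>i. \<bar>t i - z i\<bar>) ` {i\<in>{..<n}. z i \<noteq> t i})"
  have gap: "0 < gap"
    unfolding gap_def using rs by (subst Min_gr_iff) auto
  have gap_le: "gap \<le> \<bar>t i - z i\<bar>" if "i < n" "z i \<noteq> t i" for i
    unfolding gap_def using that by (intro Min_le) auto
  have "eventually (\<lambda>\<tau>. \<bar>F (\<lambda>i. z i + \<tau> * w1 i) x0 - F z x0 + \<tau> * \<alpha> * (\<Sum>i<n. w1 i * \<phi> i z x0)\<bar> < (\<alpha> * \<sigma> * \<phi> r z x0) * \<tau>) (at_right 0)"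
    using \<alpha> \<sigma> \<phi>r by (intro F_first_order z) auto
  moreover have "eventually (\<lambda>\<tau>. \<bar>F (\<lambda>i. z i + \<tau> * w2 i) x0 - F z x0 + \<tau> * \<alpha> * (\<Sum>i<n. w2 i * \<phi> i z x0)\<bar> < (\<alpha> * \<sigma> * \<phi> s z x0) * \<tau>) (at_right 0)"
    using \<alpha> \<sigma> \<phi>s by (intro F_first_order z) auto
  moreover have "eventually (\<lambda>\<tau>. \<bar>F (\<lambda>i. z i + \<tau> * w2 i) y - F z y + \<tau> * \<alpha> * (\<Sum>i<n. w2 i * \<phi> i z y)\<bar> < (\<epsilon> * U / 4) * \<tau>) (at_right 0)"
    using \<epsilon> U by (intro F_first_order z) auto
  \<comment> \<open>Ensures that no coordinate reaches or passes its target, so strict inequalities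
    between \<open>z\<close> and \<open>t\<close> persist.\<close>
  moreover have "eventually (\<lambda>\<tau>. \<tau> < gap / (U + \<sigma>)) (at_right 0)"
    using gap U \<sigma> by (intro order_tendstoD(2)[OF tendsto_ident_at]) auto
  moreover have "eventually (\<lambda>\<tau>::real. 0 < \<tau>) (at_right 0)"
    by (rule eventually_at_right_less)
  ultimately have "eventually (\<lambda>\<tau>. 0 < \<tau> \<and> \<tau> < gap / (U + \<sigma>)
      \<and> \<bar>F (\<lambda>i. z i + \<tau> * w1 i) x0 - F z x0 + \<tau> * \<alpha> * (\<Sum>i<n. w1 i * \<phi> i z x0)\<bar> < (\<alpha> * \<sigma> * \<phi> r z x0) * \<tau>
      \<and> \<bar>F (\<lambda>i. z i + \<tau> * w2 i) x0 - F z x0 + \<tau> * \<alpha> * (\<Sum>i<n. w2 i * \<phi> i z x0)\<bar> < (\<alpha> * \<sigma> * \<phi> s z x0) * \<tau>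
      \<and> \<bar>F (\<lambda>i. z i + \<tau> * w2 i) y - F z y + \<tau> * \<alpha> * (\<Sum>i<n. w2 i * \<phi> i z y)\<bar> < (\<epsilon> * U / 4) * \<tau>) (at_right 0)"
    by eventually_elim blast
  then obtain \<tau> where \<tau>: "0 < \<tau>" "\<tau> < gap / (U + \<sigma>)"
    and d1: "\<bar>F (\<lambda>i. z i + \<tau> * w1 i) x0 - F z x0 + \<tau> * \<alpha> * (\<Sum>i<n. w1 i * \<phi> i z x0)\<bar> < (\<alpha> * \<sigma> * \<phi> r z x0) * \<tau>"
    and d2: "\<bar>F (\<lambda>i. z i + \<tau> * w2 i) x0 - F z x0 + \<tau> * \<alpha> * (\<Sum>i<n. w2 i * \<phi> i z x0)\<bar> < (\<alpha> * \<sigma> * \<phi> s z x0) * \<tau>"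
    and d3: "\<bar>F (\<lambda>i. z i + \<tau> * w2 i) y - F z y + \<tau> * \<alpha> * (\<Sum>i<n. w2 i * \<phi> i z y)\<bar> < (\<epsilon> * U / 4) * \<tau>"
    by (auto dest!: eventually_happens'[OF trivial_limit_at_right_real] simp del: abs_less_iff)
  have \<tau>gap: "\<tau> * U + \<tau> * \<sigma> < gap"
    using \<tau> U \<sigma> by (simp add: field_simps)
  \<comment> \<open>One parameter joins the extremes: positive \<open>h\<close> raises
    \<open>r\<close>, negative \<open>h\<close> lowers \<open>s\<close>. The intermediate value
    theorem picks the \<open>h\<close> that hits the level exactly.\<close>
  define \<zeta> where "\<zeta> h i = z i + \<tau> * u i + (if i = r then max h 0 else 0) - (if i = s then max (- h) 0 else 0)" for h i
  have uU: "\<bar>u i\<bar> \<le> U" if "i < n" for i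
    unfolding U_def using that by (intro member_le_sum) auto
  have near: "\<bar>\<zeta> h i - z i\<bar> < gap" if "i < n" "\<bar>h\<bar> \<le> \<tau> * \<sigma>" for h i
  proof -
    have "\<bar>\<tau> * u i\<bar> \<le> \<tau> * U" using uU[OF that(1)] \<tau> by (simp add: abs_mult)
    then show ?thesis using that(2) \<tau>gap \<open>r \<noteq> s\<close> by (auto simp: \<zeta>_def max_def)
  qed
  have dirs: "(z i < t i \<longrightarrow> z i \<le> \<zeta> h i \<and> \<zeta> h i < t i) \<and> (t i < z i \<longrightarrow> t i < \<zeta> h i \<and> \<zeta> h i \<le> z i) \<and> (z i = t i \<longrightarrow> \<zeta> h i = t i)"
    if "i < n" "\<bar>h\<bar> \<le> \<tau> * \<sigma>" for h i
  proof -
    have n1: "z i \<noteq> t i \<longrightarrow> \<bar>\<zeta> h i - z i\<bar> < \<bar>t i - z i\<bar>"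
      using near[OF that] gap_le[OF that(1)] by auto
    have "0 \<le> u i" if "z i < t i" using dn[OF \<open>i < n\<close>] that by force
    moreover have "u i \<le> 0" if "t i < z i" using up[OF \<open>i < n\<close>] that by force
    moreover have "u i = 0" if "z i = t i" using dn[OF \<open>i < n\<close>] up[OF \<open>i < n\<close>] that by force
    ultimately have "(z i < t i \<longrightarrow> z i \<le> \<zeta> h i) \<and> (t i < z i \<longrightarrow> \<zeta> h i \<le> z i) \<and> (z i = t i \<longrightarrow> \<zeta> h i = t i)"
      using rs mult_nonneg_nonneg[of \<tau> "u i"] mult_nonneg_nonpos[of \<tau> "u i"] \<tau>(1)
      by (auto simp: \<zeta>_def max_def)
    then show ?thesis using n1 by auto
  qed
  have pos: "0 < \<zeta> h i" if "i < n" "\<bar>h\<bar> \<le> \<tau> * \<sigma>" for h i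
    using dirs[OF that] z[OF that(1)] t[OF that(1)] by (cases "z i" "t i" rule: linorder_cases) auto
  have "F (\<zeta> (\<tau> * \<sigma>)) = F (\<lambda>i. z i + \<tau> * w1 i)" "F (\<zeta> (- (\<tau> * \<sigma>))) = F (\<lambda>i. z i + \<tau> * w2 i)"
    unfolding F_def using \<tau> \<sigma> by (auto intro!: smear_cong simp: \<zeta>_def w1_def w2_def algebra_simps)
  then have hi: "F (\<zeta> (\<tau> * \<sigma>)) x0 \<le> F z x0" and lo: "F z x0 \<le> F (\<zeta> (- (\<tau> * \<sigma>))) x0"
    using d1 d2 level unfolding w1 w2 by (auto simp: abs_less_iff algebra_simps)
  have "continuous_on {- (\<tau> * \<sigma>)..\<tau> * \<sigma>} (\<lambda>h. F (\<zeta> h) x0)"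
    unfolding continuous_on_sequentially
  proof (intro allI ballI impI, elim conjE)
    fix H :: "nat \<Rightarrow> real" and h assume h: "h \<in> {- (\<tau> * \<sigma>)..\<tau> * \<sigma>}" "H \<longlonglongrightarrow> h"
    have "(\<lambda>m. \<zeta> (H m) i) \<longlonglongrightarrow> \<zeta> h i" for i
      unfolding \<zeta>_def using h(2) by (intro tendsto_intros tendsto_max) (auto intro!: tendsto_intros tendsto_max)
    moreover have "0 < \<zeta> h r"
      using h(1) rs by (intro pos) auto
    ultimately show "((\<lambda>h. F (\<zeta> h) x0) \<circ> H) \<longlonglongrightarrow> F (\<zeta> h) x0"
      unfolding comp_def using rs by (intro F_tendsto) auto
  qed
  then have "\<exists>h. - (\<tau> * \<sigma>) \<le> h \<and> h \<le> \<tau> * \<sigma> \<and> F (\<zeta> h) x0 = F z x0"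
    using hi lo \<tau> \<sigma> by (intro IVT2') auto
  then obtain h where h: "\<bar>h\<bar> \<le> \<tau> * \<sigma>" and Fh: "F (\<zeta> h) x0 = F z x0"
    by (metis abs_le_iff minus_le_iff)
  \<comment> \<open>Every \<open>\<zeta> h\<close> dominates the extreme vector along
    \<open>w2\<close> coordinatewise, so that extreme bounds the cost at \<open>y\<close> for
    whichever \<open>h\<close> was found.\<close>
  have "F (\<zeta> h) y \<le> F (\<lambda>i. z i + \<tau> * w2 i) y"
    using h \<tau> \<sigma> by (intro F_antimono) (auto simp: \<zeta>_def w2_def max_def algebra_simps abs_le_iff)
  also have "\<dots> < F z y + (\<epsilon> * U / 2) * \<tau>"
  proof -
    have "\<tau> * \<alpha> * (\<Sum>i<n. w2 i * \<phi> i z y) \<ge> - (\<tau> * \<alpha> * (\<sigma> * \<phi> s z y))"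
      using \<tau> \<alpha> y unfolding w2 by (simp add: right_diff_distrib)
    moreover have "\<tau> * \<alpha> * (\<sigma> * \<phi> s z y) = (\<epsilon> * U / 4) * \<tau>"
      using \<alpha> \<phi>y by (simp add: \<sigma>_def)
    moreover have "F (\<lambda>i. z i + \<tau> * w2 i) y - F z y + \<tau> * \<alpha> * (\<Sum>i<n. w2 i * \<phi> i z y) < (\<epsilon> * U / 4) * \<tau>"
      by (rule le_less_trans[OF abs_ge_self d3])
    moreover have "(\<epsilon> * U / 2) * \<tau> = (\<epsilon> * U / 4) * \<tau> + (\<epsilon> * U / 4) * \<tau>"
      by simp
    ultimately show ?thesis by linarith
  qed
  finally have Fy: "F (\<zeta> h) y < F z y + (\<epsilon> * U / 2) * \<tau>" .
  have "(\<Sum>i<n. \<bar>t i - \<zeta> h i\<bar>) \<le> (\<Sum>i<n. \<bar>t i - z i\<bar> - \<tau> * \<bar>u i\<bar>)"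
  proof (rule sum_mono)
    fix i assume "i \<in> {..<n}"
    then have i: "i < n" by simp
    have "0 \<le> u i" if "z i < t i" using dn[OF i] that by force
    moreover have "u i \<le> 0" if "t i < z i" using up[OF i] that by force
    moreover have "u i = 0" if "z i = t i" using dn[OF i] up[OF i] that by force
    ultimately show "\<bar>t i - \<zeta> h i\<bar> \<le> \<bar>t i - z i\<bar> - \<tau> * \<bar>u i\<bar>"
      using dirs[OF i h] rs by (cases "z i" "t i" rule: linorder_cases) (auto simp: \<zeta>_def)
  qed
  also have "\<dots> = (\<Sum>i<n. \<bar>t i - z i\<bar>) - \<tau> * U"
    by (simp add: sum_subtractf U_def sum_distrib_left)
  finally have "\<epsilon> * (\<Sum>i<n. \<bar>t i - \<zeta> h i\<bar>) \<le> \<epsilon> * ((\<Sum>i<n. \<bar>t i - z i\<bar>) - \<tau> * U)"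
    using \<epsilon> by (intro mult_left_mono) auto
  moreover have "0 < (\<epsilon> * U / 2) * \<tau>" using \<epsilon> U \<tau> by simp
  ultimately have J: "F (\<zeta> h) y + \<epsilon> * (\<Sum>i<n. \<bar>t i - \<zeta> h i\<bar>) < F z y + \<epsilon> * (\<Sum>i<n. \<bar>t i - z i\<bar>)"
    using Fy by (simp add: algebra_simps)
  show thesis
  proof (rule that[of \<tau> "max h 0" "max (- h) 0" "\<zeta> h"])
    show "\<zeta> h = (\<lambda>i. z i + \<tau> * u i + (if i = r then max h 0 else 0) - (if i = s then max (- h) 0 else 0))"
      by (simp add: \<zeta>_def fun_eq_iff)
  qed (use \<tau> Fh J dirs[OF _ h] in auto)
qed

end

section \<open>Level sets\<close>

text \<open>Weight vectors are total functions on the naturals, so compactness is Tychonoff's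
  theorem.\<close>

lemma compact_box_fun:
  fixes a b :: "nat \<Rightarrow> real"
  shows "compact {z. \<forall>i. a i \<le> z i \<and> z i \<le> b i}"
proof -
  have "compactin (product_topology (\<lambda>i. euclidean) UNIV) (PiE UNIV (\<lambda>i. {a i..b i}))"
    by (simp add: compactin_PiE)
  moreover have "PiE UNIV (\<lambda>i. {a i..b i}) = {z. \<forall>i. a i \<le> z i \<and> z i \<le> b i}"
    by (auto simp: PiE_def Pi_def)
  ultimately show ?thesis
    by (simp add: euclidean_product_topology)
qed

lemma tendsto_fun_apply:
  fixes Z :: "nat \<Rightarrow> nat \<Rightarrow> real"
  assumes "Z \<longlonglongrightarrow> z"
  shows "(\<lambda>m. Z m i) \<longlonglongrightarrow> z i"
proof -
  have "isCont (\<lambda>z :: nat \<Rightarrow> real. z i) z"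
    by (metis continuous_on_eq_continuous_at open_UNIV UNIV_I continuous_on_product_coordinates)
  then show ?thesis using assms by (rule isCont_tendsto_compose)
qed

lemma continuous_on_coord [continuous_intros]: "continuous_on S (\<lambda>z :: nat \<Rightarrow> real. z i)"
  by (rule continuous_on_subset[OF continuous_on_product_coordinates]) simp

context iid_gamma
begin

text \<open>
  The partial sums of \<open>t - z\<close> are controlled only up to some \<open>k\<close> with \<open>z k > t k\<close>, respectively
  from some \<open>j\<close> with \<open>z j < t j\<close> on; unlike majorization, this survives moves that change the total sum.
\<close>

definition heads_ok :: "(nat \<Rightarrow> real) \<Rightarrow> (nat \<Rightarrow> real) \<Rightarrow> bool" where
  "heads_ok t z \<longleftrightarrow> (\<forall>m. (\<exists>k. m \<le> k \<and> k < n \<and> t k < z k) \<longrightarrow> (\<Sum>i\<in>{..<m}. t i - z i) \<le> 0)"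

definition tails_ok :: "(nat \<Rightarrow> real) \<Rightarrow> (nat \<Rightarrow> real) \<Rightarrow> bool" where
  "tails_ok t z \<longleftrightarrow> (\<forall>m. (\<exists>j. j < m \<and> j < n \<and> z j < t j) \<longrightarrow> 0 \<le> (\<Sum>i\<in>{m..<n}. t i - z i))"

text \<open>The premise is an open condition on \<open>z\<close> and the conclusion a closed one;
  the strict inequality \<open>t k < z k\<close> matters here.\<close>

lemma closed_heads_ok: "closed {z. heads_ok t z}"
  unfolding heads_ok_def
  by (intro closed_Collect_all closed_Collect_imp open_Collect_ex open_Collect_conj open_Collect_less
      closed_Collect_le open_Collect_const continuous_intros)

lemma closed_tails_ok: "closed {z. tails_ok t z}"
  unfolding tails_ok_def
  by (intro closed_Collect_all closed_Collect_imp open_Collect_ex open_Collect_conj open_Collect_less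
      closed_Collect_le open_Collect_const continuous_intros)

lemma level_crossing:
  assumes \<eta>: "\<And>i. i < n \<Longrightarrow> 0 < \<eta> i" and \<theta>: "\<And>i. i < n \<Longrightarrow> 0 < \<theta> i"
    and \<eta>_mono: "\<And>i j. i \<le> j \<Longrightarrow> j < n \<Longrightarrow> \<eta> i \<le> \<eta> j" and \<theta>_mono: "\<And>i j. i \<le> j \<Longrightarrow> j < n \<Longrightarrow> \<theta> i \<le> \<theta> j"
    and heads: "\<And>m. m \<le> n \<Longrightarrow> (\<Sum>i<m. \<theta> i) \<le> (\<Sum>i<m. \<eta> i)" and total: "(\<Sum>i<n. \<theta> i) = (\<Sum>i<n. \<eta> i)"
    and x: "0 < x0" "x0 < y" and eq: "F \<eta> x0 = F \<theta> x0"
  shows "F \<theta> y \<le> F \<eta> y"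
proof (cases "n = 0")
  case True
  have "F \<eta> = F \<theta>" unfolding F_def by (rule smear_cong) (use True in simp)
  then show ?thesis by simp
next
  case False
  then have n: "0 < n" by simp
  \<comment> \<open>The common value 1 from \<open>n\<close> on shrinks the box to a point in the
    irrelevant coordinates, which makes it compact.\<close>
  define e where "e i = (if i < n then \<eta> i else 1)" for i
  define t where "t i = (if i < n then \<theta> i else 1)" for i
  have Fe: "F e = F \<eta>" and Ft: "F t = F \<theta>"
    unfolding F_def by (auto intro!: smear_cong simp: e_def t_def)
  have et: "0 < e i" "0 < t i" for i using \<eta> \<theta> by (auto simp: e_def t_def)
  define K where "K = {z. \<forall>i. min (e i) (t i) \<le> z i \<and> z i \<le> max (e i) (t i)} \<inter> (\<lambda>z. F z x0) -` {F \<theta> x0}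
      \<inter> {z. heads_ok t z} \<inter> {z. tails_ok t z}"
  have boxpos: "0 < z i" if "\<forall>i. min (e i) (t i) \<le> z i \<and> z i \<le> max (e i) (t i)" for z i
    using that et[of i] by (meson less_le_trans min_less_iff_conj)
  have Fcont: "continuous_on {z. \<forall>i. min (e i) (t i) \<le> z i \<and> z i \<le> max (e i) (t i)} (\<lambda>z. F z v)" for v
    unfolding continuous_on_sequentially
  proof (intro allI ballI impI, elim conjE)
    fix Z z assume z: "z \<in> {z. \<forall>i. min (e i) (t i) \<le> z i \<and> z i \<le> max (e i) (t i)}" "Z \<longlonglongrightarrow> z"
    then show "((\<lambda>z. F z v) \<circ> Z) \<longlonglongrightarrow> F z v"
      unfolding comp_def using n boxpos[of z 0] by (intro F_tendsto[of _ _ 0] tendsto_fun_apply) auto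
  qed
  have cl: "closed ({z. \<forall>i. min (e i) (t i) \<le> z i \<and> z i \<le> max (e i) (t i)} \<inter> (\<lambda>z. F z x0) -` {F \<theta> x0})"
    by (intro continuous_closed_preimage Fcont compact_imp_closed compact_box_fun closed_singleton)
  have "compact ({z. \<forall>i. min (e i) (t i) \<le> z i \<and> z i \<le> max (e i) (t i)}
     \<inter> ({z. \<forall>i. min (e i) (t i) \<le> z i \<and> z i \<le> max (e i) (t i)} \<inter> (\<lambda>z. F z x0) -` {F \<theta> x0}
      \<inter> {z. heads_ok t z} \<inter> {z. tails_ok t z}))"
    by (rule compact_Int_closed[OF compact_box_fun closed_Int[OF closed_Int[OF cl closed_heads_ok] closed_tails_ok]])
  moreover have "{z. \<forall>i. min (e i) (t i) \<le> z i \<and> z i \<le> max (e i) (t i)}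
     \<inter> ({z. \<forall>i. min (e i) (t i) \<le> z i \<and> z i \<le> max (e i) (t i)} \<inter> (\<lambda>z. F z x0) -` {F \<theta> x0}
      \<inter> {z. heads_ok t z} \<inter> {z. tails_ok t z}) = K"
    unfolding K_def by blast
  ultimately have compactK: "compact K" by simp
  have eK: "e \<in> K"
  proof -
    have "heads_ok t e"
      unfolding heads_ok_def
    proof (intro allI impI, elim exE conjE)
      fix m k assume "m \<le> k" "k < n"
      then have "(\<Sum>i<m. t i - e i) = (\<Sum>i<m. \<theta> i) - (\<Sum>i<m. \<eta> i)"
        unfolding sum_subtractf[symmetric] by (intro sum.cong) (auto simp: t_def e_def)
      then show "(\<Sum>i<m. t i - e i) \<le> 0"
        using heads[of m] \<open>m \<le> k\<close> \<open>k < n\<close> by simp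
    qed
    moreover have "tails_ok t e"
      unfolding tails_ok_def
    proof (intro allI impI)
      fix m
      show "0 \<le> (\<Sum>i\<in>{m..<n}. t i - e i)"
      proof (cases "m \<le> n")
        case True
        have "(\<Sum>i\<in>{m..<n}. t i - e i) = (\<Sum>i\<in>{m..<n}. \<theta> i) - (\<Sum>i\<in>{m..<n}. \<eta> i)"
          unfolding sum_subtractf[symmetric] by (intro sum.cong) (auto simp: t_def e_def)
        moreover have "(\<Sum>i<n. f i) = (\<Sum>i<m. f i) + (\<Sum>i\<in>{m..<n}. f i)" for f :: "nat \<Rightarrow> real"
          using True sum.atLeastLessThan_concat[of 0 m n f] by (simp add: lessThan_atLeast0)
        ultimately show ?thesis using heads[OF True] total by simp
      qed simp
    qed
    ultimately show ?thesis
      unfolding K_def using eq Fe by auto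
  qed
  show ?thesis
  proof (rule field_le_epsilon)
    fix \<epsilon>' :: real assume "0 < \<epsilon>'"
    define V where "V = (\<Sum>i<n. \<bar>t i - e i\<bar>)"
    \<comment> \<open>Makes the penalty at the starting vector \<open>e\<close> at most
      \<open>\<epsilon>'\<close>.\<close>
    define \<epsilon> where "\<epsilon> = \<epsilon>' / (V + 1)"
    have V: "0 \<le> V" by (simp add: V_def sum_nonneg)
    have \<epsilon>: "0 < \<epsilon>" "\<epsilon> * V \<le> \<epsilon>'" using \<open>0 < \<epsilon>'\<close> V by (auto simp: \<epsilon>_def field_simps)
    define J where "J z = F z y + \<epsilon> * (\<Sum>i<n. \<bar>t i - z i\<bar>)" for z
    have "continuous_on K J"
      unfolding J_def by (intro continuous_intros continuous_on_subset[OF Fcont]) (auto simp: K_def)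
    then obtain z where zK: "z \<in> K" and zmin: "\<And>z'. z' \<in> K \<Longrightarrow> J z \<le> J z'"
      using continuous_attains_inf[OF compactK] eK by blast
    have box: "\<forall>i. min (e i) (t i) \<le> z i \<and> z i \<le> max (e i) (t i)"
      and Fz: "F z x0 = F t x0" and zH: "heads_ok t z" and zT: "tails_ok t z"
      using zK Ft by (auto simp: K_def)
    have zpos: "0 < z i" for i using boxpos[OF box] .
    have upE: "e i \<le> z i" if "z i < t i" for i using box that by (metis linorder_not_le max.absorb2 max.cobounded2 min.absorb1 min.bounded_iff nle_le)
    have dnE: "z i \<le> e i" if "t i < z i" for i using box that by (metis linorder_not_le max.absorb1 max_def)
    \<comment> \<open>A direction accepted by \<open>descent\<close> contradicts minimality as soon
      as the moved vector still satisfies the head and tail conditions; box and level are preserved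
      by \<open>descent\<close> itself.\<close>
    have move: False
      if lv: "(\<Sum>i<n. u i * \<phi> i z x0) = 0" and uy: "0 \<le> (\<Sum>i<n. u i * \<phi> i z y)"
        and up: "\<And>i. i < n \<Longrightarrow> 0 < u i \<Longrightarrow> z i < t i" and dn: "\<And>i. i < n \<Longrightarrow> u i < 0 \<Longrightarrow> t i < z i"
        and rs: "r < n" "z r < t r" "s < n" "t s < z s" and u0: "i0 < n" "u i0 \<noteq> 0" and uo: "\<And>i. n \<le> i \<Longrightarrow> u i = 0"
        and inv: "\<And>\<tau> b c z'. 0 < \<tau> \<Longrightarrow> 0 \<le> b \<Longrightarrow> 0 \<le> c \<Longrightarrow>
            z' = (\<lambda>i. z i + \<tau> * u i + (if i = r then b else 0) - (if i = s then c else 0)) \<Longrightarrow>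
            (\<And>i. i < n \<Longrightarrow> (z' i < t i \<longleftrightarrow> z i < t i) \<and> (t i < z' i \<longleftrightarrow> t i < z i)) \<Longrightarrow> heads_ok t z' \<and> tails_ok t z'"
      for u r s i0
    proof -
      obtain \<tau> b c z' where z': "0 < \<tau>" "0 \<le> b" "0 \<le> c"
        "z' = (\<lambda>i. z i + \<tau> * u i + (if i = r then b else 0) - (if i = s then c else 0))"
        and F': "F z' x0 = F z x0"
        and u1: "\<And>i. i < n \<Longrightarrow> z i < t i \<Longrightarrow> z i \<le> z' i \<and> z' i < t i"
        and u2: "\<And>i. i < n \<Longrightarrow> t i < z i \<Longrightarrow> t i < z' i \<and> z' i \<le> z i"
        and u3: "\<And>i. i < n \<Longrightarrow> z i = t i \<Longrightarrow> z' i = t i"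
        and J': "F z' y + \<epsilon> * (\<Sum>i<n. \<bar>t i - z' i\<bar>) < F z y + \<epsilon> * (\<Sum>i<n. \<bar>t i - z i\<bar>)"
      proof -
        show thesis
          by (rule descent[of z x0 y \<epsilon> u t r s i0, OF zpos x(1) less_trans[OF x] \<epsilon>(1) lv uy up dn rs u0 et(2)])
             (assumption | (rule that; assumption))+
      qed
      have sg: "(z' i < t i \<longleftrightarrow> z i < t i) \<and> (t i < z' i \<longleftrightarrow> t i < z i)" if "i < n" for i
        using u1[OF that] u2[OF that] u3[OF that] by (cases "z i" "t i" rule: linorder_cases) auto
      have "min (e i) (t i) \<le> z' i \<and> z' i \<le> max (e i) (t i)" for i
      proof (cases "i < n")
        case True
        then show ?thesis
          using u1[OF True] u2[OF True] u3[OF True] upE[of i] dnE[of i]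
          by (cases "z i" "t i" rule: linorder_cases) (auto simp: min_le_iff_disj le_max_iff_disj intro: order.trans less_imp_le)
      next
        case False
        then have "z' i = z i" using z'(4) uo[of i] rs by auto
        then show ?thesis using box by simp
      qed
      then have "z' \<in> K"
        unfolding K_def using F' Fz Ft inv[OF z' sg] by auto
      then show False using zmin[of z'] J' by (simp add: J_def)
    qed
    have zt: "z i = t i" if "i < n" for i
    proof (rule ccontr)
      assume "z i \<noteq> t i"
      define P where "P = {i. i < n \<and> z i < t i}"
      define N where "N = {i. i < n \<and> t i < z i}"
      have fin: "finite P" "finite N" by (auto simp: P_def N_def)
      have "P \<noteq> {}"
      proof
        assume "P = {}"
        then have "j \<notin> P" for j by simp
        then have "t j \<le> z j" if "j < n" for j using that unfolding P_def mem_Collect_eq not_less[symmetric] by blast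
        moreover have "t i < z i" using calculation[OF \<open>i < n\<close>] \<open>z i \<noteq> t i\<close> by simp
        ultimately have "F z x0 < F t x0" using et \<open>i < n\<close> x by (intro F_strict_antimono) auto
        then show False using Fz by simp
      qed
      have "N \<noteq> {}"
      proof
        assume "N = {}"
        then have "j \<notin> N" for j by simp
        then have "z j \<le> t j" if "j < n" for j using that unfolding N_def mem_Collect_eq not_less[symmetric] by blast
        moreover have "z i < t i" using calculation[OF \<open>i < n\<close>] \<open>z i \<noteq> t i\<close> by simp
        ultimately have "F t x0 < F z x0" using zpos \<open>i < n\<close> x by (intro F_strict_antimono) auto
        then show False using Fz by simp
      qed
      \<comment> \<open>\<open>j\<close> is the first coordinate that must rise and \<open>k\<close>
        the last that must fall.\<close>
      define j where "j = Min P"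
      define k where "k = Max N"
      have j: "j < n" "z j < t j" and jmin: "\<And>i. i < j \<Longrightarrow> t i \<le> z i"
      proof -
        have "j \<in> P" unfolding j_def using fin \<open>P \<noteq> {}\<close> by (intro Min_in)
        then show "j < n" "z j < t j" by (auto simp: P_def)
        fix i assume "i < j"
        then have "i \<notin> P" using Min_le[OF fin(1), of i] by (auto simp: j_def)
        then show "t i \<le> z i" using \<open>i < j\<close> \<open>j < n\<close> by (auto simp: P_def)
      qed
      have k: "k < n" "t k < z k" and kmax: "\<And>i. k < i \<Longrightarrow> i < n \<Longrightarrow> z i \<le> t i"
      proof -
        have "k \<in> N" unfolding k_def using fin \<open>N \<noteq> {}\<close> by (intro Max_in)
        then show "k < n" "t k < z k" by (auto simp: N_def)
        fix i assume "k < i" "i < n"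
        then have "i \<notin> N" using Max_ge[OF fin(2), of i] by (auto simp: k_def)
        then show "z i \<le> t i" using \<open>i < n\<close> by (auto simp: N_def)
      qed
      \<comment> \<open>\<open>z\<close> need not be increasing. A falling coordinate before a
        rising one is compared through the increasing vector \<open>e\<close>, which lies above the
        former and below the latter.\<close>
      have zle: "z i \<le> z j" if "i < j" "j < n" "t i < z i" "z j < t j" for i j
      proof -
        have "z i \<le> e i" "e j \<le> z j" using that upE dnE by auto
        moreover have "e i \<le> e j" using that \<eta>_mono[of i j] by (simp add: e_def)
        ultimately show ?thesis by simp
      qed
      have \<phi>pos: "0 < \<phi> i z v" if "i < n" "0 < v" for i v
        using that zpos by (intro \<phi>_pos) auto
      have crossing: "0 \<le> - f y" if "pm_sign f" "f x0 = 0" for f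
        using that x unfolding pm_sign_def by (metis less_irrefl neg_0_le_iff_le not_less)
      show False
      proof (cases "k < j")
        case True
        \<comment> \<open>All falling coordinates precede all rising ones, so one pair suffices; the
          coefficients make the first-order change at \<open>x0\<close> vanish.\<close>
        define u where "u i = (if i = k then - \<phi> j z x0 else 0) + (if i = j then \<phi> k z x0 else 0)" for i
        have us: "(\<Sum>i<n. u i * \<phi> i z v) = - (\<phi> j z x0 * \<phi> k z v - \<phi> k z x0 * \<phi> j z v)" for v
          using j k by (simp add: u_def distrib_right sum.distrib if_distrib[of "\<lambda>c. c * _"] cong: if_cong)
        show False
        proof (rule move[of u j k j])
          show "(\<Sum>i<n. u i * \<phi> i z x0) = 0" by (simp add: us)
          show "0 \<le> (\<Sum>i<n. u i * \<phi> i z y)"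
            unfolding us using j k x \<phi>pos[of j x0] zle[OF True] zpos
            by (intro crossing pm_sign_\<phi>_pair) auto
          show "z i < t i" if "i < n" "0 < u i" for i
            using that j k \<phi>pos[of j x0] x True by (auto simp: u_def split: if_splits)
          show "t i < z i" if "i < n" "u i < 0" for i
            using that j k \<phi>pos[of k x0] x True by (auto simp: u_def split: if_splits)
          show "u j \<noteq> 0" using True \<phi>pos[of k x0] k x by (simp add: u_def)
          show "u i = 0" if "n \<le> i" for i using that j k by (simp add: u_def)
          fix \<tau> b c z'
          assume sg: "\<And>i. i < n \<Longrightarrow> (z' i < t i \<longleftrightarrow> z i < t i) \<and> (t i < z' i \<longleftrightarrow> t i < z i)"
          \<comment> \<open>A head that ends at or before some falling index contains no rising
            index, so each of its terms is nonpositive; for tails the mirror statement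
            holds.\<close>
          have "heads_ok t z'"
            unfolding heads_ok_def
          proof (intro allI impI, elim exE conjE)
            fix m k' assume m: "m \<le> k'" "k' < n" "t k' < z' k'"
            then have "k' \<le> k" using sg[of k'] kmax[of k'] by (force simp: not_less[symmetric])
            then have "t i - z' i \<le> 0" if "i < m" for i
              using that jmin[of i] sg[of i] True m k by (auto simp: not_less[symmetric])
            then show "(\<Sum>i<m. t i - z' i) \<le> 0" by (intro sum_nonpos) auto
          qed
          moreover have "tails_ok t z'"
            unfolding tails_ok_def
          proof (intro allI impI, elim exE conjE)
            fix m j' assume m: "j' < m" "j' < n" "z' j' < t j'"
            then have "j \<le> j'" using sg[of j'] jmin[of j'] by (force simp: not_less[symmetric])
            then have "0 \<le> t i - z' i" if "i \<in> {m..<n}" for i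
              using that kmax[of i] sg[of i] True m j by (auto simp: not_less[symmetric])
            then show "0 \<le> (\<Sum>i\<in>{m..<n}. t i - z' i)" by (intro sum_nonneg)
          qed
          ultimately show "heads_ok t z' \<and> tails_ok t z'" ..
        qed (use j k in auto)
      next
        case False
        then have jk: "j < k" using j k by (metis linorder_neqE_nat order.asym)
        \<comment> \<open>The head through \<open>j\<close> has nonpositive sum but ends with a
          positive term, so something before \<open>j\<close> must fall. Likewise the tail from
          \<open>k\<close> on yields a rising \<open>l\<close>. The result is the pattern down, up,
          down, up at \<open>i < j < k < l\<close>.\<close>
        obtain i where i: "i < j" "t i < z i"
        proof -
          have "(\<Sum>i<Suc j. t i - z i) \<le> 0"
            using zH jk k unfolding heads_ok_def by (metis Suc_leI)
          then have neg: "(\<Sum>i<j. t i - z i) < 0" using j by simp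
          have "\<exists>i\<in>{..<j}. t i < z i"
          proof (rule ccontr)
            assume "\<not> (\<exists>i\<in>{..<j}. t i < z i)"
            then have "0 \<le> (\<Sum>i<j. t i - z i)" by (intro sum_nonneg) (auto simp: not_less)
            with neg show False by simp
          qed
          then show thesis using that by auto
        qed
        obtain l where l: "k < l" "l < n" "z l < t l"
        proof -
          have "0 \<le> (\<Sum>i\<in>{k..<n}. t i - z i)"
            using zT jk j unfolding tails_ok_def by blast
          also have "\<dots> = (t k - z k) + (\<Sum>i\<in>{Suc k..<n}. t i - z i)"
            using k by (intro sum.atLeast_Suc_lessThan)
          finally have pos: "0 < (\<Sum>i\<in>{Suc k..<n}. t i - z i)" using k by simp
          have "\<exists>i\<in>{Suc k..<n}. z i < t i"
          proof (rule ccontr)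
            assume "\<not> (\<exists>i\<in>{Suc k..<n}. z i < t i)"
            then have "(\<Sum>i\<in>{Suc k..<n}. t i - z i) \<le> 0" by (intro sum_nonpos) (auto simp: not_less)
            with pos show False by simp
          qed
          then obtain l where "l \<in> {Suc k..<n}" "z l < t l" by blast
          then show thesis by (intro that[of l]) auto
        qed
        have ij: "i < n" using i j by simp
        have zij: "z i \<le> z j" using zle[OF i(1) j(1) i(2) j(2)] .
        have zkl: "z k \<le> z l" using zle[OF l(1,2) k(2) l(3)] .
        \<comment> \<open>For a rising coordinate before a falling one the comparison goes through
          \<open>t\<close>.\<close>
        have zjk: "z j \<le> z k" using \<theta>_mono[of j k] jk k j by (auto simp: t_def)
        \<comment> \<open>\<open>A \<le> B\<close> preserves the head conditions and
          \<open>D \<le> C\<close> the tail conditions. The corrections \<open>b\<close> at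
          \<open>j\<close> and \<open>c\<close> at \<open>k\<close> only help, because the relevant
          heads stop before or at \<open>k\<close> and the relevant tails start after
          \<open>j\<close>.\<close>
        have final: False if ABCD: "0 \<le> A" "A \<le> B" "0 \<le> D" "D \<le> C" "0 < B + C"
          and lv: "- A * \<phi> i z x0 + B * \<phi> j z x0 - C * \<phi> k z x0 + D * \<phi> l z x0 = 0"
          and uy: "0 \<le> - A * \<phi> i z y + B * \<phi> j z y - C * \<phi> k z y + D * \<phi> l z y" for A B C D
        proof -
          define u where "u m = (if m = i then - A else 0) + (if m = j then B else 0)
            + (if m = k then - C else 0) + (if m = l then D else 0)" for m
          have us: "(\<Sum>m<n. u m * \<phi> m z v) = - A * \<phi> i z v + B * \<phi> j z v - C * \<phi> k z v + D * \<phi> l z v" for v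
            using ij j k l by (simp add: u_def distrib_right sum.distrib if_distrib[of "\<lambda>c. c * _"] cong: if_cong)
          have uv: "u i = - A" "u j = B" "u k = - C" "u l = D"
            using i jk l by (auto simp: u_def)
          show False
          \<comment> \<open>The last argument names a nonzero entry of \<open>u\<close>, available
            because \<open>B + C\<close> is positive.\<close>
          proof (rule move[of u j k "if B = 0 then k else j"])
            show "(\<Sum>i<n. u i * \<phi> i z x0) = 0" "0 \<le> (\<Sum>i<n. u i * \<phi> i z y)"
              using lv uy by (simp_all only: us)
            show "z m < t m" if "m < n" "0 < u m" for m
              using that i j k l jk ABCD by (auto simp: u_def split: if_splits)
            show "t m < z m" if "m < n" "u m < 0" for m
              using that i j k l jk ABCD by (auto simp: u_def split: if_splits)
            show "u (if B = 0 then k else j) \<noteq> 0"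
              using uv ABCD by auto
            show "u m = 0" if "n \<le> m" for m using that ij j k l by (simp add: u_def)
            fix \<tau> b c z'
            assume pos: "0 < \<tau>" "0 \<le> b" "0 \<le> c"
              and z': "z' = (\<lambda>i. z i + \<tau> * u i + (if i = j then b else 0) - (if i = k then c else 0))"
              and sg: "\<And>i. i < n \<Longrightarrow> (z' i < t i \<longleftrightarrow> z i < t i) \<and> (t i < z' i \<longleftrightarrow> t i < z i)"
            have incr: "(\<Sum>m\<in>S. t m - z' m) = (\<Sum>m\<in>S. t m - z m) + ((if i \<in> S then \<tau> * A else 0) - (if j \<in> S then \<tau> * B + b else 0)
               + (if k \<in> S then \<tau> * C + c else 0) - (if l \<in> S then \<tau> * D else 0))" if "finite S" for S
            proof -
              have "(\<Sum>m\<in>S. t m - z' m) = (\<Sum>m\<in>S. (t m - z m) + ((if m = i then \<tau> * A else 0) - (if m = j then \<tau> * B + b else 0)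
               + (if m = k then \<tau> * C + c else 0) - (if m = l then \<tau> * D else 0)))"
                using i jk l by (intro sum.cong) (auto simp: z' u_def algebra_simps)
              also have "\<dots> = (\<Sum>m\<in>S. t m - z m) + ((if i \<in> S then \<tau> * A else 0) - (if j \<in> S then \<tau> * B + b else 0)
               + (if k \<in> S then \<tau> * C + c else 0) - (if l \<in> S then \<tau> * D else 0))"
                using that by (simp add: sum.distrib sum_subtractf)
              finally show ?thesis .
            qed
            have "heads_ok t z'"
              unfolding heads_ok_def
            proof (intro allI impI, elim exE conjE)
              fix m k' assume m: "m \<le> k'" "k' < n" "t k' < z' k'"
              then have k'k: "k' \<le> k" using sg[of k'] kmax[of k'] by (force simp: not_less[symmetric])
              show "(\<Sum>i<m. t i - z' i) \<le> 0"
              proof (cases "m \<le> j")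
                case True
                then have "t i - z' i \<le> 0" if "i < m" for i
                  using that jmin[of i] sg[of i] j by (auto simp: not_less[symmetric])
                then show ?thesis by (intro sum_nonpos) auto
              next
                case False
                have "(\<Sum>i<m. t i - z i) \<le> 0"
                  using zH m sg[of k'] unfolding heads_ok_def by blast
                moreover have "\<tau> * A \<le> \<tau> * B" using ABCD pos by simp
                moreover have "(\<Sum>i<m. t i - z' i) = (\<Sum>i<m. t i - z i) + (\<tau> * A - (\<tau> * B + b))"
                  using False i jk l m k'k by (subst incr) auto
                ultimately show ?thesis
                  using pos by linarith
              qed
            qed
            moreover have "tails_ok t z'"
              unfolding tails_ok_def
            proof (intro allI impI, elim exE conjE)
              fix m j' assume m: "j' < m" "j' < n" "z' j' < t j'"
              then have jj': "j \<le> j'" using sg[of j'] jmin[of j'] by (force simp: not_less[symmetric])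
              show "0 \<le> (\<Sum>i\<in>{m..<n}. t i - z' i)"
              proof (cases "k < m")
                case True
                then have "0 \<le> t i - z' i" if "i \<in> {m..<n}" for i
                  using that kmax[of i] sg[of i] by (auto simp: not_less[symmetric])
                then show ?thesis by (intro sum_nonneg)
              next
                case False
                have "0 \<le> (\<Sum>i\<in>{m..<n}. t i - z i)"
                  using zT m sg[of j'] unfolding tails_ok_def by blast
                moreover have "\<tau> * D \<le> \<tau> * C" using ABCD pos by simp
                moreover have "(\<Sum>i\<in>{m..<n}. t i - z' i) = (\<Sum>i\<in>{m..<n}. t i - z i) + ((\<tau> * C + c) - \<tau> * D)"
                  using False i jk l m jj' k by (subst incr) auto
                ultimately show ?thesis
                  using pos by linarith
              qed
            qed
            ultimately show "heads_ok t z' \<and> tails_ok t z'" ..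
          qed (use j k in auto)
        qed
        have p: "0 < \<phi> i z x0" "0 < \<phi> j z x0" "0 < \<phi> k z x0" "0 < \<phi> l z x0"
          using \<phi>pos ij j k l x by auto
        \<comment> \<open>The level condition forces the ratio of a pair move. In the first two
          cases one pair alone has the admissible ratio; in the third neither has, and two
          sum-preserving pairs with \<open>A = B\<close> and \<open>C = D\<close> are balanced
          against each other.\<close>
        consider "\<phi> j z x0 \<le> \<phi> i z x0" | "\<phi> k z x0 \<le> \<phi> l z x0" | "\<phi> i z x0 < \<phi> j z x0" "\<phi> l z x0 < \<phi> k z x0"
          by linarith
        then show False
        proof cases
          case 1
          have "0 \<le> - (\<phi> j z x0 * \<phi> i z y - \<phi> i z x0 * \<phi> j z y)"
            using p ij j zij zpos by (intro crossing pm_sign_\<phi>_pair) auto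
          then show False
            using 1 p by (intro final[of "\<phi> j z x0" "\<phi> i z x0" 0 0]) (auto simp: algebra_simps)
        next
          case 2
          have "0 \<le> - (\<phi> l z x0 * \<phi> k z y - \<phi> k z x0 * \<phi> l z y)"
            using p k l zkl zpos by (intro crossing pm_sign_\<phi>_pair) auto
          then show False
            using 2 p by (intro final[of 0 0 "\<phi> k z x0" "\<phi> l z x0"]) (auto simp: algebra_simps)
        next
          case 3
          define A where "A = \<phi> k z x0 - \<phi> l z x0"
          define C where "C = \<phi> j z x0 - \<phi> i z x0"
          have AC: "0 < A" "0 < C" using 3 by (auto simp: A_def C_def)
          have "z k \<noteq> z l" using 3(2) by (auto simp: \<phi>_def)
          then have "z k < z l" using zkl by simp
          then have "0 \<le> - (A * (\<phi> i z y - \<phi> j z y) + C * (\<phi> k z y - \<phi> l z y))"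
            using AC ij j k l zij zjk zpos
            by (intro crossing pm_sign_\<phi>_four) (auto simp: A_def C_def algebra_simps)
          then show False
            using AC by (intro final[of A A C C]) (auto simp: A_def C_def algebra_simps)
        qed
      qed
    qed
    have "F z = F t" unfolding F_def by (rule smear_cong) (use zt in auto)
    moreover have "J z = F z y" using zt by (simp add: J_def)
    moreover have "J z \<le> J e" by (rule zmin[OF eK])
    moreover have "J e \<le> F e y + \<epsilon>'" using \<epsilon> by (simp add: J_def V_def)
    ultimately show "F \<theta> y \<le> F \<eta> y + \<epsilon>'" using Fe Ft by simp
  qed
qed

end

section \<open>The crossing\<close>

text \<open>A sorted list of signs is a block of -1 followed by a block of 1. The second conjunct,
  for lists starting with 1, strengthens the induction.\<close>

lemma length_remdups_adj_sorted_signs: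
  fixes L :: "real list"
  assumes "sorted L" "set L \<subseteq> {-1, 1}"
  shows "length (remdups_adj L) \<le> 2 \<and> (L \<noteq> [] \<and> hd L = 1 \<longrightarrow> length (remdups_adj L) \<le> 1)"
  using assms
proof (induction L)
  case (Cons x L)
  then have IH: "length (remdups_adj L) \<le> 2" "L \<noteq> [] \<Longrightarrow> hd L = 1 \<Longrightarrow> length (remdups_adj L) \<le> 1"
    by auto
  show ?case
  proof (cases L)
    case (Cons y L')
    have xy: "x = 1 \<Longrightarrow> y = 1" "x = -1 \<or> x = 1" "y = -1 \<or> y = 1"
      using Cons.prems \<open>L = y # L'\<close> by auto
    have L: "L \<noteq> []" "hd L = y" using Cons by auto
    then have "remdups_adj L \<noteq> []" "hd (remdups_adj L) = y" by simp_all
    then obtain rs where R: "remdups_adj L = y # rs"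
      by (metis list.collapse)
    have rs: "length rs \<le> 1" "y = 1 \<Longrightarrow> rs = []"
      using IH L R by simp_all
    have X: "remdups_adj (x # L) = (if x = y then y # rs else x # y # rs)"
      unfolding remdups_adj_Cons R by simp
    show ?thesis
      unfolding X using xy rs by (cases "x = y") auto
  qed simp
qed simp

lemma sign_changes_eq_1:
  assumes single: "\<And>x y. 0 < x \<Longrightarrow> x < y \<Longrightarrow> 0 < D x \<Longrightarrow> 0 \<le> D y"
    and xy: "0 < x" "x < y" "D x < 0" "0 < D y"
  shows "sign_changes_on {0<..} D = 1"
proof (rule antisym)
  show "sign_changes_on {0<..} D \<le> 1"
    unfolding sign_changes_on_def
  proof (rule SUP_least)
    fix xs :: "real list"
    assume "xs \<in> {xs. sorted_wrt (<) xs \<and> set xs \<subseteq> {0<..}}"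
    then have xs: "sorted_wrt (<) xs" "set xs \<subseteq> {0<..}" by auto
    define ys where "ys = filter (\<lambda>x. D x \<noteq> 0) xs"
    have "sorted_wrt (\<lambda>x y. sgn (D x) \<le> sgn (D y)) ys"
    proof (rule sorted_wrt_mono_rel)
      show "sorted_wrt (<) ys" unfolding ys_def using xs(1) by (rule sorted_wrt_filter)
      fix u v assume "u \<in> set ys" "v \<in> set ys" "u < v"
      then show "sgn (D u) \<le> sgn (D v)"
        using single[of u v] xs(2) by (cases "0 < D u") (auto simp: ys_def sgn_if)
    qed
    then have "sorted (map (\<lambda>x. sgn (D x)) ys)"
      by (simp add: sorted_wrt_map)
    moreover have "set (map (\<lambda>x. sgn (D x)) ys) \<subseteq> {-1, 1}"
      by (auto simp: ys_def sgn_if)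
    ultimately have "length (remdups_adj (map (\<lambda>x. sgn (D x)) ys)) \<le> 2"
      using length_remdups_adj_sorted_signs by blast
    then have "seq_sign_changes (map D xs) \<le> 1"
      by (simp add: seq_sign_changes_def filter_map ys_def comp_def)
    then show "enat (seq_sign_changes (map D xs)) \<le> 1"
      by (simp add: one_enat_def)
  qed
  have "seq_sign_changes (map D [x, y]) = 1"
    using xy by (simp add: seq_sign_changes_def)
  then have "1 = enat (seq_sign_changes (map D [x, y]))"
    by (simp add: one_enat_def)
  also have "\<dots> \<le> sign_changes_on {0<..} D"
    unfolding sign_changes_on_def using xy by (intro SUP_upper) auto
  finally show "1 \<le> sign_changes_on {0<..} D" .
qed

text \<open>Strict Schur convexity of the sum of squares. Expand \<open>b = a + (b - a)\<close>: the
  cross term is nonnegative by Abel summation, since \<open>a\<close> increases and the partial sums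
  \<open>H\<close> are nonpositive with \<open>H n = 0\<close>.\<close>

lemma sum_squares_less_majorized:
  fixes a b :: "nat \<Rightarrow> real"
  assumes mono: "\<And>i j. i \<le> j \<Longrightarrow> j < n \<Longrightarrow> a i \<le> a j"
    and heads: "\<And>m. m \<le> n \<Longrightarrow> (\<Sum>i<m. b i) \<le> (\<Sum>i<m. a i)" and total: "(\<Sum>i<n. b i) = (\<Sum>i<n. a i)"
    and neq: "i0 < n" "a i0 \<noteq> b i0"
  shows "(\<Sum>i<n. (a i)\<^sup>2) < (\<Sum>i<n. (b i)\<^sup>2)"
proof -
  define H where "H m = (\<Sum>i<m. b i - a i)" for m
  have H: "H m \<le> 0" if "m \<le> n" for m
    using heads[OF that] by (simp add: H_def sum_subtractf)
  have "a m * H (Suc m) \<le> (\<Sum>i<Suc m. a i * (b i - a i))" if "Suc m \<le> n" for m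
    using that
  proof (induction m)
    case 0
    then show ?case by (simp add: H_def)
  next
    case (Suc m)
    have "a (Suc m) * H (Suc m) \<le> a m * H (Suc m)"
      using mono[of m "Suc m"] H[of "Suc m"] Suc.prems by (intro mult_right_mono_neg) auto
    then show ?case using Suc by (simp add: H_def algebra_simps)
  qed
  from this[of "n - 1"] have "0 \<le> (\<Sum>i<n. a i * (b i - a i))"
    using neq(1) total by (simp add: H_def sum_subtractf)
  moreover have "0 < (\<Sum>i<n. (b i - a i)\<^sup>2)"
    using neq by (intro sum_pos2[of _ i0]) auto
  moreover have "(\<Sum>i<n. (b i)\<^sup>2) = (\<Sum>i<n. (a i)\<^sup>2) + 2 * (\<Sum>i<n. a i * (b i - a i)) + (\<Sum>i<n. (b i - a i)\<^sup>2)"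
    unfolding sum_distrib_left sum.distrib[symmetric]
    by (intro sum.cong) (auto simp: power2_eq_square algebra_simps)
  ultimately show ?thesis by simp
qed

lemma has_bochner_integral_gamma_density:
  assumes a: "0 < a"
  shows "has_bochner_integral lborel (gamma_density a) 1"
proof -
  have G: "0 < Gamma a" using a by (rule Gamma_real_pos)
  have "((\<lambda>t. (1 / Gamma a) * (t powr (a - 1) / exp t)) has_integral (1 / Gamma a) * Gamma a) {0..}"
    by (intro has_integral_mult_right Gamma_integral_real a)
  then have "(gamma_density a has_integral 1) {0..}"
    by (rule has_integral_spike_finite[of "{0}", rotated 2, THEN has_integral_eq_rhs])
       (use G in \<open>auto simp: gamma_density_def exp_minus field_simps\<close>)
  then have "(gamma_density a has_integral 1) UNIV"
    by (rule has_integral_on_superset) (auto simp: gamma_density_eq_0)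
  from nn_integral_has_integral_lborel[OF _ _ this]
  have "(\<integral>\<^sup>+ x. ennreal (gamma_density a x) \<partial>lborel) = ennreal 1"
    using gamma_density_nonneg[OF a] by simp
  then show ?thesis
    using gamma_density_nonneg[OF a] by (intro has_bochner_integral_nn_integral) auto
qed

section \<open>Sorted and possibly zero weights\<close>

context iid_gamma
begin

text \<open>Exchangeability: by \<open>smear_insert\<close> each variable enters only through its
  weight and the common density.\<close>

lemma smear_reindex:
  assumes "finite I" "I \<subseteq> {..<n}" "J \<subseteq> {..<n}" "bij_betw f I J" "\<And>i. i \<in> I \<Longrightarrow> z i = w (f i)"
    and d: "d \<in> borel_measurable borel" "\<And>y. \<bar>d y\<bar> \<le> B"
  shows "smear z I d x = smear w J d x"
  using assms(1-5)
proof (induction I arbitrary: J x)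
  case empty
  then show ?case by (simp add: smear_empty bij_betw_def)
next
  case (insert i I)
  have J: "J = insert (f i) (f ` I)" "f i \<notin> f ` I"
    using insert.prems(3) insert.hyps(2) by (auto simp: bij_betw_def inj_on_def)
  have IH: "smear z I d v = smear w (f ` I) d v" for v
    using insert.prems J by (intro insert.IH) (auto simp: bij_betw_def inj_on_def)
  have "smear z (insert i I) d x = (LINT u|lborel. gamma_density \<alpha> u * smear z I d (x - z i * u))"
    using insert d by (intro smear_insert[where B = B]) auto
  also have "\<dots> = (LINT u|lborel. gamma_density \<alpha> u * smear w (f ` I) d (x - w (f i) * u))"
    using insert.prems by (simp add: IH)
  also have "\<dots> = smear w J d x"
    unfolding J(1) using insert.prems J d by (intro smear_insert[where B = B, symmetric]) auto
  finally show ?case .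
qed

lemma F_mset:
  assumes "length xs = n" "mset xs = mset ys"
  shows "F (\<lambda>i. xs ! i) x = F (\<lambda>i. ys ! i) x"
proof -
  obtain p where p: "p permutes {..<length ys}" "permute_list p ys = xs"
    using mset_eq_permutation[OF assms(2)] .
  have len: "length ys = n" using assms mset_eq_length by metis
  show ?thesis
    unfolding F_def
  proof (rule smear_reindex[where B = 1])
    show "bij_betw p {..<n} {..<n}" using p(1) len permutes_imp_bij by blast
    show "xs ! i = ys ! p i" if "i \<in> {..<n}" for i
      using p len that permute_list_nth[of p ys i] by auto
  qed (auto simp: indicator_def)
qed

lemma weighted_sum_cdf_eq_F:
  assumes "length \<theta> = n"
  shows "weighted_sum_cdf M X \<theta> x = F (\<lambda>i. sort \<theta> ! i) x"
proof -
  note [measurable] = wsum_measurable[of "{..<n}" "\<lambda>i. \<theta> ! i", OF order_refl]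
  have "weighted_sum_cdf M X \<theta> x = measure (distr M borel (wsum (\<lambda>i. \<theta> ! i) {..<n})) {..x}"
    using assms by (simp add: weighted_sum_cdf_def cdf_def wsum_def[abs_def])
  also have "\<dots> = F (\<lambda>i. \<theta> ! i) x"
    by (subst measure_distr) (auto simp: F_eq_prob vimage_def Int_def conj_commute)
  also have "\<dots> = F (\<lambda>i. sort \<theta> ! i) x"
    using assms by (intro F_mset) simp_all
  finally show ?thesis .
qed

text \<open>Trades the argument for the weights, so that continuity in \<open>x\<close> follows from
  continuity in the weights.\<close>

lemma F_scale:
  assumes "0 < x"
  shows "F z x = F (\<lambda>i. z i / x) 1"
proof -
  have "wsum (\<lambda>i. z i / x) {..<n} \<omega> = wsum z {..<n} \<omega> / x" for \<omega>
    by (simp add: wsum_def sum_divide_distrib)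
  then show ?thesis
    unfolding F_eq_prob using assms by (simp add: divide_le_eq)
qed

lemma F_isCont:
  assumes i: "i < n" "0 < z i" and x: "0 < x"
  shows "isCont (F z) x"
  unfolding continuous_at_sequentially
proof (intro allI impI)
  fix S assume S: "S \<longlonglongrightarrow> x"
  have "(\<lambda>m. F (\<lambda>i. z i / S m) 1) \<longlonglongrightarrow> F (\<lambda>i. z i / x) 1"
    using x i by (intro F_tendsto[of _ _ i] tendsto_intros S) auto
  moreover have "eventually (\<lambda>m. 0 < S m) sequentially"
    by (rule order_tendstoD(1)[OF S x])
  then have "eventually (\<lambda>m. F (\<lambda>i. z i / S m) 1 = F z (S m)) sequentially"
    by (rule eventually_mono) (simp add: F_scale[of _ z])
  ultimately show "(F z \<circ> S) \<longlonglongrightarrow> F z x"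
    unfolding comp_def F_scale[OF x, of z] by (rule Lim_transform_eventually)
qed

text \<open>A passage from + to - would contain a zero by continuity, and
  \<open>level_crossing\<close> excludes a negative value after a zero.\<close>

lemma single_crossing_pos:
  assumes a: "\<And>i. i < n \<Longrightarrow> 0 < a i" and b: "\<And>i. i < n \<Longrightarrow> 0 < b i"
    and a_mono: "\<And>i j. i \<le> j \<Longrightarrow> j < n \<Longrightarrow> a i \<le> a j" and b_mono: "\<And>i j. i \<le> j \<Longrightarrow> j < n \<Longrightarrow> b i \<le> b j"
    and heads: "\<And>m. m \<le> n \<Longrightarrow> (\<Sum>i<m. b i) \<le> (\<Sum>i<m. a i)" and total: "(\<Sum>i<n. b i) = (\<Sum>i<n. a i)"
    and n: "0 < n" and x: "0 < x" "x < y" and gt: "F b x < F a x"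
  shows "F b y \<le> F a y"
proof (rule ccontr)
  assume lt: "\<not> F b y \<le> F a y"
  have "isCont (\<lambda>x. F a x - F b x) v" if "x \<le> v" "v \<le> y" for v
    using that x n a[OF n] b[OF n] by (intro continuous_intros F_isCont[of 0]) auto
  then have "\<exists>v\<ge>x. v \<le> y \<and> F a v - F b v = 0"
    using gt lt x by (intro IVT2) auto
  then obtain v where v: "x \<le> v" "v \<le> y" "F a v = F b v" by auto
  then have "v < y" using lt by (cases "v = y") auto
  then have "F b y \<le> F a y"
    using v x by (intro level_crossing[OF a b a_mono b_mono heads total, of v]) auto
  with lt show False by simp
qed

text \<open>Adding the same \<open>1 / real (Suc m)\<close> to all weights makes them positive and
  keeps order, head inequalities and equality of totals. The strict inequality at \<open>x\<close>
  holds for large \<open>m\<close>, and the weak one at \<open>y\<close> passes to the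
  limit.\<close>

lemma single_crossing:
  assumes a: "\<And>i. i < n \<Longrightarrow> 0 \<le> a i" and b: "\<And>i. i < n \<Longrightarrow> 0 \<le> b i"
    and a_mono: "\<And>i j. i \<le> j \<Longrightarrow> j < n \<Longrightarrow> a i \<le> a j" and b_mono: "\<And>i j. i \<le> j \<Longrightarrow> j < n \<Longrightarrow> b i \<le> b j"
    and heads: "\<And>m. m \<le> n \<Longrightarrow> (\<Sum>i<m. b i) \<le> (\<Sum>i<m. a i)" and total: "(\<Sum>i<n. b i) = (\<Sum>i<n. a i)"
    and ai: "i < n" "0 < a i" and bj: "j < n" "0 < b j" and x: "0 < x" "x < y" and gt: "F b x < F a x"
  shows "F b y \<le> F a y"
proof -
  define A where "A m i = a i + 1 / real (Suc m)" for m i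
  define B where "B m i = b i + 1 / real (Suc m)" for m i
  have lim: "(\<lambda>m. c + 1 / real (Suc m)) \<longlonglongrightarrow> c" for c :: real
    using tendsto_add[OF tendsto_const LIMSEQ_inverse_real_of_nat, of c] by (simp add: inverse_eq_divide)
  have A: "(\<lambda>m. F (A m) v) \<longlonglongrightarrow> F a v" for v
    by (rule F_tendsto[of A a i, OF _ ai]) (simp only: A_def lim)
  have B: "(\<lambda>m. F (B m) v) \<longlonglongrightarrow> F b v" for v
    by (rule F_tendsto[of B b j, OF _ bj]) (simp only: B_def lim)
  have "eventually (\<lambda>m. 0 < F (A m) x - F (B m) x) sequentially"
    using gt by (intro order_tendstoD(1)[OF tendsto_diff[OF A B]]) simp
  then have "eventually (\<lambda>m. F (B m) y \<le> F (A m) y) sequentially"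
  proof (rule eventually_mono)
    fix m assume "0 < F (A m) x - F (B m) x"
    then show "F (B m) y \<le> F (A m) y"
      using a b a_mono b_mono heads total ai x
      by (intro single_crossing_pos[of "A m" "B m" x]) (auto simp: A_def B_def sum.distrib intro: add_nonneg_pos)
  qed
  then show ?thesis
    using A B by (intro tendsto_le[OF sequentially_bot]) auto
qed

section \<open>Moments, and why both signs occur\<close>

lemma X_moments:
  assumes i: "i < n"
  shows "integrable M (X i)" "expectation (X i) = \<alpha>"
    and "integrable M (\<lambda>\<omega>. X i \<omega> * X i \<omega>)" "expectation (\<lambda>\<omega>. X i \<omega> * X i \<omega>) = \<alpha>\<^sup>2 + \<alpha>"
proof -
  have a: "0 < \<alpha>" using \<alpha> by simp
  have 1: "gamma_density \<alpha> u * u = \<alpha> * gamma_density (\<alpha> + 1) u" for u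
    using gamma_density_Suc[OF a, of u] by (simp add: mult.commute)
  have 2: "gamma_density \<alpha> u * (u * u) = \<alpha> * (\<alpha> + 1) * gamma_density (\<alpha> + 2) u" for u
    using gamma_density_Suc[of "\<alpha> + 1" u] a by (simp add: mult.assoc[symmetric] 1) (simp add: ac_simps)
  have h1: "has_bochner_integral lborel (\<lambda>u. gamma_density \<alpha> u * u) (\<alpha> * 1)"
    unfolding 1 using a by (intro has_bochner_integral_mult_right has_bochner_integral_gamma_density) auto
  have h2: "has_bochner_integral lborel (\<lambda>u. gamma_density \<alpha> u * (u * u)) (\<alpha> * (\<alpha> + 1) * 1)"
    unfolding 2 using a by (intro has_bochner_integral_mult_right has_bochner_integral_gamma_density) auto
  show "integrable M (X i)"
    using distributed_integrable[OF dist[OF i], of "\<lambda>u. u"] h1 gamma_density_nonneg[OF a]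
    by (auto simp: has_bochner_integral_iff)
  show "integrable M (\<lambda>\<omega>. X i \<omega> * X i \<omega>)"
    using distributed_integrable[OF dist[OF i], of "\<lambda>u. u * u"] h2 gamma_density_nonneg[OF a]
    by (auto simp: has_bochner_integral_iff)
  show "expectation (X i) = \<alpha>"
    using expectation_gamma[OF i, of "\<lambda>u. u"] h1 by (simp add: has_bochner_integral_iff)
  show "expectation (\<lambda>\<omega>. X i \<omega> * X i \<omega>) = \<alpha>\<^sup>2 + \<alpha>"
    using expectation_gamma[OF i, of "\<lambda>u. u * u"] h2
    by (simp add: has_bochner_integral_iff power2_eq_square algebra_simps)
qed

lemma X_product:
  assumes "i < n" "j < n"
  shows "integrable M (\<lambda>\<omega>. X i \<omega> * X j \<omega>)"
    and "expectation (\<lambda>\<omega>. X i \<omega> * X j \<omega>) = \<alpha>\<^sup>2 + (if i = j then \<alpha> else 0)"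
proof -
  have "integrable M (\<lambda>\<omega>. X i \<omega> * X j \<omega>) \<and> expectation (\<lambda>\<omega>. X i \<omega> * X j \<omega>) = \<alpha>\<^sup>2 + (if i = j then \<alpha> else 0)"
  proof (cases "i = j")
    case True
    then show ?thesis using X_moments assms by simp
  next
    case False
    have "wsum (\<lambda>_. 1) {j} = X j"
      by (simp add: wsum_def fun_eq_iff)
    then have "indep_var borel (X i) borel (X j)"
      using indep_X_wsum[of i "{j}" "\<lambda>_. 1"] assms False by simp
    then show ?thesis
      using indep_var_integrable[of "X i" "X j"] indep_var_lebesgue_integral[of "X i" "X j"] X_moments assms False
      by (simp add: power2_eq_square)
  qed
  then show "integrable M (\<lambda>\<omega>. X i \<omega> * X j \<omega>)"
    and "expectation (\<lambda>\<omega>. X i \<omega> * X j \<omega>) = \<alpha>\<^sup>2 + (if i = j then \<alpha> else 0)"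
    by auto
qed

lemma wsum_mean: "integrable M (wsum z {..<n})" "expectation (wsum z {..<n}) = \<alpha> * (\<Sum>i<n. z i)"
  unfolding wsum_def[abs_def] using X_moments by (auto simp: sum_distrib_left mult.commute)

lemma wsum_second_moment:
  "expectation (\<lambda>\<omega>. (wsum z {..<n} \<omega>)\<^sup>2) = \<alpha>\<^sup>2 * (\<Sum>i<n. z i)\<^sup>2 + \<alpha> * (\<Sum>i<n. (z i)\<^sup>2)"
proof -
  have sq: "(wsum z {..<n} \<omega>)\<^sup>2 = (\<Sum>i<n. \<Sum>j<n. z i * z j * (X i \<omega> * X j \<omega>))" for \<omega>
    by (simp add: wsum_def power2_eq_square sum_product ac_simps)
  have "expectation (\<lambda>\<omega>. (wsum z {..<n} \<omega>)\<^sup>2) = (\<Sum>i<n. \<Sum>j<n. z i * z j * (\<alpha>\<^sup>2 + (if i = j then \<alpha> else 0)))"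
  proof -
    have "integrable M (\<lambda>\<omega>. z i * z j * (X i \<omega> * X j \<omega>))" if "i < n" "j < n" for i j
      using that by (intro integrable_mult_right X_product(1))
    then have "expectation (\<lambda>\<omega>. (wsum z {..<n} \<omega>)\<^sup>2)
        = (\<Sum>i<n. \<Sum>j<n. expectation (\<lambda>\<omega>. z i * z j * (X i \<omega> * X j \<omega>)))"
      unfolding sq by (subst Bochner_Integration.integral_sum;
          force intro!: sum.cong Bochner_Integration.integral_sum)
    also have "\<dots> = (\<Sum>i<n. \<Sum>j<n. z i * z j * (\<alpha>\<^sup>2 + (if i = j then \<alpha> else 0)))"
      by (intro sum.cong refl) (simp add: X_product(2))
    finally show ?thesis .
  qed
  also have "\<dots> = (\<Sum>i<n. \<Sum>j<n. \<alpha>\<^sup>2 * (z i * z j)) + (\<Sum>i<n. \<Sum>j<n. if i = j then \<alpha> * (z i * z j) else 0)"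
    unfolding sum.distrib[symmetric] by (intro sum.cong refl) (auto simp: algebra_simps)
  also have "\<dots> = \<alpha>\<^sup>2 * (\<Sum>i<n. z i)\<^sup>2 + \<alpha> * (\<Sum>i<n. (z i)\<^sup>2)"
    by (simp add: power2_eq_square sum_product) (simp flip: sum_distrib_left)
  finally show ?thesis .
qed

lemma wsum_pos:
  assumes "\<And>j. j < n \<Longrightarrow> 0 \<le> z j" "i < n" "0 < z i"
  shows "AE \<omega> in M. 0 < wsum z {..<n} \<omega>"
proof -
  have "AE \<omega> in M. \<forall>i\<in>{..<n}. 0 < X i \<omega>"
    by (rule AE_finite_allI) (auto intro: X_pos)
  then show ?thesis
  proof eventually_elim
    case (elim \<omega>)
    have "0 < z i * X i \<omega>" using elim assms by (intro mult_pos_pos) auto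
    moreover have "0 \<le> z j * X j \<omega>" if "j < n" for j
      using elim assms(1)[OF that] that by (intro mult_nonneg_nonneg) (auto intro: less_imp_le)
    ultimately show ?case
      unfolding wsum_def using assms(2) by (intro sum_pos2[of _ i]) auto
  qed
qed

text \<open>The layer-cake formula for the mean, by exchanging the integrals over \<open>t\<close>
  and the probability space.\<close>

lemma tail_integral:
  assumes z: "\<And>j. j < n \<Longrightarrow> 0 \<le> z j" "i < n" "0 < z i"
  shows "has_bochner_integral lborel (\<lambda>t. indicator {0<..} t * (1 - F z t)) (\<alpha> * (\<Sum>i<n. z i))"
proof -
  note [measurable] = wsum_measurable[of "{..<n}" z, OF order_refl]
  define W where "W = wsum z {..<n}"
  have W[measurable]: "W \<in> borel_measurable M" unfolding W_def by measurable
  have Wpos: "AE \<omega> in M. 0 < W \<omega>" unfolding W_def using z by (rule wsum_pos)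
  interpret P: pair_sigma_finite M lborel ..
  have tail: "prob {\<omega> \<in> space M. t < W \<omega>} = 1 - F z t" for t
  proof -
    have "prob {\<omega> \<in> space M. \<not> W \<omega> \<le> t} = 1 - prob {\<omega> \<in> space M. W \<omega> \<le> t}"
      by (rule prob_neg) measurable
    then show ?thesis by (simp add: F_eq_prob W_def not_le)
  qed
  have "(\<integral>\<^sup>+ t. ennreal (indicator {0<..} t * (1 - F z t)) \<partial>lborel)
      = (\<integral>\<^sup>+ t. \<integral>\<^sup>+ \<omega>. (if 0 < t \<and> t < W \<omega> then 1 else 0) \<partial>M \<partial>lborel)"
  proof (intro nn_integral_cong)
    fix t :: real
    have "(\<integral>\<^sup>+ \<omega>. (if 0 < t \<and> t < W \<omega> then 1 else 0) \<partial>M) = (\<integral>\<^sup>+ \<omega>. indicator {0<..} t * indicator {\<omega> \<in> space M. t < W \<omega>} \<omega> \<partial>M)"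
      by (intro nn_integral_cong) (auto simp: indicator_def)
    also have "\<dots> = indicator {0<..} t * emeasure M {\<omega> \<in> space M. t < W \<omega>}"
      by (simp add: nn_integral_cmult)
    also have "\<dots> = ennreal (indicator {0<..} t * (1 - F z t))"
      by (simp add: emeasure_eq_measure tail indicator_def)
    finally show "ennreal (indicator {0<..} t * (1 - F z t)) = (\<integral>\<^sup>+ \<omega>. (if 0 < t \<and> t < W \<omega> then 1 else 0) \<partial>M)" ..
  qed
  also have "\<dots> = (\<integral>\<^sup>+ \<omega>. \<integral>\<^sup>+ t. (if 0 < t \<and> t < W \<omega> then 1 else 0) \<partial>lborel \<partial>M)"
    by (rule P.Fubini') measurable
  also have "\<dots> = (\<integral>\<^sup>+ \<omega>. ennreal (W \<omega>) \<partial>M)"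
  proof (intro nn_integral_cong_AE)
    show "AE \<omega> in M. (\<integral>\<^sup>+ t. (if 0 < t \<and> t < W \<omega> then 1 else 0) \<partial>lborel) = ennreal (W \<omega>)"
      using Wpos
    proof eventually_elim
      case (elim \<omega>)
      have "(\<integral>\<^sup>+ t. (if 0 < t \<and> t < W \<omega> then 1 else 0) \<partial>lborel) = (\<integral>\<^sup>+ t. indicator {0<..<W \<omega>} t \<partial>lborel)"
        by (intro nn_integral_cong) (auto simp: indicator_def)
      also have "\<dots> = ennreal (W \<omega>)" using elim by simp
      finally show ?case .
    qed
  qed
  also have "\<dots> = ennreal (expectation W)"
    using Wpos wsum_mean(1)[of z] by (intro nn_integral_eq_integral) (auto simp: W_def elim!: eventually_mono)
  finally have nn: "(\<integral>\<^sup>+ t. ennreal (indicator {0<..} t * (1 - F z t)) \<partial>lborel) = ennreal (\<alpha> * (\<Sum>i<n. z i))"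
    by (simp add: W_def wsum_mean(2))
  have [measurable]: "F z \<in> borel_measurable borel"
    unfolding F_def by (rule smear_measurable) auto
  have "F z t \<le> 1" for t by (simp add: F_eq_prob)
  then show ?thesis
    using nn z \<alpha> by (intro has_bochner_integral_nn_integral) (auto simp: indicator_def intro!: mult_nonneg_nonneg sum_nonneg)
qed

text \<open>Equal means make the nonnegative difference of the tails integrate to 0. By continuity
  the distribution functions then agree everywhere, so the second moments agree, and these determine
  the sums of squares.\<close>

lemma dominated_imp_sum_squares_eq:
  assumes z: "\<And>j. j < n \<Longrightarrow> 0 \<le> z j" "i < n" "0 < z i"
    and w: "\<And>j. j < n \<Longrightarrow> 0 \<le> w j" "i' < n" "0 < w i'"
    and total: "(\<Sum>i<n. z i) = (\<Sum>i<n. w i)" and le: "\<And>x. 0 < x \<Longrightarrow> F z x \<le> F w x"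
  shows "(\<Sum>i<n. (z i)\<^sup>2) = (\<Sum>i<n. (w i)\<^sup>2)"
proof -
  define d where "d t = indicator {0<..} t * (1 - F z t) - indicator {0<..} t * (1 - F w t)" for t :: real
  have "has_bochner_integral lborel d (\<alpha> * (\<Sum>i<n. z i) - \<alpha> * (\<Sum>i<n. w i))"
    unfolding d_def using tail_integral[of z i, OF z] tail_integral[of w i', OF w]
    by (rule has_bochner_integral_diff)
  then have int: "integrable lborel d" and int0: "integral\<^sup>L lborel d = 0"
    using total by (auto simp: has_bochner_integral_iff)
  have "0 \<le> d t" for t using le[of t] by (auto simp: d_def indicator_def)
  then have ae: "AE t in lborel. d t = 0"
    using int0 integral_nonneg_eq_0_iff_AE[OF int] by simp
  have pos_eq: "F z x = F w x" if x: "0 < x" for x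
  proof (rule ccontr)
    assume "F z x \<noteq> F w x"
    then have "0 < F w x - F z x" using le[OF x] by simp
    moreover have "isCont (\<lambda>t. F w t - F z t) x"
      using z w x by (intro continuous_intros F_isCont[of i z] F_isCont[of i' w])
    then have "((\<lambda>t. F w t - F z t) \<longlongrightarrow> F w x - F z x) (nhds x)"
      using tendsto_at_iff_tendsto_nhds[of "\<lambda>t. F w t - F z t" x] unfolding isCont_def by simp
    ultimately have "eventually (\<lambda>t. 0 < F w t - F z t) (nhds x)"
      by (intro order_tendstoD(1))
    then obtain e where e: "0 < e" "\<And>t. dist t x < e \<Longrightarrow> 0 < F w t - F z t"
      by (auto simp: eventually_nhds_metric)
    have "AE t in lborel. t \<notin> {x<..<x + e}"
      using ae
    proof eventually_elim
      case (elim t)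
      show ?case
      proof
        assume "t \<in> {x<..<x + e}"
        then have "0 < F w t - F z t" "0 < t" using e(2)[of t] x by (auto simp: dist_real_def)
        then show False using elim by (simp add: d_def)
      qed
    qed
    then have "emeasure lborel {x<..<x + e} = 0"
      by (subst (asm) AE_iff_measurable[of "{x<..<x + e}"]) auto
    then show False using e(1) by simp
  qed
  note [measurable] = wsum_measurable[of "{..<n}", OF order_refl]
  have cdf: "cdf (distr M borel (wsum v {..<n})) x = F v x" for v x
    by (simp add: cdf_def measure_distr F_eq_prob vimage_def Int_def conj_commute)
  have zero: "F v x = 0" if "\<And>j. j < n \<Longrightarrow> 0 \<le> v j" "k < n" "0 < v k" "x \<le> 0" for v k x
  proof -
    have "AE \<omega> in M. \<not> wsum v {..<n} \<omega> \<le> x"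
      using wsum_pos[of v k] that by (auto elim!: eventually_mono)
    then have "emeasure M {\<omega> \<in> space M. wsum v {..<n} \<omega> \<le> x} = 0"
      by (subst (asm) AE_iff_measurable[OF _ refl]) auto
    then show ?thesis by (simp add: F_eq_prob measure_def)
  qed
  have "F z x = F w x" for x
    using pos_eq[of x] zero[of z i x] zero[of w i' x] z w by (cases "0 < x") auto
  then have "cdf (distr M borel (wsum z {..<n})) = cdf (distr M borel (wsum w {..<n}))"
    by (simp add: fun_eq_iff cdf)
  then have eq: "distr M borel (wsum z {..<n}) = distr M borel (wsum w {..<n})"
    by (intro cdf_unique real_distribution_distr) auto
  have "expectation (\<lambda>\<omega>. (wsum v {..<n} \<omega>)\<^sup>2) = (LINT y|distr M borel (wsum v {..<n}). y\<^sup>2)" for v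
    by (subst integral_distr) auto
  then have "expectation (\<lambda>\<omega>. (wsum z {..<n} \<omega>)\<^sup>2) = expectation (\<lambda>\<omega>. (wsum w {..<n} \<omega>)\<^sup>2)"
    using eq by simp
  then show ?thesis
    using total \<alpha> by (simp add: wsum_second_moment)
qed

end

theorem theorem3:
  fixes \<alpha> :: real and n :: nat and M :: "'a measure" and X :: "nat \<Rightarrow> 'a \<Rightarrow> real"
    and \<theta> \<eta> :: "real list"
  assumes "\<alpha> \<ge> 1"
    and "prob_space M"
    and "prob_space.indep_vars M (\<lambda>_. borel) X {..<n}"
    and "\<And>i. i < n \<Longrightarrow> distributed M lborel (X i) (\<lambda>t. ennreal (gamma_density \<alpha> t))"
    and "length \<theta> = n" and "length \<eta> = n"
    and "\<forall>w\<in>set \<theta>. w \<ge> 0" and "\<forall>w\<in>set \<eta>. w \<ge> 0"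
    and "\<eta> \<prec>\<^sub>m \<theta>"
    and "mset \<theta> \<noteq> mset \<eta>"
  defines "D \<equiv> \<lambda>x. weighted_sum_cdf M X \<eta> x - weighted_sum_cdf M X \<theta> x"
  shows "sign_changes_on {0<..} D = 1 \<and> (\<exists>x y. 0 < x \<and> x < y \<and> D x < 0 \<and> D y > 0)"
proof -
  interpret iid_gamma M X \<alpha> n
    using assms(1-4) by (simp add: iid_gamma_def iid_gamma_axioms_def)
  define a where "a i = sort \<eta> ! i" for i
  define b where "b i = sort \<theta> ! i" for i
  have sum_take: "sum_list (take m xs) = (\<Sum>i<m. xs ! i)" if "m \<le> length xs" for m and xs :: "real list"
    using that by (simp add: sum_list_sum_nth lessThan_atLeast0)
  have nn: "0 \<le> a i" "0 \<le> b i" if "i < n" for i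
    using that assms(5-8) nth_mem[of i "sort \<eta>"] nth_mem[of i "sort \<theta>"] by (auto simp: a_def b_def)
  have mono: "a i \<le> a j" "b i \<le> b j" if "i \<le> j" "j < n" for i j
    using that assms(5,6) by (auto simp: a_def b_def intro!: sorted_nth_mono)
  have heads: "(\<Sum>i<m. b i) \<le> (\<Sum>i<m. a i)" if "m \<le> n" for m
  proof (cases "m = 0")
    case False
    then have "m \<in> {1..length \<theta>}" using that assms(5) by simp
    then have "sum_list (take m (sort \<theta>)) \<le> sum_list (take m (sort \<eta>))"
      using assms(9) unfolding majorized_by_def by blast
    then show ?thesis
      using assms(5,6) that sum_take[of m "sort \<eta>"] sum_take[of m "sort \<theta>"]
      by (simp add: a_def b_def)
  qed simp
  have total: "(\<Sum>i<n. b i) = (\<Sum>i<n. a i)"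
  proof -
    have "sum_list (sort xs) = sum_list xs" for xs :: "real list"
      by (metis mset_sort sum_mset_sum_list)
    then show ?thesis
      using assms(5,6,9) sum_take[of n "sort \<eta>"] sum_take[of n "sort \<theta>"]
      by (simp add: majorized_by_def a_def b_def)
  qed
  have "sort \<theta> \<noteq> sort \<eta>" using assms(10) by (metis mset_sort)
  then obtain i0 where i0: "i0 < n" "a i0 \<noteq> b i0"
    using assms(5,6) nth_equalityI[of "sort \<theta>" "sort \<eta>"] by (force simp: a_def b_def)
  have squares: "(\<Sum>i<n. (a i)\<^sup>2) < (\<Sum>i<n. (b i)\<^sup>2)"
    using mono heads total i0 by (intro sum_squares_less_majorized) auto
  have "0 < (\<Sum>i<n. b i)"
  proof (rule ccontr)
    assume "\<not> 0 < (\<Sum>i<n. b i)"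
    then have z: "(\<Sum>i<n. b i) = 0" "(\<Sum>i<n. a i) = 0"
      using total nn(2) sum_nonneg[of "{..<n}" b] by auto
    have "a i0 = 0"
      using sum_nonneg_0[of "{..<n}" a i0] nn(1) z(2) i0(1) by simp
    moreover have "b i0 = 0"
      using sum_nonneg_0[of "{..<n}" b i0] nn(2) z(1) i0(1) by simp
    ultimately show False using i0 by simp
  qed
  then have "\<exists>i<n. 0 < a i" "\<exists>j<n. 0 < b j"
    using total sum_nonpos[of "{..<n}" a] sum_nonpos[of "{..<n}" b] by (force simp: not_less[symmetric])+
  then obtain i j where i: "i < n" "0 < a i" and j: "j < n" "0 < b j" by blast
  have D: "D x = F a x - F b x" for x
    using assms(5,6) by (simp add: D_def weighted_sum_cdf_eq_F a_def[abs_def] b_def[abs_def])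
  have single: "0 \<le> D y" if "0 < x" "x < y" "0 < D x" for x y
    using that single_crossing[OF nn(1) nn(2) mono(1) mono(2) heads total i j, of x y] by (simp add: D)
  have "\<exists>x>0. D x < 0"
  proof (rule ccontr)
    assume "\<not> (\<exists>x>0. D x < 0)"
    then have "F b x \<le> F a x" if "0 < x" for x using that by (force simp: D not_less)
    then have "(\<Sum>i<n. (b i)\<^sup>2) = (\<Sum>i<n. (a i)\<^sup>2)"
      using nn i j total by (intro dominated_imp_sum_squares_eq[of b j a i]) auto
    with squares show False by simp
  qed
  then obtain x where x: "0 < x" "D x < 0" by blast
  have "\<exists>y>0. 0 < D y"
  proof (rule ccontr)
    assume "\<not> (\<exists>y>0. 0 < D y)"
    then have "F a x \<le> F b x" if "0 < x" for x using that by (force simp: D not_less)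
    then have "(\<Sum>i<n. (a i)\<^sup>2) = (\<Sum>i<n. (b i)\<^sup>2)"
      using nn i j total by (intro dominated_imp_sum_squares_eq[of a i b j]) auto
    with squares show False by simp
  qed
  then obtain y where y: "0 < y" "0 < D y" by blast
  \<comment> \<open>In the opposite order \<open>D\<close> would be positive first and negative
    later, against \<open>single\<close>.\<close>
  have "x < y"
    using single[of y x] x y by (cases x y rule: linorder_cases) auto
  moreover have "sign_changes_on {0<..} D = 1"
    using single x y \<open>x < y\<close> by (intro sign_changes_eq_1)
  ultimately show ?thesis
    using x y by blast
qed

end
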